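(* Let $k$ be a field. For every affine algebraic equivariety $(V,\mathcal O_V)$ over $k$, there exists an affine scheme $Z$ over $k$ such that the subspace $Z_0\subseteq Z$ of closed points of $Z$ is dense in $Z$ and $(V,\mathcal O_V)$ is isomorphic, as a locally ringed space in $k$-algebras, to $Z_0$ (with the induced topology and the restriction of the structure sheaf of $Z$).
   Context: $k$ is an arbitrary field. An affine algebraic subvariety is the zero set $V\subseteq k^n$ of an ideal of $k[X_1,\ldots,X_n]$, with the Zariski topology and the sheaf $\mathcal O_V$ of regular functions: with $k[V]=k[X_1,\ldots,X_n]/\{f:\forall P\in V, f(P)=0\}$, for $U\subseteq V$ open, $\mathcal O_V(U)$ is the $k$-algebra of functions $f:U\to k$ such that each $P\in U$ has an open neighbourhood $U_P\subseteq U$ and $g,l\in k[V]$ with $l(Q)\neq0$, $f(Q)=g(Q)/l(Q)$ for all $Q\in U_P$. An affine algebraic equivariety over $k$ is a locally ringed space in $k$-algebras isomorphic to some affine algebraic subvariety with its sheaf of regular functions. For $Z=\mathrm{Spec}\,A$ and a subspace $Z_0\subseteq Z$, the restriction of the structure sheaf to $Z_0$ is the sheaf whose sections over an open $U\subseteq Z_0$ are the maps $s:U\to\coprod_{\mathfrak p\in U}A_{\mathfrak p}$, with $s(\mathfrak p)\in A_{\mathfrak p}$, such that each $\mathfrak p\in U$ has an open neighbourhood $U'\subseteq U$ and $a,b\in A$ with $b\notin\mathfrak q$ and $s(\mathfrak q)=a/b$ in $A_{\mathfrak q}$ for all $\mathfrak q\in U'$ (equivalently the inverse image sheaf $i^{-1}\mathcal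 O_Z$ along the inclusion $i:Z_0\to Z$). *)

theory Defs
  imports
    "HOL-Algebra.Module"
    "HOL-Algebra.QuotRing"
    "HOL-Analysis.Abstract_Topology"
    "HOL-Library.Poly_Mapping"
    "HOL-Library.FuncSet"
begin

section \<open>Algebras over a field\<close>

text \<open>The base field \<open>k\<close> is a type \<open>'k\<close> of class \<open>field\<close>; a \<open>k\<close>-algebra is a record satisfying
  the HOL-Algebra locale \<open>algebra\<close> (commutative, with unit, the zero ring being allowed)
  over \<open>base_field\<close>, which is \<open>'k\<close> as an algebra over itself.\<close>

definition base_field :: "('k::field, 'k) module" where
  "base_field = \<lparr>carrier = UNIV, monoid.mult = (*), one = 1, zero = 0, add = (+), module.smult = (*)\<rparr>"

lemma field_base_field: "field (base_field :: ('k::field, 'k) module)"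
proof -
  have cring: "cring (base_field :: ('k, 'k) module)"
    by (rule cringI, rule abelian_groupI, goal_cases)
      (auto simp: base_field_def algebra_simps intro: exI[of _ "- x" for x] intro!: comm_monoidI)
  show ?thesis
    by (rule cring.cring_fieldI2[OF cring]) (auto simp: base_field_def intro: right_inverse)
qed

abbreviation k_algebra :: "('k::field, 'a) module \<Rightarrow> bool" where
  "k_algebra A \<equiv> algebra base_field A"

definition alg_hom :: "('k::field, 'a) module \<Rightarrow> ('k, 'b) module \<Rightarrow> ('a \<Rightarrow> 'b) set" where
  "alg_hom A B = {h \<in> ring_hom A B.
     \<forall>c. \<forall>x\<in>carrier A. h (c \<odot>\<^bsub>A\<^esub> x) = c \<odot>\<^bsub>B\<^esub> h x}"

text \<open>The functions in \<open>C\<close>, defined on \<open>U\<close> (extensionally) with value at \<open>p\<close> in \<open>R p\<close>, with the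
  pointwise operations.\<close>

definition pointwise_algebra ::
    "'p set \<Rightarrow> ('p \<Rightarrow> ('k, 'v) module) \<Rightarrow> ('p \<Rightarrow> 'v) set \<Rightarrow> ('k, 'p \<Rightarrow> 'v) module" where
  "pointwise_algebra U R C =
     \<lparr>carrier = C,
      monoid.mult = (\<lambda>f g. \<lambda>p\<in>U. f p \<otimes>\<^bsub>R p\<^esub> g p),
      one = (\<lambda>p\<in>U. \<one>\<^bsub>R p\<^esub>),
      zero = (\<lambda>p\<in>U. \<zero>\<^bsub>R p\<^esub>),
      add = (\<lambda>f g. \<lambda>p\<in>U. f p \<oplus>\<^bsub>R p\<^esub> g p),
      module.smult = (\<lambda>c f. \<lambda>p\<in>U. c \<odot>\<^bsub>R p\<^esub> f p)\<rparr>"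

definition local_ring :: "('a, 'm) ring_scheme \<Rightarrow> bool" where
  "local_ring R \<longleftrightarrow> cring R \<and> (\<exists>!M. maximalideal M R)"

definition local_hom :: "('a, 'm) ring_scheme \<Rightarrow> ('b, 'n) ring_scheme \<Rightarrow> ('a \<Rightarrow> 'b) \<Rightarrow> bool" where
  "local_hom R S h \<longleftrightarrow> h \<in> ring_hom R S \<and>
     (\<forall>M N. maximalideal M R \<longrightarrow> maximalideal N S \<longrightarrow> h ` M \<subseteq> N)"

section \<open>Locally ringed spaces in \<open>k\<close>-algebras\<close>

text \<open>\<open>res E U W\<close> is the restriction from \<open>sect E U\<close> to \<open>sect E W\<close>, for \<open>W \<subseteq> U\<close>.\<close>

record ('k, 'p, 's) ringed_space =
  points :: "'p topology"
  sect :: "'p set \<Rightarrow> ('k, 's) module"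
  res :: "'p set \<Rightarrow> 'p set \<Rightarrow> 's \<Rightarrow> 's"

definition presheaf_of_algebras :: "('k::field, 'p, 's) ringed_space \<Rightarrow> bool" where
  "presheaf_of_algebras E \<longleftrightarrow>
     (\<forall>U. openin (points E) U \<longrightarrow> k_algebra (sect E U)) \<and>
     (\<forall>U W. openin (points E) U \<longrightarrow> openin (points E) W \<longrightarrow> W \<subseteq> U \<longrightarrow>
        res E U W \<in> alg_hom (sect E U) (sect E W)) \<and>
     (\<forall>U. openin (points E) U \<longrightarrow> (\<forall>s\<in>carrier (sect E U). res E U U s = s)) \<and>
     (\<forall>U W N. openin (points E) U \<longrightarrow> openin (points E) W \<longrightarrow> openin (points E) N \<longrightarrow>
        W \<subseteq> U \<longrightarrow> N \<subseteq> W \<longrightarrow>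
        (\<forall>s\<in>carrier (sect E U). res E W N (res E U W s) = res E U N s))"

definition sheaf_of_algebras :: "('k::field, 'p, 's) ringed_space \<Rightarrow> bool" where
  "sheaf_of_algebras E \<longleftrightarrow> presheaf_of_algebras E \<and>
     (\<forall>\<U> f. (\<forall>U\<in>\<U>. openin (points E) U \<and> f U \<in> carrier (sect E U)) \<longrightarrow>
        (\<forall>U\<in>\<U>. \<forall>W\<in>\<U>. res E U (U \<inter> W) (f U) = res E W (U \<inter> W) (f W)) \<longrightarrow>
        (\<exists>!s. s \<in> carrier (sect E (\<Union>\<U>)) \<and> (\<forall>U\<in>\<U>. res E (\<Union>\<U>) U s = f U)))"

text \<open>A germ at \<open>x\<close> is an equivalence class of pairs of an open neighbourhood of \<open>x\<close> and a section
  over it. The stalk operations are taken on representatives; the unions are over sets that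
  are all equal.\<close>

definition germ :: "('k, 'p, 's) ringed_space \<Rightarrow> 'p \<Rightarrow> 'p set \<Rightarrow> 's \<Rightarrow> ('p set \<times> 's) set" where
  "germ E x U s = {(W, t). openin (points E) W \<and> x \<in> W \<and> t \<in> carrier (sect E W) \<and>
     (\<exists>N. openin (points E) N \<and> x \<in> N \<and> N \<subseteq> U \<inter> W \<and> res E U N s = res E W N t)}"

definition stalk :: "('k, 'p, 's) ringed_space \<Rightarrow> 'p \<Rightarrow> ('p set \<times> 's) set ring" where
  "stalk E x =
     \<lparr>carrier = {germ E x U s |U s. openin (points E) U \<and> x \<in> U \<and> s \<in> carrier (sect E U)},
      monoid.mult = (\<lambda>c d. \<Union>(U, s)\<in>c. \<Union>(W, t)\<in>d. germ E x (U \<inter> W)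
        (res E U (U \<inter> W) s \<otimes>\<^bsub>sect E (U \<inter> W)\<^esub> res E W (U \<inter> W) t)),
      one = germ E x (topspace (points E)) \<one>\<^bsub>sect E (topspace (points E))\<^esub>,
      zero = germ E x (topspace (points E)) \<zero>\<^bsub>sect E (topspace (points E))\<^esub>,
      add = (\<lambda>c d. \<Union>(U, s)\<in>c. \<Union>(W, t)\<in>d. germ E x (U \<inter> W)
        (res E U (U \<inter> W) s \<oplus>\<^bsub>sect E (U \<inter> W)\<^esub> res E W (U \<inter> W) t))\<rparr>"

definition locally_ringed_space :: "('k::field, 'p, 's) ringed_space \<Rightarrow> bool" where
  "locally_ringed_space E \<longleftrightarrow> sheaf_of_algebras E \<and>
     (\<forall>x\<in>topspace (points E). local_ring (stalk E x))"

definition preimage :: "('k, 'p, 's) ringed_space \<Rightarrow> ('p \<Rightarrow> 'q) \<Rightarrow> 'q set \<Rightarrow> 'p set" where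
  "preimage E \<phi> U = {x \<in> topspace (points E). \<phi> x \<in> U}"

text \<open>A morphism \<open>E \<rightarrow> F\<close> is a continuous \<open>\<phi>\<close> together with homomorphisms \<open>\<psi> U\<close> from the sections of
  \<open>F\<close> over \<open>U\<close> to those of \<open>E\<close> over the preimage of \<open>U\<close>. \<open>stalk_map E \<phi> \<psi> x\<close> is the induced map
  from the stalk of \<open>F\<close> at \<open>\<phi> x\<close> to the stalk of \<open>E\<close> at \<open>x\<close>.\<close>

definition stalk_map :: "('k, 'p, 's) ringed_space \<Rightarrow> ('p \<Rightarrow> 'q) \<Rightarrow> ('q set \<Rightarrow> 't \<Rightarrow> 's) \<Rightarrow> 'p \<Rightarrow>
    ('q set \<times> 't) set \<Rightarrow> ('p set \<times> 's) set" where
  "stalk_map E \<phi> \<psi> x c = (\<Union>(U, s)\<in>c. germ E x (preimage E \<phi> U) (\<psi> U s))"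

definition lrs_morphism :: "('k::field, 'p, 's) ringed_space \<Rightarrow> ('k, 'q, 't) ringed_space \<Rightarrow>
    ('p \<Rightarrow> 'q) \<Rightarrow> ('q set \<Rightarrow> 't \<Rightarrow> 's) \<Rightarrow> bool" where
  "lrs_morphism E F \<phi> \<psi> \<longleftrightarrow>
     locally_ringed_space E \<and> locally_ringed_space F \<and>
     continuous_map (points E) (points F) \<phi> \<and>
     (\<forall>U. openin (points F) U \<longrightarrow> \<psi> U \<in> alg_hom (sect F U) (sect E (preimage E \<phi> U))) \<and>
     (\<forall>U W. openin (points F) U \<longrightarrow> openin (points F) W \<longrightarrow> W \<subseteq> U \<longrightarrow>
        (\<forall>s\<in>carrier (sect F U).
           \<psi> W (res F U W s) = res E (preimage E \<phi> U) (preimage E \<phi> W) (\<psi> U s))) \<and>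
     (\<forall>x\<in>topspace (points E). local_hom (stalk F (\<phi> x)) (stalk E x) (stalk_map E \<phi> \<psi> x))"

definition lrs_isomorphic ::
    "('k::field, 'p, 's) ringed_space \<Rightarrow> ('k, 'q, 't) ringed_space \<Rightarrow> bool" where
  "lrs_isomorphic E F \<longleftrightarrow>
     (\<exists>\<phi> \<psi> \<phi>' \<psi>'. lrs_morphism E F \<phi> \<psi> \<and> lrs_morphism F E \<phi>' \<psi>' \<and>
        (\<forall>x\<in>topspace (points E). \<phi>' (\<phi> x) = x) \<and>
        (\<forall>y\<in>topspace (points F). \<phi> (\<phi>' y) = y) \<and>
        (\<forall>W. openin (points E) W \<longrightarrow>
           (\<forall>s\<in>carrier (sect E W). \<psi> (preimage F \<phi>' W) (\<psi>' W s) = s)) \<and>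
        (\<forall>U. openin (points F) U \<longrightarrow>
           (\<forall>t\<in>carrier (sect F U). \<psi>' (preimage E \<phi> U) (\<psi> U t) = t)))"

section \<open>Affine algebraic subvarieties\<close>

text \<open>A polynomial maps monomials to coefficients, and a monomial maps variables \<open>i\<close>, standing for
  \<open>X\<close> with index \<open>i + 1\<close>, to exponents. Points of \<open>k\<close> to the \<open>n\<close> are extensional functions on
  \<open>{..<n}\<close>.\<close>

type_synonym 'k poly_n = "(nat \<Rightarrow>\<^sub>0 nat) \<Rightarrow>\<^sub>0 'k"

definition mpoly_ring :: "nat \<Rightarrow> 'k::field poly_n ring" where
  "mpoly_ring n =
     \<lparr>carrier = {f. \<forall>m\<in>Poly_Mapping.keys f. Poly_Mapping.keys m \<subseteq> {..<n}}, monoid.mult = (*), one = 1, zero = 0, add = (+)\<rparr>"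

definition monom_eval :: "(nat \<Rightarrow> 'k::field) \<Rightarrow> (nat \<Rightarrow>\<^sub>0 nat) \<Rightarrow> 'k" where
  "monom_eval P m = (\<Prod>i\<in>Poly_Mapping.keys m. P i ^ Poly_Mapping.lookup m i)"

definition poly_eval :: "'k::field poly_n \<Rightarrow> (nat \<Rightarrow> 'k) \<Rightarrow> 'k" where
  "poly_eval f P = (\<Sum>m\<in>Poly_Mapping.keys f. Poly_Mapping.lookup f m * monom_eval P m)"

definition affine_space :: "nat \<Rightarrow> (nat \<Rightarrow> 'k) set" where
  "affine_space n = {..<n} \<rightarrow>\<^sub>E UNIV"

definition zero_set :: "nat \<Rightarrow> 'k::field poly_n set \<Rightarrow> (nat \<Rightarrow> 'k) set" where
  "zero_set n S = {P \<in> affine_space n. \<forall>f\<in>S. poly_eval f P = 0}"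

definition affine_algebraic_subvariety :: "nat \<Rightarrow> (nat \<Rightarrow> 'k::field) set \<Rightarrow> bool" where
  "affine_algebraic_subvariety n V \<longleftrightarrow> (\<exists>I. ideal I (mpoly_ring n) \<and> V = zero_set n I)"

lemma monom_eval_superset:
  assumes "finite I" "Poly_Mapping.keys m \<subseteq> I"
  shows "monom_eval P m = (\<Prod>i\<in>I. P i ^ Poly_Mapping.lookup m i)"
  unfolding monom_eval_def
  by (rule prod.mono_neutral_left) (use assms in \<open>auto simp: in_keys_iff\<close>)

lemma monom_eval_add: "monom_eval P (a + b) = monom_eval P a * monom_eval P b"
proof -
  let ?I = "Poly_Mapping.keys a \<union> Poly_Mapping.keys b"
  have "monom_eval P (a + b) = (\<Prod>i\<in>?I. P i ^ Poly_Mapping.lookup (a + b) i)"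
    by (rule monom_eval_superset) (auto dest: subsetD[OF Poly_Mapping.keys_add])
  also have "\<dots> = (\<Prod>i\<in>?I. P i ^ Poly_Mapping.lookup a i) * (\<Prod>i\<in>?I. P i ^ Poly_Mapping.lookup b i)"
    by (simp add: lookup_add power_add prod.distrib)
  also have "\<dots> = monom_eval P a * monom_eval P b"
    by (simp add: monom_eval_superset[of ?I])
  finally show ?thesis .
qed

lemma poly_eval_superset:
  assumes "finite M" "Poly_Mapping.keys f \<subseteq> M"
  shows "poly_eval f P = (\<Sum>m\<in>M. Poly_Mapping.lookup f m * monom_eval P m)"
  unfolding poly_eval_def
  by (rule sum.mono_neutral_left) (use assms in \<open>auto simp: in_keys_iff\<close>)

lemma poly_eval_add: "poly_eval (f + g) P = poly_eval f P + poly_eval g P"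
proof -
  let ?M = "Poly_Mapping.keys f \<union> Poly_Mapping.keys g"
  have "poly_eval (f + g) P = (\<Sum>m\<in>?M. Poly_Mapping.lookup (f + g) m * monom_eval P m)"
    by (rule poly_eval_superset) (auto dest: subsetD[OF Poly_Mapping.keys_add])
  then show ?thesis
    by (simp add: lookup_add distrib_right sum.distrib poly_eval_superset[of ?M])
qed

lemma poly_eval_sum: "poly_eval (sum F I) P = (\<Sum>i\<in>I. poly_eval (F i) P)"
  by (induction I rule: infinite_finite_induct) (auto simp: poly_eval_add, auto simp: poly_eval_def)

lemma poly_eval_single: "poly_eval (Poly_Mapping.single m c) P = c * monom_eval P m"
  by (simp add: poly_eval_def)

lemma poly_eq_sum_single: "(f :: 'k::field poly_n) = (\<Sum>m\<in>Poly_Mapping.keys f. Poly_Mapping.single m (Poly_Mapping.lookup f m))"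
  by (rule poly_mapping_eqI) (auto simp: lookup_sum lookup_single when_def in_keys_iff)

lemma poly_eval_mult: "poly_eval (f * g) P = poly_eval f P * poly_eval g P"
proof -
  have "f * g = (\<Sum>a\<in>Poly_Mapping.keys f. \<Sum>b\<in>Poly_Mapping.keys g.
      Poly_Mapping.single a (Poly_Mapping.lookup f a) * Poly_Mapping.single b (Poly_Mapping.lookup g b))"
    by (subst poly_eq_sum_single[of f], subst poly_eq_sum_single[of g])
      (simp add: sum_product)
  then have "poly_eval (f * g) P = (\<Sum>a\<in>Poly_Mapping.keys f. \<Sum>b\<in>Poly_Mapping.keys g.
      (Poly_Mapping.lookup f a * Poly_Mapping.lookup g b) * (monom_eval P a * monom_eval P b))"
    by (simp add: poly_eval_sum mult_single poly_eval_single monom_eval_add)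
  also have "\<dots> = poly_eval f P * poly_eval g P"
    by (simp add: poly_eval_def sum_product mult_ac)
  finally show ?thesis .
qed

lemma mpoly_ring_mult_closed:
  assumes "f \<in> carrier (mpoly_ring n)" "g \<in> carrier (mpoly_ring n)"
  shows "f * g \<in> carrier (mpoly_ring n)"
proof -
  have "Poly_Mapping.keys m \<subseteq> {..<n}" if m: "m \<in> Poly_Mapping.keys (f * g)" for m
  proof -
    obtain a b where "m = a + b" "a \<in> Poly_Mapping.keys f" "b \<in> Poly_Mapping.keys g"
      using subsetD[OF keys_mult m] by auto
    then show ?thesis
      using assms Poly_Mapping.keys_add[of a b] by (fastforce simp: mpoly_ring_def)
  qed
  then show ?thesis by (auto simp: mpoly_ring_def)
qed

definition zariski_topology :: "nat \<Rightarrow> (nat \<Rightarrow> 'k::field) set \<Rightarrow> (nat \<Rightarrow> 'k) topology" where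
  "zariski_topology n V = topology (\<lambda>U. U \<subseteq> V \<and>
     (\<exists>S. S \<subseteq> carrier (mpoly_ring n) \<and> V - U = V \<inter> zero_set n S))"

lemma istopology_zariski:
  assumes V: "V \<subseteq> affine_space n"
  shows "istopology (\<lambda>U. U \<subseteq> V \<and> (\<exists>S. S \<subseteq> carrier (mpoly_ring n) \<and> V - U = V \<inter> zero_set n S))"
  (is "istopology ?L")
  unfolding istopology_def
proof (intro conjI allI impI)
  fix U W assume "?L U" "?L W"
  then obtain S T where *: "U \<subseteq> V" "W \<subseteq> V"
    "S \<subseteq> carrier (mpoly_ring n)" "V - U = V \<inter> zero_set n S"
    "T \<subseteq> carrier (mpoly_ring n)" "V - W = V \<inter> zero_set n T" by blast
  let ?P = "(\<lambda>(f, g). f * g) ` (S \<times> T)"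
  have "zero_set n ?P = zero_set n S \<union> zero_set n T"
    by (auto simp: zero_set_def poly_eval_mult)
  moreover have "V - U \<inter> W = (V - U) \<union> (V - W)" by blast
  ultimately have "V - U \<inter> W = V \<inter> zero_set n ?P" using * by blast
  moreover have "?P \<subseteq> carrier (mpoly_ring n)"
    using * by (auto intro!: mpoly_ring_mult_closed)
  ultimately show "U \<inter> W \<subseteq> V" "\<exists>S. S \<subseteq> carrier (mpoly_ring n) \<and> V - U \<inter> W = V \<inter> zero_set n S"
    using * by blast+
next
  fix \<K> assume K: "\<forall>K\<in>\<K>. ?L K"
  show "\<Union>\<K> \<subseteq> V" using K by blast
  obtain S where S: "\<And>K. K \<in> \<K> \<Longrightarrow> S K \<subseteq> carrier (mpoly_ring n) \<and> V - K = V \<inter> zero_set n (S K)"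
    using K by metis
  show "\<exists>S. S \<subseteq> carrier (mpoly_ring n) \<and> V - \<Union>\<K> = V \<inter> zero_set n S"
  proof -
    have "V \<inter> zero_set n (\<Union>K\<in>\<K>. S K) = {P \<in> V. \<forall>K\<in>\<K>. P \<in> V \<inter> zero_set n (S K)}"
      using V by (auto simp: zero_set_def)
    also have "\<dots> = {P \<in> V. \<forall>K\<in>\<K>. P \<in> V - K}"
      using S by (intro Collect_cong conj_cong ball_cong refl) simp
    also have "\<dots> = V - \<Union>\<K>" by blast
    finally have "V - \<Union>\<K> = V \<inter> zero_set n (\<Union>K\<in>\<K>. S K)" ..
    moreover have "(\<Union>K\<in>\<K>. S K) \<subseteq> carrier (mpoly_ring n)" using S by blast
    ultimately show ?thesis by blast
  qed
qed

lemma openin_zariski: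
  assumes "V \<subseteq> affine_space n"
  shows "openin (zariski_topology n V) U \<longleftrightarrow>
    U \<subseteq> V \<and> (\<exists>S. S \<subseteq> carrier (mpoly_ring n) \<and> V - U = V \<inter> zero_set n S)"
  unfolding zariski_topology_def topology_inverse'[OF istopology_zariski[OF assms]] ..

definition vanishing_ideal :: "nat \<Rightarrow> (nat \<Rightarrow> 'k::field) set \<Rightarrow> 'k poly_n set" where
  "vanishing_ideal n V = {f \<in> carrier (mpoly_ring n). \<forall>P\<in>V. poly_eval f P = 0}"

definition coordinate_ring :: "nat \<Rightarrow> (nat \<Rightarrow> 'k::field) set \<Rightarrow> 'k poly_n set ring" where
  "coordinate_ring n V = mpoly_ring n Quot vanishing_ideal n V"

text \<open>Elements of the coordinate ring are cosets, whose members all take the same value at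
  a point of \<open>V\<close>.\<close>

definition coset_eval :: "'k::field poly_n set \<Rightarrow> (nat \<Rightarrow> 'k) \<Rightarrow> 'k" where
  "coset_eval g P = (THE y. \<forall>f\<in>g. poly_eval f P = y)"

definition regular_functions ::
    "nat \<Rightarrow> (nat \<Rightarrow> 'k::field) set \<Rightarrow> (nat \<Rightarrow> 'k) set \<Rightarrow> ((nat \<Rightarrow> 'k) \<Rightarrow> 'k) set" where
  "regular_functions n V U = {f \<in> U \<rightarrow>\<^sub>E UNIV.
     \<forall>P\<in>U. \<exists>W. openin (zariski_topology n V) W \<and> P \<in> W \<and> W \<subseteq> U \<and>
       (\<exists>g\<in>carrier (coordinate_ring n V). \<exists>l\<in>carrier (coordinate_ring n V).
          \<forall>Q\<in>W. coset_eval l Q \<noteq> 0 \<and> f Q = coset_eval g Q / coset_eval l Q)}"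

definition subvariety_space ::
    "nat \<Rightarrow> (nat \<Rightarrow> 'k::field) set \<Rightarrow> ('k, nat \<Rightarrow> 'k, (nat \<Rightarrow> 'k) \<Rightarrow> 'k) ringed_space" where
  "subvariety_space n V =
     \<lparr>points = zariski_topology n V,
      sect = (\<lambda>U. pointwise_algebra U (\<lambda>_. base_field) (regular_functions n V U)),
      res = (\<lambda>U W f. restrict f W)\<rparr>"

definition affine_algebraic_equivariety :: "('k::field, 'p, 's) ringed_space \<Rightarrow> bool" where
  "affine_algebraic_equivariety E \<longleftrightarrow> locally_ringed_space E \<and>
     (\<exists>n V. affine_algebraic_subvariety n V \<and> lrs_isomorphic E (subvariety_space n V))"

section \<open>Affine schemes\<close>

definition spec_topology :: "('k, 'a) module \<Rightarrow> 'a set topology" where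
  "spec_topology A = topology (\<lambda>U. U \<subseteq> {p. primeideal p A} \<and>
     (\<exists>S. S \<subseteq> carrier A \<and> {p. primeideal p A} - U = {p. primeideal p A \<and> S \<subseteq> p}))"

lemma istopology_spec:
  assumes "k_algebra A"
  shows "istopology (\<lambda>U. U \<subseteq> {p. primeideal p A} \<and>
     (\<exists>S. S \<subseteq> carrier A \<and> {p. primeideal p A} - U = {p. primeideal p A \<and> S \<subseteq> p}))"
  (is "istopology ?L")
proof -
  interpret algebra base_field A by fact
  show ?thesis
    unfolding istopology_def
  proof (intro conjI allI impI)
    fix U W assume "?L U" "?L W"
    then obtain S T where *: "U \<subseteq> {p. primeideal p A}" "W \<subseteq> {p. primeideal p A}"
      "S \<subseteq> carrier A" "{p. primeideal p A} - U = {p. primeideal p A \<and> S \<subseteq> p}"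
      "T \<subseteq> carrier A" "{p. primeideal p A} - W = {p. primeideal p A \<and> T \<subseteq> p}" by blast
    let ?P = "(\<lambda>(f, g). f \<otimes>\<^bsub>A\<^esub> g) ` (S \<times> T)"
    have P: "?P \<subseteq> p \<longleftrightarrow> S \<subseteq> p \<or> T \<subseteq> p" if "primeideal p A" for p
    proof
      interpret p: primeideal p A by fact
      assume sub: "?P \<subseteq> p"
      show "S \<subseteq> p \<or> T \<subseteq> p"
      proof (rule ccontr)
        assume "\<not> ?thesis"
        then obtain f g where fg: "f \<in> S" "f \<notin> p" "g \<in> T" "g \<notin> p" by blast
        then have "f \<otimes>\<^bsub>A\<^esub> g \<in> p" using sub by force
        then show False using p.I_prime[of f g] fg * by blast
      qed
    next
      interpret p: primeideal p A by fact
      assume "S \<subseteq> p \<or> T \<subseteq> p"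
      then show "?P \<subseteq> p"
        using subsetD[OF *(3)] subsetD[OF *(5)] p.I_l_closed p.I_r_closed by auto
    qed
    have "{p. primeideal p A} - U \<inter> W = {p. primeideal p A \<and> S \<subseteq> p} \<union> {p. primeideal p A \<and> T \<subseteq> p}"
      using * by blast
    also have "\<dots> = {p. primeideal p A \<and> (S \<subseteq> p \<or> T \<subseteq> p)}"
      by blast
    also have "\<dots> = {p. primeideal p A \<and> ?P \<subseteq> p}"
      by (intro Collect_cong conj_cong refl P[symmetric])
    finally have "{p. primeideal p A} - U \<inter> W = {p. primeideal p A \<and> ?P \<subseteq> p}" .
    moreover have "?P \<subseteq> carrier A" using * by auto
    ultimately show "U \<inter> W \<subseteq> {p. primeideal p A}"
      "\<exists>S. S \<subseteq> carrier A \<and> {p. primeideal p A} - U \<inter> W = {p. primeideal p A \<and> S \<subseteq> p}"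
      using * by blast+
  next
    fix \<K> assume K: "\<forall>K\<in>\<K>. ?L K"
    show "\<Union>\<K> \<subseteq> {p. primeideal p A}" using K by blast
    have "\<forall>K\<in>\<K>. \<exists>S. S \<subseteq> carrier A \<and> {p. primeideal p A} - K = {p. primeideal p A \<and> S \<subseteq> p}"
      using K by (auto simp only:)
    from bchoice[OF this] obtain S where S: "\<And>K. K \<in> \<K> \<Longrightarrow>
        S K \<subseteq> carrier A \<and> {p. primeideal p A} - K = {p. primeideal p A \<and> S K \<subseteq> p}"
      by (elim exE) (rule that, erule bspec)
    have "{p. primeideal p A} - \<Union>\<K> = {p. primeideal p A \<and> (\<forall>K\<in>\<K>. p \<in> {p. primeideal p A} - K)}"
      by auto
    also have "\<dots> = {p. primeideal p A \<and> (\<forall>K\<in>\<K>. p \<in> {p. primeideal p A \<and> S K \<subseteq> p})}"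
      using S by (intro Collect_cong conj_cong ball_cong refl) simp
    also have "\<dots> = {p. primeideal p A \<and> (\<Union>K\<in>\<K>. S K) \<subseteq> p}" by auto
    finally have "{p. primeideal p A} - \<Union>\<K> = {p. primeideal p A \<and> (\<Union>K\<in>\<K>. S K) \<subseteq> p}" .
    moreover have "(\<Union>K\<in>\<K>. S K) \<subseteq> carrier A" using S by blast
    ultimately show "\<exists>S. S \<subseteq> carrier A \<and>
        {p. primeideal p A} - \<Union>\<K> = {p. primeideal p A \<and> S \<subseteq> p}" by blast
  qed
qed

lemma openin_spec:
  assumes "k_algebra A"
  shows "openin (spec_topology A) U \<longleftrightarrow> U \<subseteq> {p. primeideal p A} \<and>
     (\<exists>S. S \<subseteq> carrier A \<and> {p. primeideal p A} - U = {p. primeideal p A \<and> S \<subseteq> p})"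
  unfolding spec_topology_def topology_inverse'[OF istopology_spec[OF assms]] ..

text \<open>\<open>loc_frac A p a s\<close> is the fraction \<open>a/s\<close> in the localization of \<open>A\<close> at \<open>p\<close>, as an equivalence
  class of pairs.\<close>

definition loc_frac :: "('k, 'a) module \<Rightarrow> 'a set \<Rightarrow> 'a \<Rightarrow> 'a \<Rightarrow> ('a \<times> 'a) set" where
  "loc_frac A p a s = {(b, t). b \<in> carrier A \<and> t \<in> carrier A - p \<and>
     (\<exists>u\<in>carrier A - p. u \<otimes>\<^bsub>A\<^esub> (t \<otimes>\<^bsub>A\<^esub> a \<ominus>\<^bsub>A\<^esub> s \<otimes>\<^bsub>A\<^esub> b) = \<zero>\<^bsub>A\<^esub>)}"

definition localization :: "('k, 'a) module \<Rightarrow> 'a set \<Rightarrow> ('k, ('a \<times> 'a) set) module" where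
  "localization A p =
     \<lparr>carrier = {loc_frac A p a s |a s. a \<in> carrier A \<and> s \<in> carrier A - p},
      monoid.mult = (\<lambda>x y. \<Union>(a, s)\<in>x. \<Union>(b, t)\<in>y. loc_frac A p (a \<otimes>\<^bsub>A\<^esub> b) (s \<otimes>\<^bsub>A\<^esub> t)),
      one = loc_frac A p \<one>\<^bsub>A\<^esub> \<one>\<^bsub>A\<^esub>,
      zero = loc_frac A p \<zero>\<^bsub>A\<^esub> \<one>\<^bsub>A\<^esub>,
      add = (\<lambda>x y. \<Union>(a, s)\<in>x. \<Union>(b, t)\<in>y.
        loc_frac A p (t \<otimes>\<^bsub>A\<^esub> a \<oplus>\<^bsub>A\<^esub> s \<otimes>\<^bsub>A\<^esub> b) (s \<otimes>\<^bsub>A\<^esub> t)),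
      module.smult = (\<lambda>c x. \<Union>(a, s)\<in>x. loc_frac A p (c \<odot>\<^bsub>A\<^esub> a) s)\<rparr>"

definition spec_sections ::
    "('k, 'a) module \<Rightarrow> 'a set set \<Rightarrow> 'a set set \<Rightarrow> ('a set \<Rightarrow> ('a \<times> 'a) set) set" where
  "spec_sections A Z0 U = {s \<in> (\<Pi>\<^sub>E p\<in>U. carrier (localization A p)).
     \<forall>p\<in>U. \<exists>U'. openin (subtopology (spec_topology A) Z0) U' \<and> p \<in> U' \<and> U' \<subseteq> U \<and>
       (\<exists>a\<in>carrier A. \<exists>b\<in>carrier A. \<forall>q\<in>U'. b \<notin> q \<and> s q = loc_frac A q a b)}"

text \<open>The subspace \<open>Z0\<close> of \<open>Spec A\<close>, with the induced topology and the restriction of the structure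
  sheaf. For \<open>Z0\<close> the whole spectrum, this is the affine scheme \<open>Spec A\<close> itself.\<close>

definition spec_restriction ::
    "('k, 'a) module \<Rightarrow> 'a set set \<Rightarrow> ('k, 'a set, 'a set \<Rightarrow> ('a \<times> 'a) set) ringed_space" where
  "spec_restriction A Z0 =
     \<lparr>points = subtopology (spec_topology A) Z0,
      sect = (\<lambda>U. pointwise_algebra U (localization A) (spec_sections A Z0 U)),
      res = (\<lambda>U W s. restrict s W)\<rparr>"

definition Spec :: "('k, 'a) module \<Rightarrow> ('k, 'a set, 'a set \<Rightarrow> ('a \<times> 'a) set) ringed_space" where
  "Spec A = spec_restriction A {p. primeideal p A}"

definition closed_points :: "('k, 'p, 's) ringed_space \<Rightarrow> 'p set" where
  "closed_points Z = {z \<in> topspace (points Z). closedin (points Z) {z}}"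

end

theory Submission
  imports Defs "HOL-Computational_Algebra.Polynomial"
begin

text \<open>
  Let \<open>A\<close> be the ring of global regular functions. Localizing at the nowhere vanishing functions repairs the
  failure of the Nullstellensatz over a field that is not algebraically closed: an ideal of polynomials
  without common zero in \<open>k\<close> to the \<open>n\<close> contains a nowhere vanishing polynomial. For algebraically closed \<open>k\<close>
  this is the weak Nullstellensatz. Otherwise take a polynomial in one variable without roots; its
  homogenization combines finitely many generators of the ideal into one element whose zeros are exactly
  their common zeros. Such an element restricts to a unit of \<open>A\<close>, so every proper ideal of \<open>A\<close> vanishes at some
  point, and the closed points of the spectrum are the points of the variety. They are dense because an element
  of \<open>A\<close> vanishing at all points is zero. A regular function is locally a quotient of elements of \<open>A\<close>, and
  elements of the localization of \<open>A\<close> at a point are the germs of such quotients there, so the two sheaves agree.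
  Finally, isomorphisms carry all of this from the subvariety to an abstract equivariety.
\<close>

section \<open>Finite generation up to zeros\<close>

text \<open>The coordinate ring k[V] would not do: for k the reals and V the line, X^2 + 1 generates
  a closed point of Spec k[X] that comes from no point of V, although 1/(X^2 + 1) is regular on V.
  The homogenization of a polynomial without roots combines only finitely many polynomials, hence
  the need for a form of Hilbert's basis theorem. In the algebraically closed case a zero is found
  by extending homomorphisms one variable at a time; all computations take place in one polynomial
  type, modulo a prime ideal, so that no residue ring or fraction field has to be built. The
  localizations are never shown directly to be rings, nor the restricted structure sheaf to be a
  sheaf with local stalks: the bijection with regular functions respects all operations, and these
  properties are transported along it from the given space.\<close>

lemma nat_seq_incseq_subseq:
  fixes s :: "nat \<Rightarrow> nat"
  shows "\<exists>f :: nat \<Rightarrow> nat. strict_mono f \<and> incseq (\<lambda>j. s (f j))"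
proof -
  obtain f :: "nat \<Rightarrow> nat" where f: "strict_mono f" "monoseq (\<lambda>n. s (f n))"
    using seq_monosub[of s] by blast
  from f(2) consider "incseq (\<lambda>n. s (f n))" | "decseq (\<lambda>n. s (f n))"
    unfolding monoseq_iff by blast
  then show ?thesis
  proof cases
    case 1
    then show ?thesis using f(1) by blast
  next
    case 2
    \<comment> \<open>A decreasing sequence of naturals is constant from the place where it attains
      its least value.\<close>
    define v where "v = (LEAST v. v \<in> range (\<lambda>n. s (f n)))"
    have "v \<in> range (\<lambda>n. s (f n))"
      unfolding v_def by (rule LeastI_ex) blast
    then obtain N where N: "v = s (f N)" by blast
    have eq: "s (f (j + N)) = v" for j
    proof (rule antisym)
      show "s (f (j + N)) \<le> v"
        unfolding N by (rule decseqD[OF 2]) simp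
      show "v \<le> s (f (j + N))"
        unfolding v_def by (rule Least_le) blast
    qed
    have "strict_mono (\<lambda>j. f (j + N))"
      using f(1) by (auto simp: strict_mono_def)
    moreover have "incseq (\<lambda>j. s (f (j + N)))"
      by (simp add: eq incseq_def)
    ultimately show ?thesis by blast
  qed
qed

text \<open>The subsequence is refined one coordinate at a time; coordinates treated earlier remain
  increasing along a further subsequence.\<close>

lemma dickson_seq:
  fixes s :: "nat \<Rightarrow> 'a \<Rightarrow> nat"
  assumes "finite I"
  shows "\<exists>f :: nat \<Rightarrow> nat. strict_mono f \<and> (\<forall>i\<in>I. incseq (\<lambda>j. s (f j) i))"
  using assms
proof (induction I)
  case empty
  show ?case by (intro exI[of _ id]) (simp add: strict_mono_def)
next
  case (insert i I)
  then obtain f :: "nat \<Rightarrow> nat" where f: "strict_mono f" "\<forall>i\<in>I. incseq (\<lambda>j. s (f j) i)"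
    by blast
  obtain g :: "nat \<Rightarrow> nat" where g: "strict_mono g" "incseq (\<lambda>j. s (f (g j)) i)"
    using nat_seq_incseq_subseq[of "\<lambda>j. s (f j) i"] by blast
  have "incseq (\<lambda>j. s (f (g j)) i')" if "i' \<in> I" for i'
    using f(2) that g(1) by (auto simp: incseq_def strict_mono_less_eq)
  moreover have "strict_mono (\<lambda>j. f (g j))"
    using f(1) g(1) by (auto simp: strict_mono_def)
  ultimately show ?case
    using g(2) by (intro exI[of _ "\<lambda>j. f (g j)"]) auto
qed

definition monomials :: "nat \<Rightarrow> (nat \<Rightarrow>\<^sub>0 nat) set" where
  "monomials n = {m. Poly_Mapping.keys m \<subseteq> {..<n}}"

lemma mpoly_ring_carrier: "f \<in> carrier (mpoly_ring n) \<longleftrightarrow> Poly_Mapping.keys f \<subseteq> monomials n"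
  by (auto simp: mpoly_ring_def monomials_def)

text \<open>Along a subsequence on which the exponents of all \<open>n\<close> variables increase,
  the first term divides the second. The remaining exponents are zero, so the quotient
  \<open>t\<close> is an exact difference although subtraction of naturals truncates.\<close>

lemma dickson_pair:
  fixes s :: "nat \<Rightarrow> (nat \<Rightarrow>\<^sub>0 nat)"
  assumes s: "\<And>i. s i \<in> monomials n"
  obtains i j t where "i < j" "s j = s i + t" "t \<in> monomials n"
proof -
  obtain f :: "nat \<Rightarrow> nat" where f: "strict_mono f"
    "\<forall>i\<in>{..<n}. incseq (\<lambda>j. Poly_Mapping.lookup (s (f j)) i)"
    using dickson_seq[of "{..<n}" "\<lambda>j. Poly_Mapping.lookup (s j)"] by auto
  define t where "t = s (f 1) - s (f 0)"
  have le: "Poly_Mapping.lookup (s (f 0)) i \<le> Poly_Mapping.lookup (s (f 1)) i" for i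
  proof (cases "i < n")
    case True
    then show ?thesis using f(2) by (auto simp: incseq_def)
  next
    case False
    then have "i \<notin> Poly_Mapping.keys (s (f 0))" using s[of "f 0"] by (auto simp: monomials_def)
    then show ?thesis by (simp add: in_keys_iff)
  qed
  have "s (f 1) = s (f 0) + t"
    by (rule poly_mapping_eqI) (use le in \<open>simp add: t_def lookup_add lookup_minus\<close>)
  moreover have "Poly_Mapping.keys t \<subseteq> Poly_Mapping.keys (s (f 1))"
    by (auto simp: t_def in_keys_iff lookup_minus)
  then have "t \<in> monomials n" using s[of "f 1"] by (auto simp: monomials_def)
  moreover have "f 0 < f 1" using f(1) by (simp add: strict_mono_def)
  ultimately show ?thesis using that by blast
qed

text \<open>The order of exponent vectors is lexicographic, decided at the first place of
  difference. Zero is least because no exponent is negative, and sums are monotone; with the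
  well-foundedness below this is a monomial order.\<close>

lemma monomial_le_add: "(a :: nat \<Rightarrow>\<^sub>0 nat) \<le> a + t"
proof -
  have "0 \<le> t"
  proof (rule ccontr)
    assume "\<not> 0 \<le> t"
    then have "t < 0" by simp
    then show False by transfer (auto simp: less_fun_def)
  qed
  then show ?thesis by (metis add.right_neutral add_left_mono)
qed

text \<open>A strictly descending chain would contain a monomial dividing a later one, and a
  multiple is never smaller. Bounding the variables matters: in the lexicographic order the
  variables themselves form an infinite descending chain.\<close>

lemma wf_monomials: "wf {(a, b). a \<in> monomials n \<and> b \<in> monomials n \<and> a < b}"
  unfolding wf_iff_no_infinite_down_chain
proof
  assume "\<exists>s. \<forall>i. (s (Suc i), s i) \<in> {(a, b). a \<in> monomials n \<and> b \<in> monomials n \<and> a < b}"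
  then obtain s where s: "\<And>i. s i \<in> monomials n" "\<And>i. s (Suc i) < s i" by auto
  obtain i j t where ij: "i < j" "s j = s i + t" by (rule dickson_pair[of s n, OF s(1)])
  have "s j < s i" using ij(1)
  proof (induction j)
    case (Suc j)
    then show ?case using s(2)[of j] by (cases "i = j") (auto intro: less_trans)
  qed simp
  then show False using monomial_le_add[of "s i" t] ij(2) by simp
qed

text \<open>If no finite subset worked, elements of \<open>L\<close> could be picked one after
  another, none of them a multiple of an earlier one, against \<open>dickson_pair\<close>.\<close>

lemma dickson_finite:
  assumes L: "L \<subseteq> monomials n"
  shows "\<exists>G. finite G \<and> G \<subseteq> L \<and> (\<forall>m\<in>L. \<exists>g\<in>G. \<exists>t\<in>monomials n. m = g + t)"
proof (rule ccontr)
  assume *: "\<not> ?thesis"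
  have "\<exists>m. finite G \<and> G \<subseteq> L \<longrightarrow> m \<in> L \<and> (\<forall>g\<in>G. \<forall>t\<in>monomials n. m \<noteq> g + t)" for G
    using * by (cases "finite G \<and> G \<subseteq> L") auto
  then have "\<forall>G. \<exists>m. finite G \<and> G \<subseteq> L \<longrightarrow> m \<in> L \<and> (\<forall>g\<in>G. \<forall>t\<in>monomials n. m \<noteq> g + t)"
    by (rule allI)
  from choice[OF this] obtain pick where "\<forall>G. finite G \<and> G \<subseteq> L \<longrightarrow>
      pick G \<in> L \<and> (\<forall>g\<in>G. \<forall>t\<in>monomials n. pick G \<noteq> g + t)" ..
  then have pick: "pick G \<in> L" "\<And>g t. g \<in> G \<Longrightarrow> t \<in> monomials n \<Longrightarrow> pick G \<noteq> g + t"
    if "finite G" "G \<subseteq> L" for G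
    using that by auto
  \<comment> \<open>\<open>F i\<close> collects the first \<open>i\<close> picks; each new pick
    avoids the multiples of all of them.\<close>
  define F where "F = rec_nat {} (\<lambda>_ G. insert (pick G) G)"
  have F: "F 0 = {}" "\<And>i. F (Suc i) = insert (pick (F i)) (F i)" by (simp_all add: F_def)
  have fin: "finite (F i) \<and> F i \<subseteq> L" for i
  proof (induction i)
    case (Suc i)
    then show ?case using pick(1)[of "F i"] by (simp add: F)
  qed (simp add: F)
  have mem: "i < j \<Longrightarrow> pick (F i) \<in> F j" for i j
    by (induction j) (auto simp: F less_Suc_eq)
  have "pick (F i) \<in> monomials n" for i using pick(1)[of "F i"] fin[of i] L by auto
  then obtain i j t where "i < j" "pick (F j) = pick (F i) + t" "t \<in> monomials n"
    by (rule dickson_pair)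
  then show False using pick(2)[of "F j" "pick (F i)" t] fin mem by simp
qed


section \<open>Ideals of polynomials and leading monomials\<close>

text \<open>Ideals are stated with the type class operations on polynomials, so that the usual
  simplification rules for rings apply to their elements directly.\<close>

definition poly_ideal :: "nat \<Rightarrow> 'k::field poly_n set \<Rightarrow> bool" where
  "poly_ideal n J \<longleftrightarrow> J \<subseteq> carrier (mpoly_ring n) \<and> 0 \<in> J \<and>
     (\<forall>f\<in>J. \<forall>g\<in>J. f + g \<in> J) \<and> (\<forall>f\<in>J. \<forall>g\<in>carrier (mpoly_ring n). g * f \<in> J)"

lemma mpoly_ring_add_closed:
  "f \<in> carrier (mpoly_ring n) \<Longrightarrow> g \<in> carrier (mpoly_ring n) \<Longrightarrow> f + g \<in> carrier (mpoly_ring n)"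
  using Poly_Mapping.keys_add[of f g] by (auto simp: mpoly_ring_carrier)

lemma mpoly_ring_single: "m \<in> monomials n \<Longrightarrow> Poly_Mapping.single m c \<in> carrier (mpoly_ring n)"
  by (auto simp: mpoly_ring_carrier)

lemma mpoly_ring_const: "Poly_Mapping.single 0 c \<in> carrier (mpoly_ring n)"
  by (rule mpoly_ring_single) (simp add: monomials_def)

lemma mpoly_ring_one: "1 \<in> carrier (mpoly_ring n)"
  using mpoly_ring_const[of 1 n] by simp

lemma mpoly_ring_uminus:
  "f \<in> carrier (mpoly_ring n) \<Longrightarrow> - f \<in> carrier (mpoly_ring n)"
  by (simp add: mpoly_ring_carrier)

lemma poly_ideal_uminus: "poly_ideal n J \<Longrightarrow> f \<in> J \<Longrightarrow> - f \<in> J"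
  using mpoly_ring_uminus[OF mpoly_ring_one, of n] unfolding poly_ideal_def
  by (metis mult_minus1)

lemma poly_ideal_diff: "poly_ideal n J \<Longrightarrow> f \<in> J \<Longrightarrow> g \<in> J \<Longrightarrow> f - g \<in> J"
  using poly_ideal_uminus[of n J g] unfolding poly_ideal_def
  by (metis diff_conv_add_uminus)

text \<open>The leading monomial in the lexicographic order. At zero it is the maximum of the empty
  set and carries no information, whence the exclusion of zero below.\<close>

definition lead :: "'k::field poly_n \<Rightarrow> (nat \<Rightarrow>\<^sub>0 nat)" where
  "lead f = Max (Poly_Mapping.keys f)"

lemma lead_in_keys: "f \<noteq> 0 \<Longrightarrow> lead f \<in> Poly_Mapping.keys f"
  unfolding lead_def by (intro Max_in) auto

lemma le_lead: "m \<in> Poly_Mapping.keys f \<Longrightarrow> m \<le> lead f"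
  unfolding lead_def by (intro Max_ge) auto

lemma keys_single_mult:
  "Poly_Mapping.keys (Poly_Mapping.single t c * g) \<subseteq> (\<lambda>m. t + m) ` Poly_Mapping.keys g"
  using keys_mult[of "Poly_Mapping.single t c" g] by (auto split: if_splits)

lemma lookup_single_mult:
  "Poly_Mapping.lookup (Poly_Mapping.single t c * (g :: 'k::field poly_n)) (t + m) = c * Poly_Mapping.lookup g m"
proof -
  have "Poly_Mapping.single t c * g = (\<Sum>a\<in>Poly_Mapping.keys g. Poly_Mapping.single (t + a) (c * Poly_Mapping.lookup g a))"
    by (subst poly_eq_sum_single[of g]) (simp add: sum_distrib_left mult_single)
  then have "Poly_Mapping.lookup (Poly_Mapping.single t c * g) (t + m) =
      (\<Sum>a\<in>Poly_Mapping.keys g. if a = m then c * Poly_Mapping.lookup g a else 0)"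
    by (simp add: lookup_sum lookup_single when_def)
  then show ?thesis by (auto simp: in_keys_iff)
qed

text \<open>This is Hilbert's basis theorem, by a Groebner basis: the finite set consists of elements of \<open>J\<close>
  whose leading monomials generate all leading monomials of \<open>J\<close>.\<close>

lemma finite_same_zeros:
  assumes J: "poly_ideal n J"
  shows "\<exists>F. finite F \<and> F \<subseteq> J \<and> (\<forall>P. (\<forall>f\<in>F. poly_eval f P = 0) \<longrightarrow> (\<forall>f\<in>J. poly_eval f P = 0))"
proof -
  have JP: "f \<in> J \<Longrightarrow> Poly_Mapping.keys f \<subseteq> monomials n" for f
    using J mpoly_ring_carrier[of f n] by (auto simp: poly_ideal_def)
  have lJ: "lead f \<in> monomials n" if "f \<in> J - {0}" for f
    using that JP lead_in_keys[of f] by blast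
  then obtain G where G: "finite G" "G \<subseteq> lead ` (J - {0})"
    "\<forall>m\<in>lead ` (J - {0}). \<exists>g\<in>G. \<exists>t\<in>monomials n. m = g + t"
    using dickson_finite[of "lead ` (J - {0})" n] by blast
  obtain F where F: "finite F" "F \<subseteq> J - {0}" "G = lead ` F"
    using finite_subset_image[OF G(1,2)] by blast
  have "poly_eval f P = 0" if P: "\<forall>f\<in>F. poly_eval f P = 0" and "f \<in> J" for f P
  proof (cases "f = 0")
    case False
    \<comment> \<open>Well-founded induction on the leading monomial: subtracting a monomial
      multiple of an element of \<open>F\<close> cancels the leading term and leaves the value at
      \<open>P\<close> unchanged.\<close>
    have "\<forall>f\<in>J - {0}. lead f = m \<longrightarrow> poly_eval f P = 0" for m
    proof (induction m rule: wf_induct_rule[OF wf_monomials[of n]])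
      case (1 m)
      show ?case
      proof (intro ballI impI)
        fix f assume f: "f \<in> J - {0}" "lead f = m"
        obtain g t where gt: "g \<in> F" "t \<in> monomials n" "m = lead g + t"
          using f G(3) F(3) by blast
        \<comment> \<open>The scalar for which \<open>Poly_Mapping.single t c * g\<close> has the
          same leading coefficient as \<open>f\<close>.\<close>
        define c where "c = Poly_Mapping.lookup f m / Poly_Mapping.lookup g (lead g)"
        define h where "h = f - Poly_Mapping.single t c * g"
        have g0: "Poly_Mapping.lookup g (lead g) \<noteq> 0"
          using lead_in_keys[of g] gt(1) F(2) by (auto simp: in_keys_iff)
        have "g \<in> J" using gt(1) F(2) by blast
        then have "Poly_Mapping.single t c * g \<in> J"
          using J mpoly_ring_single[OF gt(2), of c] unfolding poly_ideal_def by blast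
        then have hJ: "h \<in> J" using poly_ideal_diff[OF J] f by (auto simp: h_def)
        have fh: "poly_eval f P = poly_eval h P"
          using P gt(1) poly_eval_add[of h "Poly_Mapping.single t c * g" P]
          by (simp add: h_def poly_eval_mult)
        show "poly_eval f P = 0"
        proof (cases "h = 0")
          case True
          then show ?thesis using fh by (simp add: poly_eval_def)
        next
          case False
          have k: "lead h \<in> Poly_Mapping.keys f \<union> (\<lambda>m. t + m) ` Poly_Mapping.keys g"
            using lead_in_keys[OF False] keys_single_mult[of t c g]
              keys_diff[of f "Poly_Mapping.single t c * g"] unfolding h_def by blast
          have "lead h \<le> m"
            using k
          proof
            assume "lead h \<in> Poly_Mapping.keys f"
            then show ?thesis using le_lead[of "lead h" f] f(2) by simp
          next
            assume "lead h \<in> (\<lambda>m. t + m) ` Poly_Mapping.keys g"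
            then show ?thesis using le_lead[of _ g] gt(3) add_left_mono[of _ "lead g" t]
              by (auto simp: add.commute)
          qed
          moreover have "Poly_Mapping.lookup h m = 0"
            using lookup_single_mult[of t c g "lead g"] g0
            by (simp add: h_def lookup_minus gt(3) add.commute[of _ t]) (simp add: c_def gt(3) add.commute[of _ t])
          then have "lead h \<noteq> m" using lead_in_keys[OF False] by (auto simp: in_keys_iff)
          ultimately have "lead h < m" by simp
          then have "poly_eval h P = 0" using 1 hJ False lJ f by blast
          then show ?thesis using fh by simp
        qed
      qed
    qed
    then show ?thesis using that False by blast
  qed (simp add: poly_eval_def)
  then show ?thesis using F by blast
qed

section \<open>Nowhere vanishing elements of ideals over a field that is not algebraically closed\<close>

lemma poly_eval_simps:
  "poly_eval 0 P = 0" "poly_eval 1 P = 1" "poly_eval (- f) P = - poly_eval f P"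
  "poly_eval (f - g) P = poly_eval f P - poly_eval g P"
  "poly_eval (f ^ m) P = poly_eval f P ^ m"
  "poly_eval (Poly_Mapping.single 0 c) P = c"
proof -
  show z: "poly_eval 0 P = 0" by (simp add: poly_eval_def)
  show o: "poly_eval 1 P = 1" by (simp add: poly_eval_def monom_eval_def)
  show u: "poly_eval (- f) P = - poly_eval f P" for f :: "'a poly_n"
    using poly_eval_add[of f "- f" P] z by (simp add: eq_neg_iff_add_eq_0 add.commute)
  show "poly_eval (f - g) P = poly_eval f P - poly_eval g P"
    using poly_eval_add[of f "- g" P] u by simp
  show "poly_eval (f ^ m) P = poly_eval f P ^ m"
    by (induction m) (simp_all add: o poly_eval_mult)
  show "poly_eval (Poly_Mapping.single 0 c) P = c"
    by (simp add: poly_eval_single monom_eval_def)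
qed

text \<open>The sum is the homogenization of \<open>q\<close> at (a, b); over the reals with q = X^2
  + 1 it is a^2 + b^2. For nonzero \<open>b\<close> it equals b^d q(a/b), where d is the degree of
  \<open>q\<close>; for b = 0 only the leading term survives.\<close>

lemma homogenization_zero_imp_origin:
  fixes q :: "'k::field poly"
  assumes "degree q > 0" "\<And>x. poly q x \<noteq> 0"
    and "(\<Sum>i\<le>degree q. coeff q i * a ^ i * b ^ (degree q - i)) = 0"
  shows "a = 0 \<and> b = 0"
proof (cases "b = 0")
  case True
  have "coeff q i * a ^ i * b ^ (degree q - i) = (if i = degree q then coeff q i * a ^ i else 0)" if "i \<le> degree q" for i
    using that by (auto simp: True power_0_left)
  then have "coeff q (degree q) * a ^ degree q = 0" using assms(3) by simp
  then show ?thesis using True assms(1) by auto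
next
  case False
  have "coeff q i * a ^ i * b ^ (degree q - i) = b ^ degree q * (coeff q i * (a / b) ^ i)" if "i \<le> degree q" for i
    using that False by (simp add: power_diff power_divide field_simps)
  then have "(\<Sum>i\<le>degree q. coeff q i * a ^ i * b ^ (degree q - i)) = b ^ degree q * poly q (a / b)"
    unfolding poly_altdef sum_distrib_left by (intro sum.cong) auto
  then have "b ^ degree q * poly q (a / b) = 0"
    using assms(3) by simp
  then show ?thesis using assms(2) False by simp
qed

lemma poly_ideal_sum: "poly_ideal n J \<Longrightarrow> (\<And>i. i \<in> I \<Longrightarrow> F i \<in> J) \<Longrightarrow> sum F I \<in> J"
  by (induction I rule: infinite_finite_induct) (auto simp: poly_ideal_def)

lemma mpoly_ring_power: "f \<in> carrier (mpoly_ring n) \<Longrightarrow> f ^ m \<in> carrier (mpoly_ring n)"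
  by (induction m) (auto simp: mpoly_ring_one mpoly_ring_mult_closed)

text \<open>The elements of \<open>F\<close> are absorbed one by one: if \<open>h\<close> stands for
  those already treated, the homogenization of \<open>q\<close> at \<open>f\<close> and
  \<open>h\<close> vanishes only where both do.\<close>

lemma ideal_common_zeros:
  fixes q :: "'k::field poly" and J :: "'k poly_n set"
  assumes q: "degree q > 0" "\<And>x. poly q x \<noteq> 0" and J: "poly_ideal n J" and "finite F" "F \<subseteq> J"
  shows "\<exists>h\<in>J. \<forall>P. poly_eval h P = 0 \<longrightarrow> (\<forall>f\<in>F. poly_eval f P = 0)"
  using assms(4,5)
proof (induction F)
  case empty
  show ?case using J by (auto simp: poly_ideal_def)
next
  case (insert f F)
  then obtain h where h: "h \<in> J" "\<And>P. poly_eval h P = 0 \<Longrightarrow> \<forall>f\<in>F. poly_eval f P = 0" by auto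
  let ?T = "\<lambda>i. Poly_Mapping.single 0 (coeff q i) * f ^ i * h ^ (degree q - i)"
  have C: "f \<in> carrier (mpoly_ring n)" "h \<in> carrier (mpoly_ring n)"
    using insert.prems h J by (auto simp: poly_ideal_def)
  \<comment> \<open>The exponents of \<open>f\<close> and \<open>h\<close> add up to the positive
    degree of \<open>q\<close>, so each term has a factor \<open>f\<close> (at the top index) or
    \<open>h\<close> (below it).\<close>
  have "?T i \<in> J" if "i \<le> degree q" for i
  proof (cases "i = degree q")
    case True
    then obtain d where "i = Suc d" using q(1) not0_implies_Suc by blast
    then have "?T i = (Poly_Mapping.single 0 (coeff q i) * f ^ d) * f" using True by (simp add: mult_ac)
    also have "\<dots> \<in> J"
      using J insert.prems C by (simp add: poly_ideal_def mpoly_ring_const mpoly_ring_mult_closed mpoly_ring_power)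
    finally show ?thesis .
  next
    case False
    then have "degree q - i \<noteq> 0" using that by simp
    then obtain d where d: "degree q - i = Suc d" using not0_implies_Suc by blast
    have "?T i = (Poly_Mapping.single 0 (coeff q i) * f ^ i * h ^ d) * h" by (simp add: d mult_ac)
    also have "\<dots> \<in> J"
      using J h C by (simp add: poly_ideal_def mpoly_ring_const mpoly_ring_mult_closed mpoly_ring_power)
    finally show ?thesis .
  qed
  then have "sum ?T {..degree q} \<in> J" by (intro poly_ideal_sum[OF J]) auto
  moreover have "\<forall>f'\<in>insert f F. poly_eval f' P = 0" if "poly_eval (sum ?T {..degree q}) P = 0" for P
  proof -
    have "poly_eval f P = 0 \<and> poly_eval h P = 0"
      by (rule homogenization_zero_imp_origin[OF q]) (use that in \<open>simp add: poly_eval_sum poly_eval_mult poly_eval_simps\<close>)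
    then show ?thesis using h(2) by auto
  qed
  ultimately show ?case by blast
qed


section \<open>Points over an algebraically closed field\<close>

text \<open>Subrings are subsets of one ring type: the polynomials in the first \<open>i\<close>
  variables, for varying \<open>i\<close>, then share a type, and an induction on \<open>i\<close>
  can pass between them.\<close>

definition subring_of :: "'c::comm_ring_1 set \<Rightarrow> bool" where
  "subring_of D \<longleftrightarrow> 0 \<in> D \<and> 1 \<in> D \<and> (\<forall>x\<in>D. \<forall>y\<in>D. x + y \<in> D \<and> x * y \<in> D) \<and> (\<forall>x\<in>D. - x \<in> D)"

definition polys_over :: "'c::comm_ring_1 set \<Rightarrow> 'c poly set" where
  "polys_over D = {p. \<forall>i. coeff p i \<in> D}"

lemma subring_of_sum: "subring_of D \<Longrightarrow> (\<And>i. i \<in> I \<Longrightarrow> F i \<in> D) \<Longrightarrow> sum F I \<in> D"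
  by (induction I rule: infinite_finite_induct) (auto simp: subring_of_def)

lemma subring_of_power: "subring_of D \<Longrightarrow> x \<in> D \<Longrightarrow> x ^ m \<in> D"
  by (induction m) (auto simp: subring_of_def)

lemma subring_of_polys_over:
  assumes D: "subring_of D"
  shows "subring_of (polys_over D)"
  unfolding subring_of_def
proof (intro conjI ballI)
  show "p * q \<in> polys_over D" if "p \<in> polys_over D" "q \<in> polys_over D" for p q
    using that D
    by (auto simp: polys_over_def coeff_mult subring_of_def intro!: subring_of_sum[OF D])
qed (use D in \<open>auto simp: polys_over_def subring_of_def\<close>)

lemma polys_over_monom: "subring_of D \<Longrightarrow> c \<in> D \<Longrightarrow> monom c j \<in> polys_over D"
  by (auto simp: polys_over_def subring_of_def)

lemma polys_over_const: "subring_of D \<Longrightarrow> c \<in> D \<Longrightarrow> [:c:] \<in> polys_over D"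
  using polys_over_monom[of D c 0] by (simp add: monom_0)

lemma subring_of_poly:
  assumes "subring_of E" "p \<in> polys_over E" "a \<in> E"
  shows "poly p a \<in> E"
  unfolding poly_altdef using assms
  by (intro subring_of_sum) (auto simp: subring_of_def polys_over_def subring_of_power)

text \<open>A prime ideal of the subring \<open>E\<close>. The residue domain is not constructed; an
  element counts as zero when it lies in \<open>M\<close>, and primality says that products of
  elements of \<open>E\<close> outside \<open>M\<close> stay outside.\<close>

definition prime_in :: "'c::comm_ring_1 set \<Rightarrow> 'c set \<Rightarrow> bool" where
  "prime_in E M \<longleftrightarrow> M \<subseteq> E \<and> 0 \<in> M \<and> 1 \<notin> M \<and> (\<forall>x\<in>M. \<forall>y\<in>M. x + y \<in> M) \<and>
     (\<forall>x\<in>M. \<forall>y\<in>E. y * x \<in> M) \<and> (\<forall>x\<in>E. \<forall>y\<in>E. x * y \<in> M \<longrightarrow> x \<in> M \<or> y \<in> M)"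

lemma prime_in_power: "subring_of E \<Longrightarrow> prime_in E M \<Longrightarrow> x \<in> E - M \<Longrightarrow> x ^ m \<in> E - M"
proof (induction m)
  case 0
  then show ?case by (simp add: prime_in_def subring_of_def)
next
  case (Suc m)
  then have "x \<in> E" "x ^ m \<in> E" "x \<notin> M" "x ^ m \<notin> M" by auto
  then show ?case using Suc.prems(1,2) by (simp add: prime_in_def subring_of_def) blast
qed

text \<open>Division with remainder without inverting the leading coefficient \<open>c\<close>: each
  cancellation of the leading term of \<open>h\<close> is paid for by one more factor
  \<open>c\<close>.\<close>

lemma pseudo_division:
  assumes D: "subring_of D" and f: "f \<in> polys_over D" "f \<noteq> 0" and c: "c = coeff f (degree f)"
  shows "h \<in> polys_over D \<Longrightarrow> \<exists>N. \<exists>q\<in>polys_over D. \<exists>r\<in>polys_over D.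
    [:c ^ N:] * h = q * f + r \<and> (r = 0 \<or> degree r < degree f)"
proof (induction "degree h" arbitrary: h rule: less_induct)
  case less
  note S = subring_of_polys_over[OF D]
  have cD: "c \<in> D" using f c by (auto simp: polys_over_def)
  show ?case
  proof (cases "h = 0 \<or> degree h < degree f")
    case True
    then show ?thesis using less.prems S
      by (intro exI[of _ 0] bexI[of _ 0] bexI[of _ h]) (auto simp: subring_of_def one_pCons[symmetric])
  next
    case False
    \<comment> \<open>Chosen so that \<open>t * f\<close> and \<open>[:c:] * h\<close> have the same
      coefficient at \<open>degree h\<close>.\<close>
    define t where "t = monom (coeff h (degree h)) (degree h - degree f)"
    define h1 where "h1 = [:c:] * h - t * f"
    have tD: "t \<in> polys_over D"
      unfolding t_def using less.prems D by (intro polys_over_monom) (auto simp: polys_over_def)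
    have h1D: "h1 \<in> polys_over D"
      using polys_over_const[OF D cD] tD less.prems f S unfolding h1_def subring_of_def
      by (metis diff_conv_add_uminus)
    have top: "coeff h1 (degree h) = 0"
      using coeff_monom_mult[of "coeff h (degree h)" "degree h - degree f" f "degree h"] False
      by (simp add: h1_def t_def c mult.commute)
    have "degree (t * f) \<le> degree h"
      using degree_mult_le[of t f] degree_monom_le[of "coeff h (degree h)" "degree h - degree f"] False
      unfolding t_def by linarith
    then have le: "degree h1 \<le> degree h"
      unfolding h1_def by (intro degree_diff_le) (auto intro: degree_smult_le)
    have eq: "[:c:] * h = h1 + t * f" by (simp add: h1_def)
    show ?thesis
    proof (cases "h1 = 0 \<or> degree h1 < degree f")
      case True
      then show ?thesis using eq tD h1D
        by (intro exI[of _ 1] bexI[of _ t] bexI[of _ h1]) auto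
    next
      case h1: False
      have "degree h1 \<noteq> degree h" using top h1 leading_coeff_0_iff[of h1] by metis
      then have "degree h1 < degree h" using le by simp
      from less.hyps[OF this h1D] obtain N q r where *: "q \<in> polys_over D" "r \<in> polys_over D"
        "[:c ^ N:] * h1 = q * f + r" "r = 0 \<or> degree r < degree f" by blast
      have "[:c ^ Suc N:] * h = [:c ^ N:] * ([:c:] * h)" by (simp add: mult.commute)
      also have "\<dots> = (q + [:c ^ N:] * t) * f + r"
        unfolding eq using *(3) by (simp add: algebra_simps smult_add_right)
      finally have "[:c ^ Suc N:] * h = (q + [:c ^ N:] * t) * f + r" .
      moreover have "q + [:c ^ N:] * t \<in> polys_over D"
        using *(1) tD S polys_over_const[OF D subring_of_power[OF D cD, of N]] unfolding subring_of_def by blast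
      ultimately show ?thesis using * by blast
    qed
  qed
qed

text \<open>Here \<open>Q\<close> is read as an ideal modulo \<open>M\<close>: \<open>f\<close> has
  least degree among the elements that do not vanish modulo \<open>M\<close>, normalized so that its
  leading coefficient lies outside \<open>M\<close>. Pseudo-division by \<open>f\<close> leaves a
  remainder in \<open>Q\<close> of smaller degree, which by minimality vanishes modulo
  \<open>M\<close>.\<close>

lemma minimal_element:
  assumes D: "subring_of D" and Q: "Q \<subseteq> polys_over D"
    and QM: "polys_over D \<inter> polys_over M \<subseteq> Q"
    and Qadd: "\<And>p q. p \<in> Q \<Longrightarrow> q \<in> Q \<Longrightarrow> p + q \<in> Q"
    and Qmul: "\<And>p q. p \<in> Q \<Longrightarrow> q \<in> polys_over D \<Longrightarrow> q * p \<in> Q"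
    and M: "0 \<in> M" "\<And>x y. x \<in> M \<Longrightarrow> - x \<in> M"
    and ne: "\<not> Q \<subseteq> polys_over M"
  shows "\<exists>f\<in>Q. coeff f (degree f) \<notin> M \<and>
    (\<forall>h\<in>Q - polys_over M. \<exists>i\<ge>degree f. coeff h i \<notin> M) \<and>
    (\<forall>h\<in>Q. \<exists>N. \<exists>q\<in>polys_over D. \<exists>r\<in>polys_over D \<inter> polys_over M.
       [:coeff f (degree f) ^ N:] * h = q * f + r)"
proof -
  note S = subring_of_polys_over[OF D]
  have Quminus: "- p \<in> Q" if "p \<in> Q" for p
    using Qmul[OF that, of "- 1"] S by (simp add: subring_of_def)
  \<comment> \<open>Cutting \<open>h\<close> off above its last coefficient outside \<open>M\<close>
    changes it by a polynomial over \<open>M\<close>, which lies in \<open>Q\<close> by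
    \<open>QM\<close>.\<close>
  have trunc: "\<exists>h'\<in>Q. coeff h' (degree h') \<notin> M \<and> degree h' \<le> degree h \<and> coeff h (degree h') \<notin> M"
    if "h \<in> Q - polys_over M" for h
  proof -
    let ?I = "{i. coeff h i \<notin> M}"
    have sub: "?I \<subseteq> {..degree h}" using M(1) by (auto intro: le_degree)
    then have fin: "finite ?I" by (rule finite_subset) simp
    have ne: "?I \<noteq> {}" using that by (auto simp: polys_over_def)
    define i where "i = Max ?I"
    have i: "coeff h i \<notin> M" using Max_in[OF fin ne] by (simp add: i_def)
    have above: "coeff h j \<in> M" if "j > i" for j
      using that Max_ge[OF fin, of j] unfolding i_def by fastforce
    define h' where "h' = poly_cutoff (Suc i) h"
    have ch': "coeff h' j = (if j \<le> i then coeff h j else 0)" for j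
      by (simp add: h'_def coeff_poly_cutoff less_Suc_eq_le)
    have dh': "degree h' = i"
    proof (rule antisym)
      show "degree h' \<le> i" by (rule degree_le) (simp add: ch')
      show "i \<le> degree h'" by (rule le_degree) (use i M(1) in \<open>auto simp: ch'\<close>)
    qed
    have hD: "coeff h j \<in> D" for j using that Q by (auto simp: polys_over_def)
    have "h' - h \<in> polys_over D \<inter> polys_over M"
      using D hD above M by (auto simp: polys_over_def ch' subring_of_def)
    then have "h' - h \<in> Q" using QM by blast
    then have "h' \<in> Q" using Qadd[of "h' - h" h] that by simp
    moreover have "i \<le> degree h" using i sub by auto
    ultimately show ?thesis using dh' ch' i by (intro bexI[of _ h']) auto
  qed
  define P where "P = (\<lambda>d. \<exists>f\<in>Q. coeff f (degree f) \<notin> M \<and> degree f = d)"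
  have "\<exists>d. P d" using ne trunc unfolding P_def by blast
  then have "P (LEAST d. P d)" by (rule LeastI_ex)
  then obtain f where f: "f \<in> Q" "coeff f (degree f) \<notin> M" "degree f = (LEAST d. P d)"
    unfolding P_def by blast
  have min: "\<exists>i\<ge>degree f. coeff h i \<notin> M" if h: "h \<in> Q - polys_over M" for h
  proof -
    obtain h' where h': "h' \<in> Q" "coeff h' (degree h') \<notin> M" "coeff h (degree h') \<notin> M"
      using trunc[OF h] by blast
    have "degree f \<le> degree h'" unfolding f(3) by (rule Least_le) (use h' in \<open>auto simp: P_def\<close>)
    then show ?thesis using h' by blast
  qed
  have "\<exists>N. \<exists>q\<in>polys_over D. \<exists>r\<in>polys_over D \<inter> polys_over M.
       [:coeff f (degree f) ^ N:] * h = q * f + r" if h: "h \<in> Q" for h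
  proof -
    have fD: "f \<in> polys_over D" and f0: "f \<noteq> 0" using f Q M(1) by auto
    obtain N q r where *: "q \<in> polys_over D" "r \<in> polys_over D"
        "[:coeff f (degree f) ^ N:] * h = q * f + r" "r = 0 \<or> degree r < degree f"
      using pseudo_division[OF D fD f0 refl, of h] h Q by blast
    have "[:coeff f (degree f) ^ N:] \<in> polys_over D"
      using fD by (intro polys_over_const[OF D] subring_of_power[OF D]) (auto simp: polys_over_def)
    then have "[:coeff f (degree f) ^ N:] * h + - (q * f) \<in> Q"
      using Qadd Qmul Quminus f h *(1) by blast
    then have "r \<in> Q" using *(3) by simp
    \<comment> \<open>These coefficients are zero, so \<open>min\<close> leaves no coefficient of
      \<open>r\<close> outside \<open>M\<close>.\<close>
    moreover have "coeff r i \<in> M" if "i \<ge> degree f" for i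
      using *(4) that M(1) coeff_eq_0[of r i] by force
    ultimately have "r \<in> polys_over M" using min[of r] by blast
    then show ?thesis using * by blast
  qed
  then show ?thesis using f min by blast
qed


section \<open>Extension of homomorphisms into a field\<close>

text \<open>Homomorphisms are defined on a whole ring type, as evaluation of polynomials at a point
  is; conditions relative to a subring are stated separately.\<close>

definition ring_map :: "('c::comm_ring_1 \<Rightarrow> 'k::field) \<Rightarrow> bool" where
  "ring_map \<phi> \<longleftrightarrow> \<phi> 0 = 0 \<and> \<phi> 1 = 1 \<and> (\<forall>x y. \<phi> (x + y) = \<phi> x + \<phi> y) \<and> (\<forall>x y. \<phi> (x * y) = \<phi> x * \<phi> y)"

lemma ring_map_sum: "ring_map \<phi> \<Longrightarrow> \<phi> (sum F I) = (\<Sum>i\<in>I. \<phi> (F i))"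
  by (induction I rule: infinite_finite_induct) (auto simp: ring_map_def)

lemma ring_map_power: "ring_map \<phi> \<Longrightarrow> \<phi> (x ^ m) = \<phi> x ^ m"
  by (induction m) (auto simp: ring_map_def)

lemma ring_map_poly_add: "ring_map \<phi> \<Longrightarrow> map_poly \<phi> (p + q) = map_poly \<phi> p + map_poly \<phi> q"
  by (rule poly_eqI) (simp add: coeff_map_poly ring_map_def)

lemma ring_map_poly_mult: "ring_map \<phi> \<Longrightarrow> map_poly \<phi> (p * q) = map_poly \<phi> p * map_poly \<phi> q"
proof (rule poly_eqI)
  fix i
  assume *: "ring_map \<phi>"
  then have "\<phi> 0 = 0" "\<And>x y. \<phi> (x * y) = \<phi> x * \<phi> y" by (auto simp: ring_map_def)
  then show "coeff (map_poly \<phi> (p * q)) i = coeff (map_poly \<phi> p * map_poly \<phi> q) i"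
    by (simp add: coeff_mult coeff_map_poly ring_map_sum[OF *])
qed

lemma ring_map_poly_const: "ring_map \<phi> \<Longrightarrow> map_poly \<phi> [:c:] = [:\<phi> c:]"
  by (simp add: map_poly_pCons ring_map_def)

text \<open>In a finite field the product of all X - a, plus one, takes the value one everywhere and
  would be a polynomial of positive degree without roots.\<close>

lemma alg_closed_infinite:
  assumes "\<And>p :: 'k::field poly. degree p > 0 \<Longrightarrow> \<exists>x. poly p x = 0"
  shows "infinite (UNIV :: 'k set)"
proof
  assume fin: "finite (UNIV :: 'k set)"
  define p :: "'k poly" where "p = (\<Prod>a\<in>UNIV. [:- a, 1:]) + 1"
  have dp: "degree (\<Prod>a\<in>(UNIV :: 'k set). [:- a, 1:]) = card (UNIV :: 'k set)"
    by (subst degree_prod_eq_sum_degree) (auto simp: fin)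
  have "card (UNIV :: 'k set) > 0" using fin by (simp add: card_gt_0_iff)
  then have "degree p > 0"
    unfolding p_def by (subst degree_add_eq_left) (auto simp: dp)
  then obtain x where "poly p x = 0" using assms by blast
  moreover have "poly p x = 1" for x
    using fin by (auto simp: p_def poly_prod intro!: prod_zero bexI[of _ x])
  ultimately show False by simp
qed

text \<open>Homomorphisms from \<open>D\<close> modulo \<open>M\<close> to an algebraically closed field extend to \<open>D[a]\<close> without killing
  \<open>pe(a)\<close>, provided they do not kill \<open>d\<close>. If \<open>a\<close> is transcendental modulo \<open>M\<close>, it is sent to a non-root of
  the image of \<open>pe\<close>, and \<open>d\<close> is a coefficient of \<open>pe\<close>. Otherwise \<open>a\<close> is sent to a root of the image of a
  relation \<open>f\<close> of least degree, and \<open>d\<close> is the product of the leading coefficient of \<open>f\<close> and an element of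
  \<open>D\<close> in the ideal generated by the relations and \<open>pe\<close>.\<close>

lemma ring_map_extension:
  fixes a :: "'c::comm_ring_1"
  assumes ac: "\<And>p :: 'k::field poly. degree p > 0 \<Longrightarrow> \<exists>x. poly p x = 0"
    and E: "subring_of E" and D: "subring_of D" "D \<subseteq> E" and a: "a \<in> E" and M: "prime_in E M"
    and pe: "pe \<in> polys_over D" "poly pe a \<notin> M"
  shows "\<exists>d\<in>D - M. \<forall>\<phi> :: 'c \<Rightarrow> 'k. ring_map \<phi> \<longrightarrow> (\<forall>m\<in>D \<inter> M. \<phi> m = 0) \<longrightarrow> \<phi> d \<noteq> 0 \<longrightarrow>
    (\<exists>x. (\<forall>p\<in>polys_over D. poly p a \<in> M \<longrightarrow> poly (map_poly \<phi> p) x = 0) \<and> poly (map_poly \<phi> pe) x \<noteq> 0)"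
proof -
  note S = subring_of_polys_over[OF D(1)]
  \<comment> \<open>The relations of \<open>a\<close> modulo \<open>M\<close>: the kernel of
    evaluation at \<open>a\<close> followed by reduction modulo \<open>M\<close>, and thus a prime
    ideal.\<close>
  define K where "K = {p \<in> polys_over D. poly p a \<in> M}"
  have evE: "poly p a \<in> E" if "p \<in> polys_over D" for p
    using that D a by (intro subring_of_poly[OF E]) (auto simp: polys_over_def)
  have Mneg: "- x \<in> M" if "x \<in> M" for x
  proof -
    have "- 1 \<in> E" using E by (auto simp: subring_of_def)
    then have "- 1 * x \<in> M" using M that unfolding prime_in_def by blast
    then show ?thesis by simp
  qed
  have M0: "0 \<in> M" using M by (simp add: prime_in_def)
  have Msum: "(\<And>i. i \<in> I \<Longrightarrow> F i \<in> M) \<Longrightarrow> sum F I \<in> M" for F :: "nat \<Rightarrow> 'c" and I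
    by (induction I rule: infinite_finite_induct) (use M M0 in \<open>auto simp: prime_in_def\<close>)
  have MxK: "polys_over D \<inter> polys_over M \<subseteq> K"
  proof
    fix p assume p: "p \<in> polys_over D \<inter> polys_over M"
    have "a ^ i * coeff p i \<in> M" for i
      using M p subring_of_power[OF E a] unfolding prime_in_def polys_over_def by blast
    then have "poly p a \<in> M" unfolding poly_altdef by (intro Msum) (simp add: mult.commute)
    then show "p \<in> K" using p by (simp add: K_def)
  qed
  have Kadd: "p + q \<in> K" if "p \<in> K" "q \<in> K" for p q
    using that S M unfolding K_def subring_of_def prime_in_def by simp
  have Kmul: "q * p \<in> K" if "p \<in> K" "q \<in> polys_over D" for p q
    using that S M evE[of q] unfolding K_def subring_of_def prime_in_def by simp
  have Kprime: "p \<in> K \<or> q \<in> K" if "p \<in> polys_over D" "q \<in> polys_over D" "p * q \<in> K" for p q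
    using that evE[of p] evE[of q] M unfolding K_def prime_in_def by simp
  have KP: "K \<subseteq> polys_over D" by (auto simp: K_def)
  have Mx0: "map_poly \<phi> p = 0" if "p \<in> polys_over D \<inter> polys_over M" "\<forall>m\<in>D \<inter> M. \<phi> m = 0"
    "ring_map \<phi>" for \<phi> :: "'c \<Rightarrow> 'k" and p
    by (rule poly_eqI) (use that in \<open>auto simp: coeff_map_poly polys_over_def ring_map_def\<close>)
  show ?thesis
  proof (cases "K \<subseteq> polys_over M")
    case True
    have "pe \<notin> polys_over M" using MxK pe by (auto simp: K_def)
    then obtain i where i: "coeff pe i \<notin> M" by (auto simp: polys_over_def)
    show ?thesis
    proof (intro bexI[of _ "coeff pe i"] allI impI)
      show "coeff pe i \<in> D - M" using i pe by (auto simp: polys_over_def)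
      fix \<phi> :: "'c \<Rightarrow> 'k"
      assume \<phi>: "ring_map \<phi>" "\<forall>m\<in>D \<inter> M. \<phi> m = 0" "\<phi> (coeff pe i) \<noteq> 0"
      have "coeff (map_poly \<phi> pe) i \<noteq> 0" using \<phi> by (simp add: coeff_map_poly ring_map_def)
      then have "map_poly \<phi> pe \<noteq> 0" by auto
      then have "finite {x. poly (map_poly \<phi> pe) x = 0}" by (rule poly_roots_finite)
      then obtain x where "poly (map_poly \<phi> pe) x \<noteq> 0"
        using alg_closed_infinite[OF ac] by (metis (mono_tags, lifting) UNIV_I finite_subset mem_Collect_eq subsetI)
      moreover have "poly (map_poly \<phi> p) x = 0" if "p \<in> polys_over D" "poly p a \<in> M" for p
        using Mx0[of p \<phi>] that True \<phi> by (auto simp: K_def)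
      ultimately show "\<exists>x. (\<forall>p\<in>polys_over D. poly p a \<in> M \<longrightarrow> poly (map_poly \<phi> p) x = 0) \<and>
          poly (map_poly \<phi> pe) x \<noteq> 0" by blast
    qed
  next
    case False
    obtain f where f: "f \<in> K" "coeff f (degree f) \<notin> M"
      and fmin: "\<And>h. h \<in> K - polys_over M \<Longrightarrow> \<exists>i\<ge>degree f. coeff h i \<notin> M"
      and fdiv: "\<And>h. h \<in> K \<Longrightarrow> \<exists>N. \<exists>q\<in>polys_over D. \<exists>r\<in>polys_over D \<inter> polys_over M.
        [:coeff f (degree f) ^ N:] * h = q * f + r"
      using minimal_element[OF D(1) KP MxK Kadd Kmul M0 Mneg False] by blast
    define c where "c = coeff f (degree f)"
    have cD: "c \<in> D - M" using f KP by (auto simp: c_def polys_over_def)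
    \<comment> \<open>The ideal generated by the relations and \<open>pe\<close>. Over the fraction
      field of \<open>D\<close> modulo \<open>M\<close> the relations are the multiples of an
      irreducible polynomial that does not divide \<open>pe\<close>, so a constant outside
      \<open>M\<close> is to be expected in \<open>Q\<close>; \<open>h\<close> turns out to be
      one.\<close>
    define Q where "Q = {k + s * pe |k s. k \<in> K \<and> s \<in> polys_over D}"
    have QP: "Q \<subseteq> polys_over D" using S KP pe unfolding Q_def subring_of_def by auto
    have KQ: "K \<subseteq> Q" unfolding Q_def using S by (force simp: subring_of_def)
    have "0 \<in> K" using MxK S M0 by (auto simp: subring_of_def polys_over_def)
    then have peQ: "pe \<in> Q" unfolding Q_def using S by (force simp: subring_of_def)
    have Qadd: "p + q \<in> Q" if pq: "p \<in> Q" "q \<in> Q" for p q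
    proof -
      obtain k s k' s' where *: "p = k + s * pe" "q = k' + s' * pe" "k \<in> K" "k' \<in> K" "s \<in> polys_over D" "s' \<in> polys_over D"
        using pq unfolding Q_def by blast
      then have "p + q = (k + k') + (s + s') * pe" by (simp add: algebra_simps)
      moreover have "k + k' \<in> K" "s + s' \<in> polys_over D" using * Kadd S by (auto simp: subring_of_def)
      ultimately show ?thesis unfolding Q_def by blast
    qed
    have Qmul: "q * p \<in> Q" if pq: "p \<in> Q" "q \<in> polys_over D" for p q
    proof -
      obtain k s where *: "p = k + s * pe" "k \<in> K" "s \<in> polys_over D"
        using pq unfolding Q_def by blast
      then have "q * p = q * k + (q * s) * pe" by (simp add: algebra_simps)
      moreover have "q * k \<in> K" "q * s \<in> polys_over D" using * Kmul pq S by (auto simp: subring_of_def)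
      ultimately show ?thesis unfolding Q_def by blast
    qed
    have MxQ: "polys_over D \<inter> polys_over M \<subseteq> Q" using MxK KQ by blast
    obtain h where h: "h \<in> Q" "coeff h (degree h) \<notin> M"
      and hdiv: "\<And>g. g \<in> Q \<Longrightarrow> \<exists>N. \<exists>q\<in>polys_over D. \<exists>r\<in>polys_over D \<inter> polys_over M.
        [:coeff h (degree h) ^ N:] * g = q * h + r"
      using minimal_element[OF D(1) QP MxQ Qadd Qmul M0 Mneg] False KQ by blast
    define b where "b = coeff h (degree h)"
    have bD: "b \<in> D - M" using h QP by (auto simp: b_def polys_over_def)
    have pow: "x ^ N \<in> D - M" if "x \<in> D - M" for x N
      using prime_in_power[OF E M, of x N] that D subring_of_power[OF D(1)] by auto
    \<comment> \<open>Up to a power of \<open>b\<close> and modulo \<open>M\<close>,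
      \<open>h\<close> divides \<open>f\<close>. Since \<open>h\<close> is not a relation, the
      cofactor \<open>q\<close> is one by primality, so the degree of \<open>q\<close> modulo
      \<open>M\<close> is already at least that of \<open>f\<close>.\<close>
    have "degree h = 0"
    proof -
      obtain N q r where *: "q \<in> polys_over D" "r \<in> polys_over D \<inter> polys_over M"
        "[:b ^ N:] * f = q * h + r" using hdiv[of f] f KQ unfolding b_def by blast
      have "- r \<in> polys_over D \<inter> polys_over M"
        using *(2) S Mneg by (auto simp: subring_of_def polys_over_def)
      then have "- r \<in> K" using MxK by blast
      moreover have "[:b ^ N:] * f \<in> K"
        using Kmul f(1) pow[OF bD, of N] polys_over_const[OF D(1)] by blast
      ultimately have "[:b ^ N:] * f + - r \<in> K" using Kadd by blast
      then have qh: "q * h \<in> K" using *(3) by simp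
      \<comment> \<open>Otherwise \<open>pe\<close> times a power of \<open>b\<close> would be a
        relation, although neither factor vanishes at \<open>a\<close> modulo
        \<open>M\<close>.\<close>
      have hK: "h \<notin> K"
      proof
        assume "h \<in> K"
        obtain N q r where **: "q \<in> polys_over D" "r \<in> polys_over D \<inter> polys_over M"
          "[:b ^ N:] * pe = q * h + r" using hdiv[of pe] peQ unfolding b_def by blast
        then have "[:b ^ N:] * pe \<in> K" using Kadd Kmul \<open>h \<in> K\<close> MxK by auto
        then have "b ^ N * poly pe a \<in> M" by (simp add: K_def)
        then show False using pow[OF bD, of N] pe evE[OF pe(1)] M D(2) unfolding prime_in_def by blast
      qed
      have "q \<in> K" using Kprime[OF *(1) _ qh] h QP hK by blast
      have fbN: "coeff ([:b ^ N:] * f) (degree f) \<notin> M"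
      proof -
        have "b ^ N * c \<notin> M"
          using pow[OF bD, of N] cD M D(2) unfolding prime_in_def by blast
        then show ?thesis by (simp add: c_def)
      qed
      have "q \<notin> polys_over M"
      proof
        assume qM: "q \<in> polys_over M"
        have "coeff (q * h) i \<in> M" for i
          unfolding coeff_mult
        proof (rule Msum)
          fix j
          have "coeff q j \<in> M" "coeff h (i - j) \<in> E" using qM h QP D(2) by (auto simp: polys_over_def)
          then have "coeff h (i - j) * coeff q j \<in> M" using M unfolding prime_in_def by blast
          then show "coeff q j * coeff h (i - j) \<in> M" by (simp add: mult.commute)
        qed
        then have "coeff ([:b ^ N:] * f) (degree f) \<in> M"
          using *(2,3) M by (auto simp: polys_over_def prime_in_def)
        then show False using fbN by simp
      qed
      define i where "i = Max {i. coeff q i \<notin> M}"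
      have fin: "finite {i. coeff q i \<notin> M}"
        by (rule finite_subset[of _ "{..degree q}"]) (use M0 in \<open>auto intro: le_degree\<close>)
      have ne: "{i. coeff q i \<notin> M} \<noteq> {}" using \<open>q \<notin> polys_over M\<close> by (auto simp: polys_over_def)
      have i: "coeff q i \<notin> M" using Max_in[OF fin ne] by (simp add: i_def)
      have above: "coeff q j \<in> M" if "j > i" for j
        using that Max_ge[OF fin, of j] unfolding i_def by fastforce
      have "degree f \<le> i"
        using fmin[of q] \<open>q \<in> K\<close> \<open>q \<notin> polys_over M\<close> above by (meson DiffI le_trans not_le_imp_less)
      have qD: "coeff q j \<in> D" and hD: "coeff h j \<in> D" for j
        using *(1) h QP by (auto simp: polys_over_def)
      \<comment> \<open>The degree of \<open>q * h\<close> modulo \<open>M\<close>: in the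
        coefficient at this index only the summand \<open>coeff q i * b\<close> lies outside
        \<open>M\<close>.\<close>
      let ?n = "i + degree h"
      have split: "coeff (q * h) ?n = coeff q i * b + (\<Sum>j\<in>{..?n} - {i}. coeff q j * coeff h (?n - j))"
        unfolding coeff_mult b_def by (subst sum.remove[of _ i]) auto
      have rest: "(\<Sum>j\<in>{..?n} - {i}. coeff q j * coeff h (?n - j)) \<in> M"
      proof (rule Msum)
        fix j assume j: "j \<in> {..?n} - {i}"
        show "coeff q j * coeff h (?n - j) \<in> M"
        proof (cases "j > i")
          case True
          then show ?thesis using above[OF True] hD[of "?n - j"] D(2) M
            by (auto simp: prime_in_def mult.commute)
        next
          case False
          then have "coeff h (?n - j) = 0" using j by (intro coeff_eq_0) auto
          then show ?thesis using M0 by simp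
        qed
      qed
      have qib: "coeff q i * b \<notin> M" using i bD qD[of i] D(2) M unfolding prime_in_def by blast
      have "coeff (q * h) ?n \<notin> M"
      proof
        assume "coeff (q * h) ?n \<in> M"
        then have "coeff (q * h) ?n + - (\<Sum>j\<in>{..?n} - {i}. coeff q j * coeff h (?n - j)) \<in> M"
          using M Mneg[OF rest] by (auto simp: prime_in_def)
        then show False using qib by (simp add: split)
      qed
      moreover have "coeff r ?n \<in> M" using *(2) by (auto simp: polys_over_def)
      moreover have "coeff (q * h) ?n = - coeff r ?n" if "coeff ([:b ^ N:] * f) ?n = 0"
        using that unfolding *(3) by (simp add: eq_neg_iff_add_eq_0)
      ultimately have "coeff ([:b ^ N:] * f) ?n \<noteq> 0"
        using Mneg by auto
      then have "coeff f ?n \<noteq> 0" by auto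
      then have "?n \<le> degree f" by (rule le_degree)
      then show ?thesis using \<open>degree f \<le> i\<close> by simp
    qed
    then have hb: "h = [:b:]" unfolding b_def by (metis degree_eq_zeroE coeff_pCons_0 degree_pCons_0)
    \<comment> \<open>A Bezout identity with the constant \<open>b\<close>: where the relations
      vanish, the images of \<open>s\<close> and \<open>pe\<close> multiply to the nonzero image of
      \<open>b\<close>.\<close>
    obtain k s where ks: "h = k + s * pe" "k \<in> K" "s \<in> polys_over D" using h(1) unfolding Q_def by blast
    show ?thesis
    proof (intro bexI[of _ "c * b"] allI impI)
      have "c * b \<notin> M" using cD bD D(2) M unfolding prime_in_def by blast
      moreover have "c * b \<in> D" using cD bD D(1) unfolding subring_of_def by blast
      ultimately show "c * b \<in> D - M" by blast
      fix \<phi> :: "'c \<Rightarrow> 'k"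
      assume \<phi>: "ring_map \<phi>" "\<forall>m\<in>D \<inter> M. \<phi> m = 0" "\<phi> (c * b) \<noteq> 0"
      have cb: "\<phi> c \<noteq> 0" "\<phi> b \<noteq> 0" using \<phi>(1,3) by (auto simp: ring_map_def)
      \<comment> \<open>A constant relation would put \<open>c\<close> into \<open>M\<close>. As
        \<phi> does not kill \<open>c\<close>, the image of \<open>f\<close> has positive degree
        too, and therefore a root.\<close>
      have "degree f \<noteq> 0"
      proof
        assume "degree f = 0"
        then have "f = [:c:]" unfolding c_def by (metis degree_eq_zeroE coeff_pCons_0 degree_pCons_0)
        then show False using f(1) cD by (simp add: K_def)
      qed
      have "coeff (map_poly \<phi> f) (degree f) \<noteq> 0"
        using cb \<phi>(1) by (simp add: coeff_map_poly ring_map_def c_def)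
      then have "degree f \<le> degree (map_poly \<phi> f)" by (rule le_degree)
      then have "degree (map_poly \<phi> f) > 0" using \<open>degree f \<noteq> 0\<close> by simp
      then obtain x where x: "poly (map_poly \<phi> f) x = 0" using ac by blast
      \<comment> \<open>\<phi> kills the remainder \<open>r\<close> of the pseudo-division but no
        power of \<open>c\<close>, so every relation vanishes at the root of the image of
        \<open>f\<close>.\<close>
      have z: "poly (map_poly \<phi> p) x = 0" if pK: "p \<in> K" for p
      proof -
        obtain N q r where *: "r \<in> polys_over D \<inter> polys_over M" "[:c ^ N:] * p = q * f + r"
          using fdiv[OF pK] unfolding c_def by blast
        have "map_poly \<phi> ([:c ^ N:] * p) = map_poly \<phi> q * map_poly \<phi> f"
          unfolding *(2) by (simp add: ring_map_poly_add[OF \<phi>(1)] ring_map_poly_mult[OF \<phi>(1)] Mx0[OF *(1) \<phi>(2,1)])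
        then have "map_poly \<phi> [:c ^ N:] * map_poly \<phi> p = map_poly \<phi> q * map_poly \<phi> f"
          by (simp only: ring_map_poly_mult[OF \<phi>(1)])
        then have "poly (map_poly \<phi> [:c ^ N:] * map_poly \<phi> p) x = 0" by (simp only: poly_mult x) simp
        then show ?thesis using cb by (simp add: ring_map_poly_const[OF \<phi>(1)] ring_map_power[OF \<phi>(1)])
      qed
      have "map_poly \<phi> h = map_poly \<phi> k + map_poly \<phi> s * map_poly \<phi> pe"
        unfolding ks(1) by (simp add: ring_map_poly_add[OF \<phi>(1)] ring_map_poly_mult[OF \<phi>(1)])
      then have "[:\<phi> b:] = map_poly \<phi> k + map_poly \<phi> s * map_poly \<phi> pe"
        by (simp add: hb ring_map_poly_const[OF \<phi>(1)])
      then have "poly [:\<phi> b:] x = poly (map_poly \<phi> s) x * poly (map_poly \<phi> pe) x"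
        by (simp add: z[OF ks(2)])
      then have "poly (map_poly \<phi> pe) x \<noteq> 0" using cb by auto
      then show "\<exists>x. (\<forall>p\<in>polys_over D. poly p a \<in> M \<longrightarrow> poly (map_poly \<phi> p) x = 0) \<and>
          poly (map_poly \<phi> pe) x \<noteq> 0" using z by (intro exI[of _ x]) (auto simp: K_def)
    qed
  qed
qed


section \<open>Polynomials in several variables, one variable at a time\<close>

lemma subring_of_mpoly_ring: "subring_of (carrier (mpoly_ring n))"
  by (auto simp: subring_of_def mpoly_ring_one mpoly_ring_add_closed mpoly_ring_mult_closed
      mpoly_ring_uminus) (simp add: mpoly_ring_def)

lemma mpoly_ring_mono: "i \<le> n \<Longrightarrow> carrier (mpoly_ring i) \<subseteq> carrier (mpoly_ring n)"
  by (fastforce simp: mpoly_ring_def)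

definition var :: "nat \<Rightarrow> 'k::field poly_n" where
  "var i = Poly_Mapping.single (Poly_Mapping.single i 1) 1"

lemma var_in_mpoly_ring: "i < n \<Longrightarrow> var i \<in> carrier (mpoly_ring n)"
  by (auto simp: var_def mpoly_ring_def)

lemma var_power: "var i ^ m = Poly_Mapping.single (Poly_Mapping.single i m) (1 :: 'k::field)"
  by (induction m) (simp_all add: var_def mult_single single_add[symmetric] single_one[symmetric] del: single_one)

lemma poly_eval_var: "poly_eval (var i) P = P i"
  by (simp add: var_def poly_eval_single monom_eval_def)

lemma poly_eval_upd:
  assumes "f \<in> carrier (mpoly_ring n)" "\<And>i. i < n \<Longrightarrow> P i = P' i"
  shows "poly_eval f P = poly_eval f P'"
proof -
  have "monom_eval P m = monom_eval P' m" if "m \<in> Poly_Mapping.keys f" for m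
    unfolding monom_eval_def by (rule prod.cong) (use assms that in \<open>auto simp: mpoly_ring_def subset_iff\<close>)
  then show ?thesis by (simp add: poly_eval_def)
qed

text \<open>Each monomial is a monomial in the first \<open>i\<close> variables times a power of the
  last one, so collecting powers of \<open>var i\<close> gives a polynomial in one variable over the
  smaller ring.\<close>

lemma mpoly_ring_Suc_poly:
  fixes f :: "'k::field poly_n"
  assumes f: "f \<in> carrier (mpoly_ring (Suc i))"
  shows "\<exists>p\<in>polys_over (carrier (mpoly_ring i)). poly p (var i) = f"
proof -
  let ?D = "carrier (mpoly_ring i)"
  note D = subring_of_mpoly_ring[of i]
  have "\<exists>p\<in>polys_over ?D. poly p (var i) = Poly_Mapping.single m c" if m: "m \<in> monomials (Suc i)" for m and c :: 'k
  proof -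
    define e where "e = Poly_Mapping.lookup m i"
    define m' where "m' = m - Poly_Mapping.single i e"
    have l: "Poly_Mapping.lookup m' j = (if j = i then 0 else Poly_Mapping.lookup m j)" for j
      by (simp add: m'_def e_def lookup_minus lookup_single when_def)
    have "m = m' + Poly_Mapping.single i e"
      by (rule poly_mapping_eqI) (simp add: lookup_add l lookup_single when_def e_def)
    then have "Poly_Mapping.single m c = Poly_Mapping.single m' c * var i ^ e"
      by (simp add: var_power mult_single)
    moreover have "m' \<in> monomials i"
      using m by (auto simp: monomials_def in_keys_iff l less_Suc_eq subset_iff split: if_splits)
    then have "monom (Poly_Mapping.single m' c) e \<in> polys_over ?D"
      by (intro polys_over_monom[OF D] mpoly_ring_single)
    ultimately show ?thesis by (metis poly_monom)
  qed
  then have ex: "\<exists>p. p \<in> polys_over ?D \<and> poly p (var i) = Poly_Mapping.single m c"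
    if "m \<in> monomials (Suc i)" for m and c :: 'k
    using that by blast
  define F where "F m c = (SOME p. p \<in> polys_over ?D \<and> poly p (var i) = Poly_Mapping.single m c)" for m and c :: 'k
  have F: "F m c \<in> polys_over ?D \<and> poly (F m c) (var i) = Poly_Mapping.single m c"
    if "m \<in> monomials (Suc i)" for m and c :: 'k
    unfolding F_def by (rule someI_ex[OF ex[OF that]])
  have k: "m \<in> monomials (Suc i)" if "m \<in> Poly_Mapping.keys f" for m
    using f that mpoly_ring_carrier by blast
  let ?p = "\<Sum>m\<in>Poly_Mapping.keys f. F m (Poly_Mapping.lookup f m)"
  have "poly ?p (var i) = f"
    by (subst (3) poly_eq_sum_single[of f]) (simp add: poly_sum F k)
  moreover have "?p \<in> polys_over ?D"
    by (intro subring_of_sum[OF subring_of_polys_over[OF D]]) (simp add: F k)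
  ultimately show ?thesis by blast
qed

lemma mpoly_ring_0: "f \<in> carrier (mpoly_ring 0) \<Longrightarrow> \<exists>c. f = Poly_Mapping.single 0 c"
proof -
  assume "f \<in> carrier (mpoly_ring 0)"
  then have "Poly_Mapping.keys f \<subseteq> {0}" by (auto simp: mpoly_ring_def)
  then have "f = Poly_Mapping.single 0 (Poly_Mapping.lookup f 0)"
    by (intro poly_mapping_eqI) (auto simp: lookup_single when_def in_keys_iff)
  then show ?thesis by blast
qed

lemma ring_map_poly_eval: "ring_map (\<lambda>f. poly_eval f P)"
  by (simp add: ring_map_def poly_eval_simps poly_eval_add poly_eval_mult)

text \<open>The element \<open>e\<close> that must survive is there for the induction: extending a
  point by one coordinate without making \<open>e\<close> vanish requires that some \<open>d\<close>
  in fewer variables does not vanish at the given point. With \<open>i = n\<close> and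
  \<open>e = 1\<close> the result is a zero of \<open>M\<close>.\<close>

lemma prime_has_point:
  fixes M :: "'k::field poly_n set"
  assumes ac: "\<And>p :: 'k poly. degree p > 0 \<Longrightarrow> \<exists>x. poly p x = 0"
    and M: "prime_in (carrier (mpoly_ring n)) M"
  shows "i \<le> n \<Longrightarrow> e \<in> carrier (mpoly_ring i) - M \<Longrightarrow>
    \<exists>P. (\<forall>f\<in>carrier (mpoly_ring i) \<inter> M. poly_eval f P = 0) \<and> poly_eval e P \<noteq> 0"
proof (induction i arbitrary: e)
  case 0
  have M0: "0 \<in> M" using M by (simp add: prime_in_def)
  obtain c where c: "e = Poly_Mapping.single 0 c" using 0 mpoly_ring_0 by blast
  have "poly_eval f P = 0" if f: "f \<in> carrier (mpoly_ring 0) \<inter> M" for f P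
  proof -
    obtain b where b: "f = Poly_Mapping.single 0 b" using f mpoly_ring_0 by blast
    \<comment> \<open>A nonzero constant is a unit and cannot lie in the proper ideal
      \<open>M\<close>.\<close>
    have "b = 0"
    proof (rule ccontr)
      assume "b \<noteq> 0"
      have "Poly_Mapping.single 0 (1 / b) * f \<in> M"
        using M f mpoly_ring_const unfolding prime_in_def by blast
      then have "1 \<in> M" using \<open>b \<noteq> 0\<close> by (simp add: b mult_single)
      then show False using M by (simp add: prime_in_def)
    qed
    then show ?thesis by (simp add: b poly_eval_simps)
  qed
  moreover have "c \<noteq> 0" using 0 M0 c by auto
  ultimately show ?case using c by (auto simp: poly_eval_simps)
next
  case (Suc i)
  let ?D = "carrier (mpoly_ring i)"
  obtain pe where pe: "pe \<in> polys_over ?D" "poly pe (var i) = e"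
    using mpoly_ring_Suc_poly[of e i] Suc.prems by blast
  obtain d where d: "d \<in> ?D - M"
    "\<And>\<phi> :: 'k poly_n \<Rightarrow> 'k. ring_map \<phi> \<Longrightarrow> (\<forall>m\<in>?D \<inter> M. \<phi> m = 0) \<Longrightarrow> \<phi> d \<noteq> 0 \<Longrightarrow>
      (\<exists>x. (\<forall>p\<in>polys_over ?D. poly p (var i) \<in> M \<longrightarrow> poly (map_poly \<phi> p) x = 0) \<and> poly (map_poly \<phi> pe) x \<noteq> 0)"
  proof -
    have "?D \<subseteq> carrier (mpoly_ring n)" "var i \<in> carrier (mpoly_ring n)" "poly pe (var i) \<notin> M"
      using Suc.prems pe(2) by (simp_all add: mpoly_ring_mono var_in_mpoly_ring)
    from ring_map_extension[OF ac subring_of_mpoly_ring[of n] subring_of_mpoly_ring[of i] this(1,2) M pe(1) this(3)]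
    show ?thesis using that by blast
  qed
  obtain P where P: "\<forall>f\<in>?D \<inter> M. poly_eval f P = 0" "poly_eval d P \<noteq> 0"
    using Suc.IH[of d] Suc.prems d(1) by auto
  obtain x where x: "\<forall>p\<in>polys_over ?D. poly p (var i) \<in> M \<longrightarrow> poly (map_poly (\<lambda>f. poly_eval f P) p) x = 0"
    "poly (map_poly (\<lambda>f. poly_eval f P) pe) x \<noteq> 0"
    using d(2)[OF ring_map_poly_eval P] by blast
  \<comment> \<open>The coefficients of \<open>p\<close> do not involve the variable
    \<open>i\<close>, so changing that coordinate to \<open>x\<close> affects only the powers of
    \<open>var i\<close>.\<close>
  have ev: "poly_eval (poly p (var i)) (P(i := x)) = poly (map_poly (\<lambda>f. poly_eval f P) p) x"
    if p: "p \<in> polys_over ?D" for p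
  proof -
    have c: "poly_eval (coeff p j) (P(i := x)) = poly_eval (coeff p j) P" for j
      by (rule poly_eval_upd[of _ i]) (use p in \<open>auto simp: polys_over_def\<close>)
    have "degree (map_poly (\<lambda>f. poly_eval f P) p) \<le> degree p"
      by (rule degree_le) (simp add: coeff_map_poly poly_eval_simps coeff_eq_0)
    then have "poly (map_poly (\<lambda>f. poly_eval f P) p) x =
        (\<Sum>j\<le>degree p. coeff (map_poly (\<lambda>f. poly_eval f P) p) j * x ^ j)"
      unfolding poly_altdef by (intro sum.mono_neutral_left) (auto intro: coeff_eq_0)
    then have "poly (map_poly (\<lambda>f. poly_eval f P) p) x = (\<Sum>j\<le>degree p. poly_eval (coeff p j) P * x ^ j)"
      by (simp add: coeff_map_poly poly_eval_simps)
    then show ?thesis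
      by (simp add: poly_altdef poly_eval_sum poly_eval_mult poly_eval_simps poly_eval_var c)
  qed
  show ?case
  proof (intro exI[of _ "P(i := x)"] conjI ballI)
    fix f assume f: "f \<in> carrier (mpoly_ring (Suc i)) \<inter> M"
    then obtain p where "p \<in> polys_over ?D" "poly p (var i) = f" using mpoly_ring_Suc_poly by blast
    then show "poly_eval f (P(i := x)) = 0" using ev[of p] x(1) f by auto
  next
    show "poly_eval e (P(i := x)) \<noteq> 0" using ev[OF pe(1)] pe(2) x(2) by simp
  qed
qed

section \<open>Zeros of proper ideals and nowhere vanishing elements\<close>

text \<open>Zorn's lemma gives an ideal that is maximal among those containing \<open>J\<close> and
  omitting 1; such an ideal is prime.\<close>

lemma poly_ideal_in_prime:
  assumes J: "poly_ideal n J" "1 \<notin> J"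
  shows "\<exists>M. prime_in (carrier (mpoly_ring n)) M \<and> J \<subseteq> M"
proof -
  let ?E = "carrier (mpoly_ring n)"
  note E = subring_of_mpoly_ring[of n]
  define \<A> where "\<A> = {I. poly_ideal n I \<and> 1 \<notin> I \<and> J \<subseteq> I}"
  have "\<exists>M\<in>\<A>. \<forall>X\<in>\<A>. M \<subseteq> X \<longrightarrow> X = M"
  proof (rule subset_Zorn_nonempty)
    show "\<A> \<noteq> {}" using J by (auto simp: \<A>_def)
    fix \<C> assume C: "\<C> \<noteq> {}" "subset.chain \<A> \<C>"
    then have CA: "\<C> \<subseteq> \<A>" and tot: "\<And>X Y. X \<in> \<C> \<Longrightarrow> Y \<in> \<C> \<Longrightarrow> X \<subseteq> Y \<or> Y \<subseteq> X"
      by (auto simp: subset_chain_def)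
    have "f + g \<in> \<Union>\<C>" if fg: "f \<in> \<Union>\<C>" "g \<in> \<Union>\<C>" for f g
    proof -
      obtain X Y where "X \<in> \<C>" "Y \<in> \<C>" "f \<in> X" "g \<in> Y" using fg by blast
      then obtain Z where "Z \<in> \<C>" "f \<in> Z" "g \<in> Z" using tot by blast
      moreover have "poly_ideal n Z" using CA \<open>Z \<in> \<C>\<close> by (auto simp: \<A>_def)
      ultimately show ?thesis unfolding poly_ideal_def by blast
    qed
    moreover have "0 \<in> \<Union>\<C>" "\<Union>\<C> \<subseteq> ?E" "1 \<notin> \<Union>\<C>" "J \<subseteq> \<Union>\<C>"
      "\<And>f g. f \<in> \<Union>\<C> \<Longrightarrow> g \<in> ?E \<Longrightarrow> g * f \<in> \<Union>\<C>"
      using C(1) CA unfolding \<A>_def poly_ideal_def by blast+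
    ultimately show "\<Union>\<C> \<in> \<A>" by (auto simp: \<A>_def poly_ideal_def)
  qed
  then obtain M where MA: "M \<in> \<A>" "\<forall>X\<in>\<A>. M \<subseteq> X \<longrightarrow> X = M" ..
  have M: "poly_ideal n M" "1 \<notin> M" "J \<subseteq> M" using MA(1) by (auto simp only: \<A>_def)
  have max: "X = M" if "poly_ideal n X" "1 \<notin> X" "M \<subseteq> X" for X
  proof -
    have "X \<in> \<A>" using that M(3) by (simp add: \<A>_def)
    then show ?thesis using MA(2) that(3) by blast
  qed
  have mul: "y * x \<in> M" if "x \<in> M" "y \<in> ?E" for x y using M(1) that unfolding poly_ideal_def by blast
  have "x \<in> M \<or> y \<in> M" if xy: "x \<in> ?E" "y \<in> ?E" "x * y \<in> M" for x y
  proof (rule ccontr)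
    assume *: "\<not> (x \<in> M \<or> y \<in> M)"
    \<comment> \<open>The ideal generated by \<open>M\<close> and \<open>x\<close>. It exceeds
      \<open>M\<close>, so it contains 1; multiplying the resulting identity by \<open>y\<close>
      puts \<open>y\<close> into \<open>M\<close>.\<close>
    define X where "X = {m + s * x |m s. m \<in> M \<and> s \<in> ?E}"
    have M0: "0 \<in> M" and ME: "M \<subseteq> ?E" and Madd: "\<And>f g. f \<in> M \<Longrightarrow> g \<in> M \<Longrightarrow> f + g \<in> M"
      using M(1) unfolding poly_ideal_def by blast+
    have E': "0 \<in> ?E" "1 \<in> ?E" "\<And>f g. f \<in> ?E \<Longrightarrow> g \<in> ?E \<Longrightarrow> f + g \<in> ?E \<and> f * g \<in> ?E"
      using E unfolding subring_of_def by blast+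
    have XE: "X \<subseteq> ?E"
    proof
      fix f assume "f \<in> X"
      then obtain m s where "f = m + s * x" "m \<in> M" "s \<in> ?E" unfolding X_def by blast
      moreover from this have "s * x \<in> ?E" "m \<in> ?E" using ME E'(3)[of s x] xy(1) by auto
      ultimately show "f \<in> ?E" using E'(3)[of m "s * x"] by simp
    qed
    have "0 \<in> X" unfolding X_def using M0 E'(1) by force
    moreover have "f + g \<in> X" if fg: "f \<in> X" "g \<in> X" for f g
    proof -
      obtain m s m' s' where h: "f = m + s * x" "g = m' + s' * x" "m \<in> M" "m' \<in> M" "s \<in> ?E" "s' \<in> ?E"
        using fg unfolding X_def by blast
      then have "f + g = (m + m') + (s + s') * x" by (simp add: algebra_simps)
      moreover have "m + m' \<in> M" "s + s' \<in> ?E" using h Madd E'(3) by auto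
      ultimately show ?thesis unfolding X_def by blast
    qed
    moreover have "g * f \<in> X" if fg: "f \<in> X" "g \<in> ?E" for f g
    proof -
      obtain m s where h: "f = m + s * x" "m \<in> M" "s \<in> ?E"
        using fg unfolding X_def by blast
      then have "g * f = g * m + (g * s) * x" by (simp add: algebra_simps)
      moreover have "g * m \<in> M" "g * s \<in> ?E" using h mul fg E'(3) by auto
      ultimately show ?thesis unfolding X_def by blast
    qed
    ultimately have iX: "poly_ideal n X" using XE unfolding poly_ideal_def by blast
    have MX: "M \<subseteq> X" unfolding X_def using E'(1) by force
    have xX: "x \<in> X" unfolding X_def using M0 E'(2) by force
    have "1 \<in> X" using max[OF iX _ MX] xX * by blast
    then obtain m s where ms: "1 = m + s * x" "m \<in> M" "s \<in> ?E" unfolding X_def by blast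
    have "y = y * m + s * (x * y)" using arg_cong[OF ms(1), of "\<lambda>t. y * t"] by (simp add: algebra_simps)
    also have "\<dots> \<in> M" by (intro Madd mul ms(2,3) xy(2,3))
    finally show False using * by blast
  qed
  then have "prime_in ?E M" using M(1,2) unfolding prime_in_def poly_ideal_def by blast
  then show ?thesis using M by blast
qed

lemma affine_space_restrict:
  assumes "f \<in> carrier (mpoly_ring n)"
  shows "poly_eval f (restrict P {..<n}) = poly_eval f P" "restrict P {..<n} \<in> affine_space n"
  using poly_eval_upd[OF assms, of "restrict P {..<n}" P] by (auto simp: affine_space_def)

theorem nowhere_vanishing_element:
  fixes J :: "'k::field poly_n set"
  assumes J: "poly_ideal n J"
    and nz: "\<And>P. P \<in> affine_space n \<Longrightarrow> \<exists>f\<in>J. poly_eval f P \<noteq> 0"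
  shows "\<exists>f\<in>J. \<forall>P. poly_eval f P \<noteq> 0"
proof -
  have JE: "J \<subseteq> carrier (mpoly_ring n)" using J by (auto simp: poly_ideal_def)
  \<comment> \<open>A polynomial in \<open>n\<close> variables sees only the first \<open>n\<close>
    coordinates, so the hypothesis passes from extensional points to all \<open>P\<close>.\<close>
  have nz: "\<exists>f\<in>J. poly_eval f P \<noteq> 0" for P
    using nz[of "restrict P {..<n}"] affine_space_restrict[of _ n P] JE by (metis mpoly_ring_one subsetD)
  show ?thesis
  proof (cases "\<exists>q :: 'k poly. degree q > 0 \<and> (\<forall>x. poly q x \<noteq> 0)")
    case True
    then obtain q :: "'k poly" where q: "degree q > 0" "\<And>x. poly q x \<noteq> 0" by blast
    obtain F where F: "finite F" "F \<subseteq> J"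
      "\<And>P. (\<forall>f\<in>F. poly_eval f P = 0) \<Longrightarrow> (\<forall>f\<in>J. poly_eval f P = 0)"
      using finite_same_zeros[OF J] by blast
    obtain h where "h \<in> J" "\<And>P. poly_eval h P = 0 \<Longrightarrow> (\<forall>f\<in>F. poly_eval f P = 0)"
      using ideal_common_zeros[OF q J F(1,2)] by blast
    then show ?thesis using F(3) nz by blast
  next
    case False
    have "1 \<in> J"
    proof (rule ccontr)
      assume "1 \<notin> J"
      then obtain M where M: "prime_in (carrier (mpoly_ring n)) M" "J \<subseteq> M"
        using poly_ideal_in_prime[OF J] by blast
      have "1 \<in> carrier (mpoly_ring n) - M" using M mpoly_ring_one by (auto simp: prime_in_def)
      then obtain P where "\<forall>f\<in>carrier (mpoly_ring n) \<inter> M. poly_eval f P = 0"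
        using prime_has_point[OF _ M(1), of n 1] False by blast
      then show False using nz[of P] M(2) JE by blast
    qed
    then show ?thesis by (intro bexI[of _ 1]) (simp_all add: poly_eval_simps)
  qed
qed

section \<open>Isomorphisms of sheaves of algebras\<close>

text \<open>The condition on zero is separate because \<open>ring_hom\<close> does not contain it,
  and it follows from additivity only once the target is known to be a ring. Here the ring laws of
  the target are to be deduced from those of the source.\<close>

definition alg_iso :: "('k::field, 'a) module \<Rightarrow> ('k, 'b) module \<Rightarrow> ('a \<Rightarrow> 'b) \<Rightarrow> bool" where
  "alg_iso A B h \<longleftrightarrow> h \<in> alg_hom A B \<and> bij_betw h (carrier A) (carrier B) \<and> h \<zero>\<^bsub>A\<^esub> = \<zero>\<^bsub>B\<^esub>"

lemma alg_isoD:
  assumes "alg_iso A B h"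
  shows "h \<in> alg_hom A B" "h \<in> ring_hom A B" "h \<in> ring_iso A B" "bij_betw h (carrier A) (carrier B)"
    "h \<zero>\<^bsub>A\<^esub> = \<zero>\<^bsub>B\<^esub>" "inj_on h (carrier A)" "h ` carrier A = carrier B"
    "\<And>x. x \<in> carrier A \<Longrightarrow> h x \<in> carrier B"
    "\<And>x y. x \<in> carrier A \<Longrightarrow> y \<in> carrier A \<Longrightarrow> h (x \<otimes>\<^bsub>A\<^esub> y) = h x \<otimes>\<^bsub>B\<^esub> h y"
    "\<And>x y. x \<in> carrier A \<Longrightarrow> y \<in> carrier A \<Longrightarrow> h (x \<oplus>\<^bsub>A\<^esub> y) = h x \<oplus>\<^bsub>B\<^esub> h y"
    "h \<one>\<^bsub>A\<^esub> = \<one>\<^bsub>B\<^esub>"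
    "\<And>c x. x \<in> carrier A \<Longrightarrow> h (c \<odot>\<^bsub>A\<^esub> x) = c \<odot>\<^bsub>B\<^esub> h x"
  using assms by (auto simp: alg_iso_def alg_hom_def ring_iso_def bij_betw_def ring_hom_def)

lemma cring_ring_iso_image:
  assumes "cring A" "h \<in> ring_iso A B" "h \<zero>\<^bsub>A\<^esub> = \<zero>\<^bsub>B\<^esub>"
  shows "cring B"
  using cring.ring_iso_imp_img_cring[OF assms(1,2)] assms(3) by simp

lemma k_algebra_iso_image:
  assumes A: "k_algebra A" and h: "alg_iso A B h"
  shows "k_algebra B"
proof -
  interpret A: algebra base_field A by fact
  note H = alg_isoD[OF h]
  have k: "c \<in> carrier base_field" for c :: 'a by (simp add: base_field_def)
  have pre: "\<exists>x. x \<in> carrier A \<and> y = h x" if "y \<in> carrier B" for y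
    using H(7) that by blast
  show ?thesis
  proof (rule algebraI)
    show "cring (base_field :: ('a, 'a) module)" by (rule A.R_cring)
    show "cring B" by (rule cring_ring_iso_image[OF A.M_cring H(3,5)])
    fix c d :: 'a and x y assume "x \<in> carrier B"
    then obtain x' where x: "x' \<in> carrier A" "x = h x'" using pre by blast
    show "c \<odot>\<^bsub>B\<^esub> x \<in> carrier B" using x k[of c] H(8,12) by (metis A.smult_closed)
    show "(c \<oplus>\<^bsub>base_field\<^esub> d) \<odot>\<^bsub>B\<^esub> x = c \<odot>\<^bsub>B\<^esub> x \<oplus>\<^bsub>B\<^esub> d \<odot>\<^bsub>B\<^esub> x"
      unfolding x(2) H(12)[OF x(1), symmetric] A.smult_l_distr[OF k k x(1)]
      by (rule H(10)) (use x k in auto)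
    show "(c \<otimes>\<^bsub>base_field\<^esub> d) \<odot>\<^bsub>B\<^esub> x = c \<odot>\<^bsub>B\<^esub> (d \<odot>\<^bsub>B\<^esub> x)"
      using x k by (simp add: H(12)[symmetric] A.smult_assoc1)
    show "\<one>\<^bsub>base_field\<^esub> \<odot>\<^bsub>B\<^esub> x = x"
      using x by (simp add: H(12)[symmetric])
    assume "y \<in> carrier B"
    then obtain y' where y: "y' \<in> carrier A" "y = h y'" using pre by blast
    show "c \<odot>\<^bsub>B\<^esub> (x \<oplus>\<^bsub>B\<^esub> y) = c \<odot>\<^bsub>B\<^esub> x \<oplus>\<^bsub>B\<^esub> c \<odot>\<^bsub>B\<^esub> y"
      using x y k by (simp add: H(10)[symmetric] H(12)[symmetric] A.smult_r_distr)
    show "c \<odot>\<^bsub>B\<^esub> x \<otimes>\<^bsub>B\<^esub> y = c \<odot>\<^bsub>B\<^esub> (x \<otimes>\<^bsub>B\<^esub> y)"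
      using x y k by (simp add: H(9)[symmetric] H(12)[symmetric] A.smult_assoc2)
  qed
qed

lemma alg_iso_comp:
  assumes g: "alg_iso A B g" and h: "alg_iso B C h"
  shows "alg_iso A C (h \<circ> g)"
  unfolding alg_iso_def alg_hom_def ring_hom_def
  using bij_betw_trans[OF alg_isoD(4)[OF g] alg_isoD(4)[OF h]]
  by (auto simp: alg_isoD(5,8-12)[OF g] alg_isoD(5,8-12)[OF h])

lemma alg_iso_inv:
  assumes A: "k_algebra A" and h: "alg_iso A B h"
  shows "alg_iso B A (inv_into (carrier A) h)"
proof -
  interpret A: algebra base_field A by fact
  note H = alg_isoD[OF h]
  let ?g = "inv_into (carrier A) h"
  have k: "c \<in> carrier base_field" for c :: 'a by (simp add: base_field_def)
  have "?g \<in> ring_iso B A" using ring_iso_set_sym[OF A.ring_axioms H(3)] .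
  moreover have "?g (c \<odot>\<^bsub>B\<^esub> y) = c \<odot>\<^bsub>A\<^esub> ?g y" if y: "y \<in> carrier B" for c y
  proof -
    obtain x where x: "x \<in> carrier A" "y = h x"
      using y unfolding H(7)[symmetric] by (rule imageE)
    then have "c \<odot>\<^bsub>B\<^esub> y = h (c \<odot>\<^bsub>A\<^esub> x)" by (simp add: H(12))
    then show ?thesis using x k by (simp add: inv_into_f_f[OF H(6)])
  qed
  moreover have "?g \<zero>\<^bsub>B\<^esub> = \<zero>\<^bsub>A\<^esub>"
    using inv_into_f_f[OF H(6) A.zero_closed] H(5) by simp
  ultimately show ?thesis by (auto simp: alg_iso_def alg_hom_def ring_iso_def)
qed

lemma maximalideal_ring_iso_image:
  assumes R: "cring R" and S: "cring S" and h: "h \<in> ring_iso R S" and M: "maximalideal M R"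
  shows "maximalideal (h ` M) S"
proof -
  interpret R: cring R by fact
  interpret S: cring S by fact
  interpret M: maximalideal M R by fact
  let ?g = "inv_into (carrier R) h"
  have g: "?g \<in> ring_iso S R" by (rule ring_iso_set_sym[OF R.ring_axioms h])
  have bij: "bij_betw h (carrier R) (carrier S)" using h by (simp add: ring_iso_def)
  have gh: "?g (h x) = x" if "x \<in> carrier R" for x using bij that by (simp add: bij_betw_def)
  have hg: "h (?g y) = y" "?g y \<in> carrier R" if "y \<in> carrier S" for y
    using bij that by (auto simp: bij_betw_def f_inv_into_f inv_into_into)
  interpret hh: ring_hom_ring R S h
    using h R.ring_axioms S.ring_axioms by (auto simp: ring_iso_def intro: ring_hom_ringI2)
  interpret gg: ring_hom_ring S R ?g
    using g R.ring_axioms S.ring_axioms by (auto simp: ring_iso_def intro: ring_hom_ringI2)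
  \<comment> \<open>Images under \<open>h\<close> are preimages under its inverse, and preimages of
    ideals under ring homomorphisms are ideals.\<close>
  have im: "h ` I = {y \<in> carrier S. ?g y \<in> I}" if "I \<subseteq> carrier R" for I
  proof (intro equalityI subsetI)
    fix y assume "y \<in> h ` I"
    then obtain x where x: "x \<in> I" "y = h x" by blast
    then have "x \<in> carrier R" using that by blast
    then show "y \<in> {y \<in> carrier S. ?g y \<in> I}" using x gh bij by (auto simp: bij_betw_def)
  next
    fix y assume "y \<in> {y \<in> carrier S. ?g y \<in> I}"
    then show "y \<in> h ` I" using hg[of y] by (intro image_eqI[of _ _ "?g y"]) auto
  qed
  have MR: "M \<subseteq> carrier R" by (rule M.a_subset)
  show ?thesis
  proof (rule maximalidealI)
    show "ideal (h ` M) S"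
      using gg.ideal_vimage[OF M.is_ideal] by (simp add: im[OF MR])
    show "carrier S \<noteq> h ` M"
    proof
      assume eq: "carrier S = h ` M"
      have "carrier R \<subseteq> M"
      proof
        fix x assume "x \<in> carrier R"
        then have "h x \<in> h ` M" using eq hh.hom_closed by simp
        then obtain x' where "x' \<in> M" "h x = h x'" by blast
        moreover have "x' \<in> carrier R" using \<open>x' \<in> M\<close> MR by blast
        ultimately have "x = x'" using \<open>x \<in> carrier R\<close> gh by metis
        then show "x \<in> M" using \<open>x' \<in> M\<close> by simp
      qed
      then show False using M.I_notcarr MR by blast
    qed
    fix J assume J: "ideal J S" "h ` M \<subseteq> J" "J \<subseteq> carrier S"
    let ?J = "{x \<in> carrier R. h x \<in> J}"
    have "ideal ?J R" by (rule hh.ideal_vimage[OF J(1)])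
    moreover have "M \<subseteq> ?J" using J(2) MR by blast
    ultimately have "?J = M \<or> ?J = carrier R" using M.I_maximal by blast
    moreover have "h ` ?J = J"
    proof (intro equalityI subsetI)
      fix y assume "y \<in> J"
      then show "y \<in> h ` ?J" using J(3) hg[of y] by (intro image_eqI[of _ _ "?g y"]) auto
    qed blast
    ultimately show "J = h ` M \<or> J = carrier S" using bij by (auto simp: bij_betw_def)
  qed
qed

lemma local_ring_iso_image:
  assumes R: "local_ring R" and h: "h \<in> ring_iso R S" and h0: "h \<zero>\<^bsub>R\<^esub> = \<zero>\<^bsub>S\<^esub>"
  shows "local_ring S"
proof -
  have cR: "cring R" using R by (simp add: local_ring_def)
  then interpret R: cring R .
  have cS: "cring S" by (rule cring_ring_iso_image[OF cR h h0])
  let ?g = "inv_into (carrier R) h"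
  have g: "?g \<in> ring_iso S R" by (rule ring_iso_set_sym[OF R.ring_axioms h])
  have bij: "bij_betw h (carrier R) (carrier S)" using h by (simp add: ring_iso_def)
  obtain M where M: "maximalideal M R" "\<And>N. maximalideal N R \<Longrightarrow> N = M"
    using R unfolding local_ring_def by blast
  have "N = h ` M" if N: "maximalideal N S" for N
  proof -
    have "?g ` N = M" by (rule M(2)[OF maximalideal_ring_iso_image[OF cS cR g N]])
    moreover have "N \<subseteq> carrier S"
      using N by (simp add: additive_subgroup.a_subset ideal.axioms(1) maximalideal.axioms(1))
    then have "h ` ?g ` N = N" using bij by (force simp: bij_betw_def f_inv_into_f)
    ultimately show ?thesis by simp
  qed
  then show ?thesis
    unfolding local_ring_def using cS maximalideal_ring_iso_image[OF cR cS h M(1)] by blast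
qed

section \<open>Isomorphisms of ringed spaces\<close>

text \<open>Sections are pushed forward to the image of \<open>U\<close> instead of being pulled
  back to a preimage, so that composition is plain and no condition on stalks occurs. Locality of
  the stalk maps is a consequence.\<close>

definition sheaf_iso :: "('k::field, 'p, 's) ringed_space \<Rightarrow> ('k, 'q, 't) ringed_space \<Rightarrow>
    ('p \<Rightarrow> 'q) \<Rightarrow> ('p set \<Rightarrow> 's \<Rightarrow> 't) \<Rightarrow> bool" where
  "sheaf_iso E F \<phi> \<chi> \<longleftrightarrow> homeomorphic_map (points E) (points F) \<phi> \<and>
     (\<forall>U. openin (points E) U \<longrightarrow> alg_iso (sect E U) (sect F (\<phi> ` U)) (\<chi> U)) \<and>
     (\<forall>U W. openin (points E) U \<longrightarrow> openin (points E) W \<longrightarrow> W \<subseteq> U \<longrightarrow>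
        (\<forall>s\<in>carrier (sect E U). \<chi> W (res E U W s) = res F (\<phi> ` U) (\<phi> ` W) (\<chi> U s)))"

lemma sheaf_iso_trans:
  assumes E: "presheaf_of_algebras E" and 1: "sheaf_iso E F \<phi> \<chi>" and 2: "sheaf_iso F G \<phi>' \<chi>'"
  shows "sheaf_iso E G (\<phi>' \<circ> \<phi>) (\<lambda>U. \<chi>' (\<phi> ` U) \<circ> \<chi> U)"
  unfolding sheaf_iso_def
proof (intro conjI allI impI ballI)
  have h1: "homeomorphic_map (points E) (points F) \<phi>" and h2: "homeomorphic_map (points F) (points G) \<phi>'"
    using 1 2 by (simp_all add: sheaf_iso_def)
  have op: "openin (points F) (\<phi> ` U)" if "openin (points E) U" for U
    using homeomorphic_map_openness_eq[OF h1, of U] that by blast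
  show "homeomorphic_map (points E) (points G) (\<phi>' \<circ> \<phi>)"
    by (rule homeomorphic_map_compose[OF h1 h2])
  show "alg_iso (sect E U) (sect G ((\<phi>' \<circ> \<phi>) ` U)) (\<chi>' (\<phi> ` U) \<circ> \<chi> U)" if "openin (points E) U" for U
    unfolding image_comp[symmetric] using 1 2 op[OF that] that
    by (intro alg_iso_comp[of _ "sect F (\<phi> ` U)"]) (simp_all add: sheaf_iso_def)
  fix U W s assume *: "openin (points E) U" "openin (points E) W" "W \<subseteq> U" "s \<in> carrier (sect E U)"
  have "alg_iso (sect E U) (sect F (\<phi> ` U)) (\<chi> U)" using 1 *(1) by (simp add: sheaf_iso_def)
  from alg_isoD(8)[OF this *(4)] have "\<chi> U s \<in> carrier (sect F (\<phi> ` U))" .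
  then have "\<chi>' (\<phi> ` W) (res F (\<phi> ` U) (\<phi> ` W) (\<chi> U s)) =
      res G (\<phi>' ` \<phi> ` U) (\<phi>' ` \<phi> ` W) (\<chi>' (\<phi> ` U) (\<chi> U s))" if "\<phi> ` W \<subseteq> \<phi> ` U"
    using that 2 op[OF *(1)] op[OF *(2)] unfolding sheaf_iso_def by blast
  moreover have "\<chi> W (res E U W s) = res F (\<phi> ` U) (\<phi> ` W) (\<chi> U s)"
    using 1 * unfolding sheaf_iso_def by blast
  moreover have "\<phi> ` W \<subseteq> \<phi> ` U" using * by blast
  ultimately show "(\<chi>' (\<phi> ` W) \<circ> \<chi> W) (res E U W s) =
      res G ((\<phi>' \<circ> \<phi>) ` U) ((\<phi>' \<circ> \<phi>) ` W) ((\<chi>' (\<phi> ` U) \<circ> \<chi> U) s)"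
    unfolding image_comp[symmetric] o_apply by simp
qed

lemma presheaf_of_algebrasD:
  assumes "presheaf_of_algebras E"
  shows "openin (points E) U \<Longrightarrow> k_algebra (sect E U)"
    "openin (points E) U \<Longrightarrow> openin (points E) W \<Longrightarrow> W \<subseteq> U \<Longrightarrow> s \<in> carrier (sect E U) \<Longrightarrow>
      res E U W s \<in> carrier (sect E W)"
    "openin (points E) U \<Longrightarrow> s \<in> carrier (sect E U) \<Longrightarrow> res E U U s = s"
    "openin (points E) U \<Longrightarrow> openin (points E) W \<Longrightarrow> openin (points E) N \<Longrightarrow> W \<subseteq> U \<Longrightarrow> N \<subseteq> W \<Longrightarrow>
      s \<in> carrier (sect E U) \<Longrightarrow> res E W N (res E U W s) = res E U N s"
proof -
  show "openin (points E) U \<Longrightarrow> k_algebra (sect E U)"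
    using assms by (simp add: presheaf_of_algebras_def)
  show "openin (points E) U \<Longrightarrow> s \<in> carrier (sect E U) \<Longrightarrow> res E U U s = s"
    using assms by (simp add: presheaf_of_algebras_def)
  show "openin (points E) U \<Longrightarrow> openin (points E) W \<Longrightarrow> openin (points E) N \<Longrightarrow> W \<subseteq> U \<Longrightarrow> N \<subseteq> W \<Longrightarrow>
      s \<in> carrier (sect E U) \<Longrightarrow> res E W N (res E U W s) = res E U N s"
    using assms by (simp add: presheaf_of_algebras_def)
  assume *: "openin (points E) U" "openin (points E) W" "W \<subseteq> U" "s \<in> carrier (sect E U)"
  then have "res E U W \<in> alg_hom (sect E U) (sect E W)"
    using assms by (simp add: presheaf_of_algebras_def)
  then show "res E U W s \<in> carrier (sect E W)"
    using ring_hom_closed[of "res E U W" "sect E U" "sect E W", OF _ *(4)] by (simp add: alg_hom_def)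
qed

text \<open>Only \<open>E\<close> is assumed to be a presheaf; that \<open>F\<close> is a presheaf,
  a sheaf or locally ringed whenever \<open>E\<close> is gets deduced. This spares a direct
  verification for the subspace of closed points of a spectrum.\<close>

locale sheaf_isomorphism =
  fixes E :: "('k::field, 'p, 's) ringed_space" and F :: "('k, 'q, 't) ringed_space"
    and \<phi> :: "'p \<Rightarrow> 'q" and \<chi> :: "'p set \<Rightarrow> 's \<Rightarrow> 't"
  assumes pre: "presheaf_of_algebras E" and iso: "sheaf_iso E F \<phi> \<chi>"
begin

lemma phi_homeomorphic: "homeomorphic_map (points E) (points F) \<phi>"
  using iso by (simp add: sheaf_iso_def)

lemma phi_inj: "inj_on \<phi> (topspace (points E))"
  using phi_homeomorphic by (simp add: homeomorphic_map_def)

lemma phi_surj: "\<phi> ` topspace (points E) = topspace (points F)"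
  using phi_homeomorphic by (rule homeomorphic_imp_surjective_map)

lemma chi_iso: "openin (points E) U \<Longrightarrow> alg_iso (sect E U) (sect F (\<phi> ` U)) (\<chi> U)"
  using iso by (simp add: sheaf_iso_def)

lemma chi_res: "openin (points E) U \<Longrightarrow> openin (points E) W \<Longrightarrow> W \<subseteq> U \<Longrightarrow> s \<in> carrier (sect E U) \<Longrightarrow>
    \<chi> W (res E U W s) = res F (\<phi> ` U) (\<phi> ` W) (\<chi> U s)"
  using iso by (simp add: sheaf_iso_def)

lemma open_image: "openin (points E) U \<Longrightarrow> openin (points F) (\<phi> ` U)"
  using homeomorphic_map_openness_eq[OF phi_homeomorphic] by blast

lemma open_imageE:
  assumes "openin (points F) W"
  obtains U where "openin (points E) U" "W = \<phi> ` U"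
proof -
  have "W \<subseteq> \<phi> ` topspace (points E)" using openin_subset[OF assms] phi_surj by simp
  then obtain U where "U \<subseteq> topspace (points E)" "W = \<phi> ` U" by (auto simp: subset_image_iff)
  then show ?thesis using that homeomorphic_map_openness[OF phi_homeomorphic, of U] assms by blast
qed

lemma image_Int: "openin (points E) U \<Longrightarrow> openin (points E) W \<Longrightarrow> \<phi> ` (U \<inter> W) = \<phi> ` U \<inter> \<phi> ` W"
  by (rule inj_on_image_Int[OF phi_inj]) (auto dest: openin_subset)

lemma image_subset_iff': "openin (points E) U \<Longrightarrow> openin (points E) W \<Longrightarrow> \<phi> ` U \<subseteq> \<phi> ` W \<longleftrightarrow> U \<subseteq> W"
proof
  assume *: "openin (points E) U" "openin (points E) W" "\<phi> ` U \<subseteq> \<phi> ` W"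
  show "U \<subseteq> W"
  proof
    fix x assume "x \<in> U"
    then have "\<phi> x \<in> \<phi> ` W" "x \<in> topspace (points E)" using * openin_subset[OF *(1)] by auto
    then show "x \<in> W" using inj_on_image_mem_iff[OF phi_inj _ openin_subset[OF *(2)]] by simp
  qed
qed (rule image_mono)

lemma sect_imageE:
  assumes "openin (points E) U" "t \<in> carrier (sect F (\<phi> ` U))"
  obtains s where "s \<in> carrier (sect E U)" "t = \<chi> U s"
  using alg_isoD(7)[OF chi_iso[OF assms(1)]] assms(2) by blast

lemmas E_algebra = presheaf_of_algebrasD(1)[OF pre]
  and E_res = presheaf_of_algebrasD(2)[OF pre]
  and E_res_id = presheaf_of_algebrasD(3)[OF pre]
  and E_res_res = presheaf_of_algebrasD(4)[OF pre]

lemma chi_carrier: "openin (points E) U \<Longrightarrow> s \<in> carrier (sect E U) \<Longrightarrow> \<chi> U s \<in> carrier (sect F (\<phi> ` U))"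
  by (rule alg_isoD(8)[OF chi_iso])

lemma chi_inj: "openin (points E) U \<Longrightarrow> s \<in> carrier (sect E U) \<Longrightarrow> t \<in> carrier (sect E U) \<Longrightarrow>
    \<chi> U s = \<chi> U t \<longleftrightarrow> s = t"
  using alg_isoD(6)[OF chi_iso[of U]] by (auto dest: inj_onD)

text \<open>Every open set and section on the side of \<open>F\<close> is the image of one on the
  side of \<open>E\<close>, and restrictions correspond, so each axiom can be read off
  there.\<close>

lemma presheaf_image: "presheaf_of_algebras F"
  unfolding presheaf_of_algebras_def
proof (intro conjI allI impI ballI)
  fix U' assume "openin (points F) U'"
  then obtain U where U: "openin (points E) U" "U' = \<phi> ` U" by (rule open_imageE)
  show "k_algebra (sect F U')"
    unfolding U(2) by (rule k_algebra_iso_image[OF E_algebra chi_iso]) (rule U)+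
  show "res F U' U' s = s" if s: "s \<in> carrier (sect F U')" for s
  proof -
    obtain t where t: "t \<in> carrier (sect E U)" "s = \<chi> U t"
      using s unfolding U(2) by (rule sect_imageE[OF U(1)])
    then show ?thesis using chi_res[OF U(1) U(1) _ t(1)] E_res_id[OF U(1) t(1)] by (simp add: U(2))
  qed
  fix W' assume "openin (points F) W'" and WU: "W' \<subseteq> U'"
  then obtain W where W: "openin (points E) W" "W' = \<phi> ` W" by (elim open_imageE)
  have sub: "W \<subseteq> U" using WU image_subset_iff'[OF W(1) U(1)] by (simp add: W U)
  interpret AU: algebra base_field "sect E U" by (rule E_algebra[OF U(1)])
  have r: "res E U W \<in> alg_hom (sect E U) (sect E W)"
    using pre U W sub by (auto simp: presheaf_of_algebras_def)
  then have rr: "res E U W \<in> ring_hom (sect E U) (sect E W)"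
    "\<And>c x. x \<in> carrier (sect E U) \<Longrightarrow> res E U W (c \<odot>\<^bsub>sect E U\<^esub> x) = c \<odot>\<^bsub>sect E W\<^esub> res E U W x"
    by (auto simp: alg_hom_def)
  note cU = alg_isoD[OF chi_iso[OF U(1)]] and cW = alg_isoD[OF chi_iso[OF W(1)]]
  have N: "res F U' W' (\<chi> U t) = \<chi> W (res E U W t)" if "t \<in> carrier (sect E U)" for t
    using chi_res[OF U(1) W(1) sub that] by (simp add: U W)
  have ex: "\<exists>t. t \<in> carrier (sect E U) \<and> s = \<chi> U t" if s: "s \<in> carrier (sect F U')" for s
    using s unfolding U(2) by (elim sect_imageE[OF U(1)]) blast
  have k: "c \<in> carrier base_field" for c :: 'k by (simp add: base_field_def)
  note rm = ring_hom_memE[OF rr(1)]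
  show "res F U' W' \<in> alg_hom (sect F U') (sect F W')"
    unfolding alg_hom_def
  proof (intro CollectI conjI allI ballI ring_hom_memI)
    fix s assume "s \<in> carrier (sect F U')"
    then obtain t where t: "t \<in> carrier (sect E U)" "s = \<chi> U t" using ex by blast
    show "res F U' W' s \<in> carrier (sect F W')"
      using t N rm(1) cW(8) by (simp add: W(2))
    show "res F U' W' (c \<odot>\<^bsub>sect F U'\<^esub> s) = c \<odot>\<^bsub>sect F W'\<^esub> res F U' W' s" for c
      using t N[of "c \<odot>\<^bsub>sect E U\<^esub> t"] N[of t] cU(12)[of t c] cW(12) rr(2) rm(1) k
      by (simp add: U(2) W(2))
    fix s' assume "s' \<in> carrier (sect F U')"
    then obtain t' where t': "t' \<in> carrier (sect E U)" "s' = \<chi> U t'" using ex by blast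
    show "res F U' W' (s \<otimes>\<^bsub>sect F U'\<^esub> s') = res F U' W' s \<otimes>\<^bsub>sect F W'\<^esub> res F U' W' s'"
      using t t' N[of "t \<otimes>\<^bsub>sect E U\<^esub> t'"] N[of t] N[of t'] cU(9)[of t t'] cW(9) rm(1,2)
      by (simp add: U(2) W(2))
    show "res F U' W' (s \<oplus>\<^bsub>sect F U'\<^esub> s') = res F U' W' s \<oplus>\<^bsub>sect F W'\<^esub> res F U' W' s'"
      using t t' N[of "t \<oplus>\<^bsub>sect E U\<^esub> t'"] N[of t] N[of t'] cU(10)[of t t'] cW(10) rm(1,3)
      by (simp add: U(2) W(2))
  next
    show "res F U' W' \<one>\<^bsub>sect F U'\<^esub> = \<one>\<^bsub>sect F W'\<^esub>"
      using N[OF AU.one_closed] cU(11) cW(11) rm(4) by (simp add: U(2) W(2))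
  qed
  fix N' s assume oN: "openin (points F) N'" and NW: "N' \<subseteq> W'" and s: "s \<in> carrier (sect F U')"
  obtain N where N': "openin (points E) N" "N' = \<phi> ` N" using oN by (rule open_imageE)
  obtain t where t: "t \<in> carrier (sect E U)" "s = \<chi> U t" using ex[OF s] by blast
  have sub': "N \<subseteq> W" using NW image_subset_iff'[OF N'(1) W(1)] by (simp add: N' W)
  have "res F W' N' (res F U' W' s) = \<chi> N (res E W N (res E U W t))"
    using chi_res[OF W(1) N'(1) sub' E_res[OF U(1) W(1) sub t(1)]] N[OF t(1)] by (simp add: W N' t)
  also have "\<dots> = \<chi> N (res E U N t)" using E_res_res[OF U(1) W(1) N'(1) sub sub' t(1)] by simp
  also have "\<dots> = res F U' N' s"
    using chi_res[OF U(1) N'(1) _ t(1)] sub sub' by (simp add: U N' t)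
  finally show "res F W' N' (res F U' W' s) = res F U' N' s" .
qed

lemma sheaf_iso_inv:
  assumes "\<And>x. x \<in> topspace (points E) \<Longrightarrow> \<phi>' (\<phi> x) = x"
  shows "sheaf_iso F E \<phi>' (\<lambda>U'. inv_into (carrier (sect E (\<phi>' ` U'))) (\<chi> (\<phi>' ` U')))"
  unfolding sheaf_iso_def
proof (intro conjI allI impI ballI)
  have im: "\<phi>' ` \<phi> ` U = U" if "openin (points E) U" for U
    using assms openin_subset[OF that] by (force simp: image_iff)
  obtain g where g: "homeomorphic_maps (points E) (points F) \<phi> g"
    using phi_homeomorphic homeomorphic_map_maps by blast
  then have "homeomorphic_map (points F) (points E) g"
    using homeomorphic_maps_sym homeomorphic_maps_map by blast
  moreover have "g y = \<phi>' y" if "y \<in> topspace (points F)" for y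
    using that g assms unfolding phi_surj[symmetric] by (auto simp: homeomorphic_maps_def)
  ultimately show "homeomorphic_map (points F) (points E) \<phi>'" by (rule homeomorphic_map_eq)
  show "alg_iso (sect F U') (sect E (\<phi>' ` U')) (inv_into (carrier (sect E (\<phi>' ` U'))) (\<chi> (\<phi>' ` U')))"
    if U': "openin (points F) U'" for U'
  proof -
    obtain U where U: "openin (points E) U" "U' = \<phi> ` U" using U' by (rule open_imageE)
    show ?thesis using alg_iso_inv[OF E_algebra[OF U(1)] chi_iso[OF U(1)]] by (simp add: U im)
  qed
  fix U' W' s assume *: "openin (points F) U'" "openin (points F) W'" and WU: "W' \<subseteq> U'" and s: "s \<in> carrier (sect F U')"
  obtain U where U: "openin (points E) U" "U' = \<phi> ` U" using *(1) by (rule open_imageE)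
  obtain W where W: "openin (points E) W" "W' = \<phi> ` W" using *(2) by (rule open_imageE)
  have sub: "W \<subseteq> U" using WU image_subset_iff'[OF W(1) U(1)] by (simp add: W U)
  obtain t where t: "t \<in> carrier (sect E U)" "s = \<chi> U t"
    using s unfolding U(2) by (rule sect_imageE[OF U(1)])
  have "inv_into (carrier (sect E W)) (\<chi> W) (res F (\<phi> ` U) (\<phi> ` W) s) = res E U W t"
    unfolding t(2) chi_res[OF U(1) W(1) sub t(1), symmetric]
    by (rule inv_into_f_f[OF alg_isoD(6)[OF chi_iso[OF W(1)]] E_res[OF U(1) W(1) sub t(1)]])
  moreover have "inv_into (carrier (sect E U)) (\<chi> U) s = t"
    using t inv_into_f_f[OF alg_isoD(6)[OF chi_iso[OF U(1)]]] by simp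
  ultimately show "inv_into (carrier (sect E (\<phi>' ` W'))) (\<chi> (\<phi>' ` W')) (res F U' W' s) =
      res E (\<phi>' ` U') (\<phi>' ` W') (inv_into (carrier (sect E (\<phi>' ` U'))) (\<chi> (\<phi>' ` U')) s)"
    using im U W by simp
qed

text \<open>The open sets and sections are pulled back to \<open>E\<close> and glued there.
  Uniqueness carries over because \<open>key\<close> translates the gluing condition in both
  directions and every section over the union is an image under \<chi>.\<close>

lemma sheaf_image:
  assumes E: "sheaf_of_algebras E"
  shows "sheaf_of_algebras F"
  unfolding sheaf_of_algebras_def
proof (intro conjI allI impI presheaf_image)
  fix \<U>' and f' :: "'q set \<Rightarrow> 't"
  assume op: "\<forall>U\<in>\<U>'. openin (points F) U \<and> f' U \<in> carrier (sect F U)"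
    and comp: "\<forall>U\<in>\<U>'. \<forall>W\<in>\<U>'. res F U (U \<inter> W) (f' U) = res F W (U \<inter> W) (f' W)"
  define \<U> where "\<U> = {U. openin (points E) U \<and> \<phi> ` U \<in> \<U>'}"
  define f where "f U = inv_into (carrier (sect E U)) (\<chi> U) (f' (\<phi> ` U))" for U
  have opU: "openin (points E) U" if "U \<in> \<U>" for U using that by (simp add: \<U>_def)
  have f: "f U \<in> carrier (sect E U)" "\<chi> U (f U) = f' (\<phi> ` U)" if U: "U \<in> \<U>" for U
  proof -
    have "f' (\<phi> ` U) \<in> \<chi> U ` carrier (sect E U)"
      using op U alg_isoD(7)[OF chi_iso[OF opU[OF U]]] by (auto simp: \<U>_def)
    then show "f U \<in> carrier (sect E U)" "\<chi> U (f U) = f' (\<phi> ` U)"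
      unfolding f_def by (auto simp: inv_into_into f_inv_into_f)
  qed
  have im: "\<phi> ` U \<in> \<U>'" if "U \<in> \<U>" for U using that by (simp add: \<U>_def)
  have preim: "\<exists>U\<in>\<U>. U' = \<phi> ` U" if U': "U' \<in> \<U>'" for U'
  proof -
    have "openin (points F) U'" using op U' by blast
    then obtain U where "openin (points E) U" "U' = \<phi> ` U" by (rule open_imageE)
    then show ?thesis using U' by (auto simp: \<U>_def)
  qed
  have compE: "res E U (U \<inter> W) (f U) = res E W (U \<inter> W) (f W)" if UW: "U \<in> \<U>" "W \<in> \<U>" for U W
  proof -
    note o = opU[OF UW(1)] opU[OF UW(2)] openin_Int[OF opU[OF UW(1)] opU[OF UW(2)]]
    have "\<chi> (U \<inter> W) (res E U (U \<inter> W) (f U)) = \<chi> (U \<inter> W) (res E W (U \<inter> W) (f W))"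
      using chi_res[OF o(1,3) _ f(1)[OF UW(1)]] chi_res[OF o(2,3) _ f(1)[OF UW(2)]] f(2)[OF UW(1)] f(2)[OF UW(2)]
        comp[rule_format, OF im[OF UW(1)] im[OF UW(2)]]
      by (simp add: image_Int[OF o(1,2)])
    then show ?thesis
      using chi_inj[OF o(3) E_res[OF o(1,3) _ f(1)[OF UW(1)]] E_res[OF o(2,3) _ f(1)[OF UW(2)]]] by simp
  qed
  let ?X = "\<Union>\<U>"
  have X: "openin (points E) ?X" using opU by blast
  have X': "\<Union>\<U>' = \<phi> ` ?X"
  proof -
    have "\<U>' = (\<lambda>U. \<phi> ` U) ` \<U>" using im preim by blast
    then show ?thesis by (simp add: image_Union)
  qed
  have "\<exists>!s. s \<in> carrier (sect E ?X) \<and> (\<forall>U\<in>\<U>. res E ?X U s = f U)"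
    using E[unfolded sheaf_of_algebras_def, THEN conjunct2, rule_format, of \<U> f] opU f(1) compE by blast
  then obtain s where s: "s \<in> carrier (sect E ?X)" "\<And>U. U \<in> \<U> \<Longrightarrow> res E ?X U s = f U"
    and uni: "\<And>t. t \<in> carrier (sect E ?X) \<Longrightarrow> (\<forall>U\<in>\<U>. res E ?X U t = f U) \<Longrightarrow> t = s" by blast
  have key: "(\<forall>U'\<in>\<U>'. res F (\<Union>\<U>') U' (\<chi> ?X t) = f' U') \<longleftrightarrow> (\<forall>U\<in>\<U>. res E ?X U t = f U)"
    if t: "t \<in> carrier (sect E ?X)" for t
  proof -
    have "res F (\<Union>\<U>') (\<phi> ` U) (\<chi> ?X t) = f' (\<phi> ` U) \<longleftrightarrow> res E ?X U t = f U" if U: "U \<in> \<U>" for U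
    proof -
      have sub: "U \<subseteq> ?X" using U by blast
      have "res F (\<Union>\<U>') (\<phi> ` U) (\<chi> ?X t) = \<chi> U (res E ?X U t)"
        using chi_res[OF X opU[OF U] sub t] by (simp add: X')
      then show ?thesis using f[OF U] chi_inj[OF opU[OF U] E_res[OF X opU[OF U] sub t] f(1)[OF U]] by simp
    qed
    moreover have "\<U>' = (\<lambda>U. \<phi> ` U) ` \<U>" using im preim by blast
    ultimately show ?thesis by simp
  qed
  show "\<exists>!s. s \<in> carrier (sect F (\<Union>\<U>')) \<and> (\<forall>U\<in>\<U>'. res F (\<Union>\<U>') U s = f' U)"
  proof (rule ex1I[of _ "\<chi> ?X s"], intro conjI)
    show "\<chi> ?X s \<in> carrier (sect F (\<Union>\<U>'))" using chi_carrier[OF X s(1)] by (simp only: X')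
    show "\<forall>U\<in>\<U>'. res F (\<Union>\<U>') U (\<chi> ?X s) = f' U" using key[OF s(1)] s(2) by blast
    fix t' assume t': "t' \<in> carrier (sect F (\<Union>\<U>')) \<and> (\<forall>U\<in>\<U>'. res F (\<Union>\<U>') U t' = f' U)"
    then have "t' \<in> carrier (sect F (\<phi> ` ?X))" by (simp only: X')
    then obtain t where t: "t \<in> carrier (sect E ?X)" "t' = \<chi> ?X t" by (rule sect_imageE[OF X])
    then show "t' = \<chi> ?X s" using uni[OF t(1)] key[OF t(1)] t' by blast
  qed
qed


section \<open>Stalks\<close>

text \<open>Germs are sets of pairs, so the induced map on stalks is formation of the image under
  \<open>push\<close>.\<close>

definition push :: "'p set \<times> 's \<Rightarrow> 'q set \<times> 't" where
  "push = (\<lambda>(U, s). (\<phi> ` U, \<chi> U s))"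

text \<open>The possible representatives of germs at \<open>x\<close>. On these pairs
  \<open>push\<close> is injective, which it need not be on arbitrary ones.\<close>

definition reps :: "'p \<Rightarrow> ('p set \<times> 's) set" where
  "reps x = {(U, s). openin (points E) U \<and> x \<in> U \<and> s \<in> carrier (sect E U)}"

lemma germ_subset_reps: "germ E x U s \<subseteq> reps x"
  by (auto simp: germ_def reps_def)

lemma image_mem_iff:
  assumes "x \<in> topspace (points E)" "openin (points E) U"
  shows "\<phi> x \<in> \<phi> ` U \<longleftrightarrow> x \<in> U"
  using inj_on_image_mem_iff[OF phi_inj assms(1)] openin_subset[OF assms(2)] by blast

text \<open>Open sets and sections on the side of \<open>F\<close> all come from \<open>E\<close>,
  and their restrictions agree exactly when those of the originals do, since each
  \<open>\<chi> N\<close> is injective on sections. So no representative is lost or gained.\<close>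

lemma germ_image:
  assumes x: "x \<in> topspace (points E)" and U: "openin (points E) U" "x \<in> U" and s: "s \<in> carrier (sect E U)"
  shows "germ F (\<phi> x) (\<phi> ` U) (\<chi> U s) = push ` germ E x U s"
proof (intro equalityI subsetI)
  fix z assume "z \<in> push ` germ E x U s"
  then obtain W t N where W: "openin (points E) W" "x \<in> W" "t \<in> carrier (sect E W)" "z = (\<phi> ` W, \<chi> W t)"
    and N: "openin (points E) N" "x \<in> N" "N \<subseteq> U \<inter> W" "res E U N s = res E W N t"
    by (auto simp: germ_def push_def)
  have "res F (\<phi> ` U) (\<phi> ` N) (\<chi> U s) = res F (\<phi> ` W) (\<phi> ` N) (\<chi> W t)"
    using chi_res[OF U(1) N(1) _ s] chi_res[OF W(1) N(1) _ W(3)] N(3,4) by simp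
  moreover have "\<phi> ` N \<subseteq> \<phi> ` U \<inter> \<phi> ` W" using N(3) by blast
  ultimately show "z \<in> germ F (\<phi> x) (\<phi> ` U) (\<chi> U s)"
    unfolding germ_def W(4) using W open_image[OF W(1)] chi_carrier[OF W(1,3)] open_image[OF N(1)] N(2)
    by (auto intro!: exI[of _ "\<phi> ` N"])
next
  fix z assume "z \<in> germ F (\<phi> x) (\<phi> ` U) (\<chi> U s)"
  then obtain W' t' N' where W': "openin (points F) W'" "\<phi> x \<in> W'" "t' \<in> carrier (sect F W')" "z = (W', t')"
    and N': "openin (points F) N'" "\<phi> x \<in> N'" "N' \<subseteq> \<phi> ` U \<inter> W'" "res F (\<phi> ` U) N' (\<chi> U s) = res F W' N' t'"
    unfolding germ_def by blast
  obtain W where W: "openin (points E) W" "W' = \<phi> ` W" using W'(1) by (rule open_imageE)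
  obtain N where N: "openin (points E) N" "N' = \<phi> ` N" using N'(1) by (rule open_imageE)
  obtain t where t: "t \<in> carrier (sect E W)" "t' = \<chi> W t"
    using W'(3) unfolding W(2) by (rule sect_imageE[OF W(1)])
  have sub: "N \<subseteq> U" "N \<subseteq> W"
    using N'(3) image_subset_iff'[OF N(1) U(1)] image_subset_iff'[OF N(1) W(1)] by (auto simp: N(2) W(2))
  have "\<chi> N (res E U N s) = \<chi> N (res E W N t)"
    using N'(4) chi_res[OF U(1) N(1) sub(1) s] chi_res[OF W(1) N(1) sub(2) t(1)] by (simp add: N(2) W(2) t(2))
  then have "res E U N s = res E W N t"
    using chi_inj[OF N(1) E_res[OF U(1) N(1) sub(1) s] E_res[OF W(1) N(1) sub(2) t(1)]] by simp
  moreover have "x \<in> W" "x \<in> N"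
    using W'(2) N'(2) image_mem_iff[OF x W(1)] image_mem_iff[OF x N(1)] by (auto simp: W(2) N(2))
  ultimately have "(W, t) \<in> germ E x U s"
    unfolding germ_def using W(1) N(1) sub t(1) by blast
  moreover have "z = push (W, t)" by (simp add: push_def W'(4) W(2) t(2))
  ultimately show "z \<in> push ` germ E x U s" by blast
qed

lemma push_inj: "inj_on push (reps x)"
proof (rule inj_onI, clarify)
  fix U s W t assume *: "(U, s) \<in> reps x" "(W, t) \<in> reps x" "push (U, s) = push (W, t)"
  then have U: "openin (points E) U" "s \<in> carrier (sect E U)" and W: "openin (points E) W" "t \<in> carrier (sect E W)"
    and eq: "\<phi> ` U = \<phi> ` W" "\<chi> U s = \<chi> W t" by (auto simp: reps_def push_def)
  have "U = W"
    using eq(1) image_subset_iff'[OF U(1) W(1)] image_subset_iff'[OF W(1) U(1)] by blast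
  then show "U = W \<and> s = t" using eq(2) chi_inj[OF U(1), of s t] U W by simp
qed

lemma stalk_carrier_subset: "c \<in> carrier (stalk E x) \<Longrightarrow> c \<subseteq> reps x"
  using germ_subset_reps by (auto simp: stalk_def)

text \<open>The operations of a stalk are unions over representatives, so \<open>push\<close> carries them over termwise and
  their well-definedness plays no role.\<close>

lemma stalk_iso:
  assumes x: "x \<in> topspace (points E)"
  shows "(`) push \<in> ring_iso (stalk E x) (stalk F (\<phi> x))" "push ` \<zero>\<^bsub>stalk E x\<^esub> = \<zero>\<^bsub>stalk F (\<phi> x)\<^esub>"
proof -
  have top: "openin (points E) (topspace (points E))" by simp
  interpret top: algebra base_field "sect E (topspace (points E))" by (rule E_algebra[OF top])
  note ct = alg_isoD[OF chi_iso[OF top]]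
  show "push ` \<zero>\<^bsub>stalk E x\<^esub> = \<zero>\<^bsub>stalk F (\<phi> x)\<^esub>"
    using germ_image[OF x top x top.zero_closed] ct(5) by (simp add: stalk_def phi_surj)
  have one: "push ` \<one>\<^bsub>stalk E x\<^esub> = \<one>\<^bsub>stalk F (\<phi> x)\<^esub>"
    using germ_image[OF x top x top.one_closed] ct(11) by (simp add: stalk_def phi_surj)
  \<comment> \<open>One statement for both stalk operations: \<open>f\<close> and \<open>g\<close>
    stand for the operation applied, on either side, to the sections restricted to the
    intersection.\<close>
  have union: "push ` (\<Union>(U, s)\<in>c. \<Union>(W, t)\<in>d. germ E x (U \<inter> W) (f U W s t)) =
      (\<Union>(U, s)\<in>push ` c. \<Union>(W, t)\<in>push ` d. germ F (\<phi> x) (U \<inter> W) (g U W s t))"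
    if cd: "c \<subseteq> reps x" "d \<subseteq> reps x"
      and f: "\<And>U W s t. openin (points E) U \<Longrightarrow> s \<in> carrier (sect E U) \<Longrightarrow> openin (points E) W \<Longrightarrow>
        t \<in> carrier (sect E W) \<Longrightarrow> f U W s t \<in> carrier (sect E (U \<inter> W)) \<and>
        \<chi> (U \<inter> W) (f U W s t) = g (\<phi> ` U) (\<phi> ` W) (\<chi> U s) (\<chi> W t)" for c d f g
  proof -
    have "push ` germ E x (U \<inter> W) (f U W s t) =
        germ F (\<phi> x) (\<phi> ` U \<inter> \<phi> ` W) (g (\<phi> ` U) (\<phi> ` W) (\<chi> U s) (\<chi> W t))"
      if "(U, s) \<in> c" "(W, t) \<in> d" for U s W t
    proof -
      have "(U, s) \<in> reps x" "(W, t) \<in> reps x" using that cd by auto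
      then have *: "openin (points E) U" "x \<in> U" "s \<in> carrier (sect E U)"
        "openin (points E) W" "x \<in> W" "t \<in> carrier (sect E W)" by (auto simp: reps_def)
      show ?thesis
        using germ_image[OF x openin_Int[OF *(1,4)] _ conjunct1[OF f[OF *(1,3,4,6)]]] f[OF *(1,3,4,6)] *(2,5)
        by (simp add: image_Int[OF *(1,4)])
    qed
    then have key: "push ` germ E x (fst z \<inter> fst w) (f (fst z) (fst w) (snd z) (snd w)) =
        germ F (\<phi> x) (fst (push z) \<inter> fst (push w)) (g (fst (push z)) (fst (push w)) (snd (push z)) (snd (push w)))"
      if "z \<in> c" "w \<in> d" for z w
      using that by (cases z; cases w) (simp add: push_def)
    have "push ` (\<Union>(U, s)\<in>c. \<Union>(W, t)\<in>d. germ E x (U \<inter> W) (f U W s t)) =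
        (\<Union>z\<in>c. \<Union>w\<in>d. push ` germ E x (fst z \<inter> fst w) (f (fst z) (fst w) (snd z) (snd w)))"
      by (simp add: image_UN case_prod_beta)
    also have "\<dots> = (\<Union>z\<in>c. \<Union>w\<in>d. germ F (\<phi> x) (fst (push z) \<inter> fst (push w))
        (g (fst (push z)) (fst (push w)) (snd (push z)) (snd (push w))))"
      by (intro SUP_cong refl key)
    also have "\<dots> = (\<Union>(U, s)\<in>push ` c. \<Union>(W, t)\<in>push ` d. germ F (\<phi> x) (U \<inter> W) (g U W s t))"
      by (simp add: case_prod_beta)
    finally show ?thesis .
  qed
  show "(`) push \<in> ring_iso (stalk E x) (stalk F (\<phi> x))"
  proof (rule ring_iso_memI)
    fix c d assume cd: "c \<in> carrier (stalk E x)" "d \<in> carrier (stalk E x)"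
    note sub = stalk_carrier_subset[OF cd(1)] stalk_carrier_subset[OF cd(2)]
    have r: "res E U (U \<inter> W) s \<in> carrier (sect E (U \<inter> W))" "res E W (U \<inter> W) t \<in> carrier (sect E (U \<inter> W))"
      "\<chi> (U \<inter> W) (res E U (U \<inter> W) s) = res F (\<phi> ` U) (\<phi> ` (U \<inter> W)) (\<chi> U s)"
      "\<chi> (U \<inter> W) (res E W (U \<inter> W) t) = res F (\<phi> ` W) (\<phi> ` (U \<inter> W)) (\<chi> W t)"
      "k_algebra (sect E (U \<inter> W))" "alg_iso (sect E (U \<inter> W)) (sect F (\<phi> ` (U \<inter> W))) (\<chi> (U \<inter> W))"
      if "openin (points E) U" "s \<in> carrier (sect E U)" "openin (points E) W" "t \<in> carrier (sect E W)" for U W s t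
      using that by (auto intro!: E_res chi_res E_algebra chi_iso)
    have closed: "a \<otimes>\<^bsub>sect E U\<^esub> b \<in> carrier (sect E U)" "a \<oplus>\<^bsub>sect E U\<^esub> b \<in> carrier (sect E U)"
      if "k_algebra (sect E U)" "a \<in> carrier (sect E U)" "b \<in> carrier (sect E U)" for U a b
    proof -
      interpret algebra base_field "sect E U" by (rule that(1))
      show "a \<otimes>\<^bsub>sect E U\<^esub> b \<in> carrier (sect E U)" "a \<oplus>\<^bsub>sect E U\<^esub> b \<in> carrier (sect E U)"
        using that by auto
    qed
    show "push ` (c \<otimes>\<^bsub>stalk E x\<^esub> d) = push ` c \<otimes>\<^bsub>stalk F (\<phi> x)\<^esub> push ` d"
      unfolding stalk_def ring.simps monoid.simps
    proof (rule union[OF sub, of _ "\<lambda>U W s t. res F U (U \<inter> W) s \<otimes>\<^bsub>sect F (U \<inter> W)\<^esub> res F W (U \<inter> W) t"], intro conjI)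
      fix U W s t assume *: "openin (points E) U" "s \<in> carrier (sect E U)" "openin (points E) W" "t \<in> carrier (sect E W)"
      note r = r[OF *]
      show "res E U (U \<inter> W) s \<otimes>\<^bsub>sect E (U \<inter> W)\<^esub> res E W (U \<inter> W) t \<in> carrier (sect E (U \<inter> W))"
        by (rule closed(1)[OF r(5,1,2)])
      show "\<chi> (U \<inter> W) (res E U (U \<inter> W) s \<otimes>\<^bsub>sect E (U \<inter> W)\<^esub> res E W (U \<inter> W) t) =
          res F (\<phi> ` U) (\<phi> ` U \<inter> \<phi> ` W) (\<chi> U s) \<otimes>\<^bsub>sect F (\<phi> ` U \<inter> \<phi> ` W)\<^esub> res F (\<phi> ` W) (\<phi> ` U \<inter> \<phi> ` W) (\<chi> W t)"
        unfolding image_Int[OF *(1,3), symmetric] r(3,4)[symmetric] by (rule alg_isoD(9)[OF r(6,1,2)])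
    qed
    show "push ` (c \<oplus>\<^bsub>stalk E x\<^esub> d) = push ` c \<oplus>\<^bsub>stalk F (\<phi> x)\<^esub> push ` d"
      unfolding stalk_def ring.simps monoid.simps
    proof (rule union[OF sub, of _ "\<lambda>U W s t. res F U (U \<inter> W) s \<oplus>\<^bsub>sect F (U \<inter> W)\<^esub> res F W (U \<inter> W) t"], intro conjI)
      fix U W s t assume *: "openin (points E) U" "s \<in> carrier (sect E U)" "openin (points E) W" "t \<in> carrier (sect E W)"
      note r = r[OF *]
      show "res E U (U \<inter> W) s \<oplus>\<^bsub>sect E (U \<inter> W)\<^esub> res E W (U \<inter> W) t \<in> carrier (sect E (U \<inter> W))"
        by (rule closed(2)[OF r(5,1,2)])
      show "\<chi> (U \<inter> W) (res E U (U \<inter> W) s \<oplus>\<^bsub>sect E (U \<inter> W)\<^esub> res E W (U \<inter> W) t) =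
          res F (\<phi> ` U) (\<phi> ` U \<inter> \<phi> ` W) (\<chi> U s) \<oplus>\<^bsub>sect F (\<phi> ` U \<inter> \<phi> ` W)\<^esub> res F (\<phi> ` W) (\<phi> ` U \<inter> \<phi> ` W) (\<chi> W t)"
        unfolding image_Int[OF *(1,3), symmetric] r(3,4)[symmetric] by (rule alg_isoD(10)[OF r(6,1,2)])
    qed
  next
    fix c assume "c \<in> carrier (stalk E x)"
    then obtain U s where U: "openin (points E) U" "x \<in> U" "s \<in> carrier (sect E U)" "c = germ E x U s"
      by (auto simp: stalk_def)
    then have "push ` c = germ F (\<phi> x) (\<phi> ` U) (\<chi> U s)" using germ_image[OF x U(1-3)] by simp
    then show "push ` c \<in> carrier (stalk F (\<phi> x))"
      using open_image[OF U(1)] chi_carrier[OF U(1,3)] U(2) by (auto simp: stalk_def)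
  next
    show "bij_betw ((`) push) (carrier (stalk E x)) (carrier (stalk F (\<phi> x)))"
      unfolding bij_betw_def
    proof (intro conjI equalityI subsetI)
      show "inj_on ((`) push) (carrier (stalk E x))"
      proof (rule inj_onI)
        fix c d assume "c \<in> carrier (stalk E x)" "d \<in> carrier (stalk E x)" "push ` c = push ` d"
        then show "c = d"
          using inj_on_image_eq_iff[OF push_inj stalk_carrier_subset stalk_carrier_subset] by blast
      qed
    next
      fix c' assume "c' \<in> (`) push ` carrier (stalk E x)"
      then obtain U s where U: "openin (points E) U" "x \<in> U" "s \<in> carrier (sect E U)" "c' = push ` germ E x U s"
        by (auto simp: stalk_def)
      then have "c' = germ F (\<phi> x) (\<phi> ` U) (\<chi> U s)" using germ_image[OF x U(1-3)] by simp
      then show "c' \<in> carrier (stalk F (\<phi> x))"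
        using open_image[OF U(1)] chi_carrier[OF U(1,3)] U(2) by (auto simp: stalk_def)
    next
      fix c' assume "c' \<in> carrier (stalk F (\<phi> x))"
      then obtain U' s' where U': "openin (points F) U'" "\<phi> x \<in> U'" "s' \<in> carrier (sect F U')"
        "c' = germ F (\<phi> x) U' s'" by (auto simp: stalk_def)
      obtain U where U: "openin (points E) U" "U' = \<phi> ` U" using U'(1) by (rule open_imageE)
      obtain s where s: "s \<in> carrier (sect E U)" "s' = \<chi> U s"
        using U'(3) unfolding U(2) by (rule sect_imageE[OF U(1)])
      have xU: "x \<in> U" using U'(2) image_mem_iff[OF x U(1)] by (simp add: U(2))
      have "c' = push ` germ E x U s" using germ_image[OF x U(1) xU s(1)] by (simp add: U'(4) U(2) s(2))
      moreover have "germ E x U s \<in> carrier (stalk E x)" using U(1) xU s(1) by (auto simp: stalk_def)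
      ultimately show "c' \<in> (`) push ` carrier (stalk E x)" by blast
    qed
  qed (rule one)
qed

section \<open>Morphisms of locally ringed spaces\<close>

lemma locally_ringed_image:
  assumes "locally_ringed_space E"
  shows "locally_ringed_space F"
  unfolding locally_ringed_space_def
proof (intro conjI ballI)
  show "sheaf_of_algebras F" using assms sheaf_image by (simp add: locally_ringed_space_def)
  fix y assume "y \<in> topspace (points F)"
  then obtain x where x: "x \<in> topspace (points E)" "y = \<phi> x" unfolding phi_surj[symmetric] by (rule imageE)
  have "local_ring (stalk E x)" using assms x by (simp add: locally_ringed_space_def)
  then show "local_ring (stalk F y)"
    unfolding x(2) by (rule local_ring_iso_image) (rule stalk_iso[OF x(1)])+
qed

text \<open>The relation between representatives is transitive: two neighbourhoods on which sections
  agree are intersected. Used in both directions, this shows that the classes coincide.\<close>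

lemma germ_eqI:
  assumes "openin (points E) U" "x \<in> U" "s \<in> carrier (sect E U)" "(W, t) \<in> germ E x U s"
  shows "germ E x W t = germ E x U s"
proof -
  have half: "germ E x W t \<subseteq> germ E x U s"
    if U: "openin (points E) U" "s \<in> carrier (sect E U)" and W: "openin (points E) W" "t \<in> carrier (sect E W)"
      and N: "openin (points E) N" "x \<in> N" "N \<subseteq> U \<inter> W" "res E U N s = res E W N t" for U W s t N
  proof
    fix z assume "z \<in> germ E x W t"
    then obtain W' t' N' where *: "z = (W', t')" "openin (points E) W'" "x \<in> W'" "t' \<in> carrier (sect E W')"
      "openin (points E) N'" "x \<in> N'" "N' \<subseteq> W \<inter> W'" "res E W N' t = res E W' N' t'"
      unfolding germ_def by blast
    let ?I = "N \<inter> N'"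
    have I: "openin (points E) ?I" using N(1) *(5) by (rule openin_Int)
    have "res E U ?I s = res E N ?I (res E U N s)"
      using E_res_res[OF U(1) N(1) I _ _ U(2)] N(3) by simp
    also have "\<dots> = res E W ?I t"
      unfolding N(4) using E_res_res[OF W(1) N(1) I _ _ W(2)] N(3) by simp
    also have "\<dots> = res E N' ?I (res E W N' t)"
      using E_res_res[OF W(1) *(5) I _ _ W(2)] *(7) by simp
    also have "\<dots> = res E W' ?I t'"
      unfolding *(8) using E_res_res[OF *(2,5) I _ _ *(4)] *(7) by simp
    finally show "z \<in> germ E x U s"
      unfolding germ_def *(1) using * N I by blast
  qed
  obtain N where "openin (points E) W" "t \<in> carrier (sect E W)"
    "openin (points E) N" "x \<in> N" "N \<subseteq> U \<inter> W" "res E U N s = res E W N t"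
    using assms(4) unfolding germ_def by blast
  then show ?thesis using half[of U s W t N] half[of W t U s N] assms by (simp add: Int_commute)
qed

text \<open>The stalk map is a union over the representatives of \<open>c\<close>, and each of them
  contributes the same germ.\<close>

lemma stalk_map_eq:
  assumes x: "x \<in> topspace (points E)" and inv: "\<And>x. x \<in> topspace (points E) \<Longrightarrow> \<phi>' (\<phi> x) = x"
    and c: "c \<in> carrier (stalk E x)"
  shows "stalk_map F \<phi>' \<chi> (\<phi> x) c = push ` c"
proof -
  obtain U0 s0 where c0: "openin (points E) U0" "x \<in> U0" "s0 \<in> carrier (sect E U0)" "c = germ E x U0 s0"
    using c by (auto simp: stalk_def)
  have "(U0, s0) \<in> c" using c0 by (auto simp: germ_def)
  moreover have "germ F (\<phi> x) (preimage F \<phi>' U) (\<chi> U s) = push ` c" if "(U, s) \<in> c" for U s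
  proof -
    have *: "openin (points E) U" "x \<in> U" "s \<in> carrier (sect E U)" using that c0(4) by (auto simp: germ_def)
    have "preimage F \<phi>' U = \<phi> ` U"
      using inv openin_subset[OF *(1)] by (force simp: preimage_def phi_surj[symmetric])
    moreover have "germ E x U s = c" using germ_eqI[OF c0(1-3)] that c0(4) by blast
    ultimately show ?thesis using germ_image[OF x *] by simp
  qed
  ultimately show ?thesis unfolding stalk_map_def by blast
qed

lemma preimage_inv:
  assumes inv: "\<And>x. x \<in> topspace (points E) \<Longrightarrow> \<phi>' (\<phi> x) = x" and U: "openin (points E) U"
  shows "preimage F \<phi>' U = \<phi> ` U"
  using inv openin_subset[OF U] by (force simp: preimage_def phi_surj[symmetric])

text \<open>In a morphism the maps of sections go against the map of points: \<chi>, which sends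
  sections of \<open>E\<close> to sections of \<open>F\<close>, belongs to the inverse
  \<open>\<phi>'\<close> of \<phi>.\<close>

lemma morphism_inv:
  assumes E: "locally_ringed_space E" and inv: "\<And>x. x \<in> topspace (points E) \<Longrightarrow> \<phi>' (\<phi> x) = x"
  shows "lrs_morphism F E \<phi>' \<chi>"
  unfolding lrs_morphism_def
proof (intro conjI allI impI ballI E locally_ringed_image)
  have "homeomorphic_map (points F) (points E) \<phi>'"
    using sheaf_iso_inv[OF inv] by (simp add: sheaf_iso_def)
  then show "continuous_map (points F) (points E) \<phi>'" by (rule homeomorphic_imp_continuous_map)
  show "\<chi> U \<in> alg_hom (sect E U) (sect F (preimage F \<phi>' U))" if "openin (points E) U" for U
    using alg_isoD(1)[OF chi_iso[OF that]] by (simp add: preimage_inv[OF inv that])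
  show "\<chi> W (res E U W s) = res F (preimage F \<phi>' U) (preimage F \<phi>' W) (\<chi> U s)"
    if "openin (points E) U" "openin (points E) W" "W \<subseteq> U" "s \<in> carrier (sect E U)" for U W s
    using chi_res[OF that] that(1,2) by (simp add: preimage_inv[OF inv])
  fix y assume "y \<in> topspace (points F)"
  then obtain x where x: "x \<in> topspace (points E)" "y = \<phi> x" unfolding phi_surj[symmetric] by (rule imageE)
  have lE: "local_ring (stalk E x)" using E x by (simp add: locally_ringed_space_def)
  have lF: "local_ring (stalk F y)"
    using locally_ringed_image[OF E] \<open>y \<in> topspace (points F)\<close> by (simp add: locally_ringed_space_def)
  interpret RE: cring "stalk E x" using lE by (simp add: local_ring_def)
  have eq: "stalk_map F \<phi>' \<chi> y c = push ` c" if "c \<in> carrier (stalk E x)" for c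
    using stalk_map_eq[OF x(1) inv that] by (simp add: x(2))
  have iso: "(`) push \<in> ring_iso (stalk E x) (stalk F y)" using stalk_iso[OF x(1)] by (simp add: x(2))
  have "stalk_map F \<phi>' \<chi> y \<in> ring_hom (stalk E x) (stalk F y)"
    by (rule RE.ring_hom_restrict[of "(`) push"]) (use iso eq in \<open>auto simp: ring_iso_def\<close>)
  \<comment> \<open>The stalk map is an isomorphism, so it carries a maximal ideal onto a maximal
    ideal, and that is \<open>N\<close> by uniqueness.\<close>
  moreover have "stalk_map F \<phi>' \<chi> y ` M \<subseteq> N"
    if M: "maximalideal M (stalk E x)" and N: "maximalideal N (stalk F y)" for M N
  proof -
    have "M \<subseteq> carrier (stalk E x)"
      using M by (simp add: additive_subgroup.a_subset ideal.axioms(1) maximalideal.axioms(1))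
    then have "stalk_map F \<phi>' \<chi> y ` M = (`) push ` M" using eq by (intro image_cong) auto
    moreover have "maximalideal ((`) push ` M) (stalk F y)"
      by (rule maximalideal_ring_iso_image[OF _ _ iso M]) (use lE lF in \<open>simp_all add: local_ring_def\<close>)
    ultimately have "stalk_map F \<phi>' \<chi> y ` M = N" using N lF unfolding local_ring_def by metis
    then show ?thesis by simp
  qed
  ultimately show "local_hom (stalk E (\<phi>' y)) (stalk F y) (stalk_map F \<phi>' \<chi> y)"
    using inv[OF x(1)] by (simp add: local_hom_def x(2))
qed

end

text \<open>The two morphisms are instances of \<open>morphism_inv\<close>, for the given
  isomorphism and for its inverse.\<close>

lemma sheaf_iso_imp_lrs_isomorphic:
  assumes E: "locally_ringed_space E" and iso: "sheaf_iso E F \<phi> \<chi>"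
  shows "lrs_isomorphic E F"
proof -
  have preE: "presheaf_of_algebras E"
    using E by (simp add: locally_ringed_space_def sheaf_of_algebras_def)
  interpret EF: sheaf_isomorphism E F \<phi> \<chi> by unfold_locales (fact preE iso)+
  define \<phi>' where "\<phi>' = inv_into (topspace (points E)) \<phi>"
  have inv: "\<phi>' (\<phi> x) = x" if "x \<in> topspace (points E)" for x
    using EF.phi_inj that by (simp add: \<phi>'_def)
  have inv': "\<phi> (\<phi>' y) = y" if "y \<in> topspace (points F)" for y
    using that unfolding \<phi>'_def EF.phi_surj[symmetric] by (rule f_inv_into_f)
  define \<psi> where "\<psi> U' = inv_into (carrier (sect E (\<phi>' ` U'))) (\<chi> (\<phi>' ` U'))" for U'
  have iso': "sheaf_iso F E \<phi>' \<psi>"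
    unfolding \<psi>_def by (rule EF.sheaf_iso_inv) (rule inv)
  interpret FE: sheaf_isomorphism F E \<phi>' \<psi>
    by unfold_locales (rule EF.presheaf_image, rule iso')
  have F: "locally_ringed_space F" by (rule EF.locally_ringed_image[OF E])
  have im: "\<phi>' ` \<phi> ` U = U" if "openin (points E) U" for U
    using inv openin_subset[OF that] by (force simp: image_iff)
  have im': "\<phi> ` \<phi>' ` U = U" if "openin (points F) U" for U
    using inv' openin_subset[OF that] by (force simp: image_iff)
  show ?thesis
    unfolding lrs_isomorphic_def
  proof (intro exI conjI ballI allI impI)
    show "lrs_morphism E F \<phi> \<psi>" by (rule FE.morphism_inv[OF F inv'])
    show "lrs_morphism F E \<phi>' \<chi>" by (rule EF.morphism_inv[OF E inv])
    show "\<phi>' (\<phi> x) = x" if "x \<in> topspace (points E)" for x by (rule inv[OF that])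
    show "\<phi> (\<phi>' y) = y" if "y \<in> topspace (points F)" for y by (rule inv'[OF that])
    show "\<psi> (preimage F \<phi>' W) (\<chi> W s) = s" if "openin (points E) W" "s \<in> carrier (sect E W)" for W s
      using that alg_isoD(6)[OF EF.chi_iso[OF that(1)]]
      by (simp add: EF.preimage_inv[OF inv that(1)] \<psi>_def im)
    show "\<chi> (preimage E \<phi> U) (\<psi> U t) = t" if U: "openin (points F) U" and t: "t \<in> carrier (sect F U)" for U t
    proof -
      have "openin (points E) (\<phi>' ` U)" by (rule FE.open_image[OF U])
      from alg_isoD(7)[OF EF.chi_iso[OF this]] have "t \<in> \<chi> (\<phi>' ` U) ` carrier (sect E (\<phi>' ` U))"
        using t by (simp add: im'[OF U])
      then show ?thesis by (simp add: FE.preimage_inv[OF inv' U] \<psi>_def f_inv_into_f)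
    qed
  qed
qed

text \<open>The maps \<open>\<psi>'\<close> that accompany the inverse \<open>\<phi>'\<close> serve
  as \<chi>, since the preimage of \<open>U\<close> under \<open>\<phi>'\<close> is the image of
  \<open>U\<close> under \<phi>.\<close>

lemma lrs_isomorphic_imp_sheaf_iso:
  assumes "lrs_isomorphic E F"
  shows "\<exists>\<phi> \<chi>. sheaf_iso E F \<phi> \<chi>"
proof -
  obtain \<phi> \<psi> \<phi>' \<psi>' where m: "lrs_morphism E F \<phi> \<psi>" "lrs_morphism F E \<phi>' \<psi>'"
    and inv: "\<forall>x\<in>topspace (points E). \<phi>' (\<phi> x) = x" "\<forall>y\<in>topspace (points F). \<phi> (\<phi>' y) = y"
    and s1: "\<forall>W. openin (points E) W \<longrightarrow> (\<forall>s\<in>carrier (sect E W). \<psi> (preimage F \<phi>' W) (\<psi>' W s) = s)"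
    and s2: "\<forall>U. openin (points F) U \<longrightarrow> (\<forall>t\<in>carrier (sect F U). \<psi>' (preimage E \<phi> U) (\<psi> U t) = t)"
    using assms unfolding lrs_isomorphic_def by (elim exE conjE) rule
  have preE: "presheaf_of_algebras E" and preF: "presheaf_of_algebras F"
    using m(1) by (simp_all add: lrs_morphism_def locally_ringed_space_def sheaf_of_algebras_def)
  have c: "continuous_map (points E) (points F) \<phi>" "continuous_map (points F) (points E) \<phi>'"
    using m by (simp_all add: lrs_morphism_def)
  have maps: "\<phi> x \<in> topspace (points F)" if "x \<in> topspace (points E)" for x
    using c(1) that by (auto simp: continuous_map_def)
  have im: "preimage F \<phi>' U = \<phi> ` U" if "openin (points E) U" for U
  proof (intro equalityI subsetI)
    fix y assume "y \<in> preimage F \<phi>' U"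
    then have "\<phi>' y \<in> U" "y = \<phi> (\<phi>' y)" using inv(2) by (auto simp: preimage_def)
    then show "y \<in> \<phi> ` U" by blast
  next
    fix y assume "y \<in> \<phi> ` U"
    then obtain x where x: "x \<in> U" "y = \<phi> x" by blast
    then have "x \<in> topspace (points E)" using openin_subset[OF that] by blast
    then show "y \<in> preimage F \<phi>' U" using x maps inv(1) by (simp add: preimage_def)
  qed
  have im': "preimage E \<phi> (\<phi> ` U) = U" if "openin (points E) U" for U
  proof -
    have "inj_on \<phi> (topspace (points E))" using inv(1) by (metis inj_onI)
    then show ?thesis
      using inj_on_image_mem_iff[of \<phi> "topspace (points E)" _ U] openin_subset[OF that]
      by (auto simp: preimage_def)
  qed
  have op: "openin (points F) (\<phi> ` U)" if "openin (points E) U" for U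
    using openin_continuous_map_preimage[OF c(2) that] im[OF that] by (simp add: preimage_def)
  have "homeomorphic_map (points E) (points F) \<phi>"
    using c inv by (auto simp: homeomorphic_map_maps homeomorphic_maps_def)
  moreover have "alg_iso (sect E U) (sect F (\<phi> ` U)) (\<psi>' U)" if U: "openin (points E) U" for U
  proof -
    have h: "\<psi>' U \<in> alg_hom (sect E U) (sect F (\<phi> ` U))"
      using m(2) U im[OF U] by (auto simp: lrs_morphism_def)
    have h': "\<psi> (\<phi> ` U) \<in> alg_hom (sect F (\<phi> ` U)) (sect E U)"
      using m(1) op[OF U] im'[OF U] by (auto simp: lrs_morphism_def)
    interpret EU: algebra base_field "sect E U" by (rule presheaf_of_algebrasD(1)[OF preE U])
    interpret FU: algebra base_field "sect F (\<phi> ` U)" by (rule presheaf_of_algebrasD(1)[OF preF op[OF U]])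
    have r: "\<psi>' U \<in> ring_hom (sect E U) (sect F (\<phi> ` U))" "\<psi> (\<phi> ` U) \<in> ring_hom (sect F (\<phi> ` U)) (sect E U)"
      using h h' by (auto simp: alg_hom_def)
    have "bij_betw (\<psi>' U) (carrier (sect E U)) (carrier (sect F (\<phi> ` U)))"
    proof (rule bij_betw_byWitness[where f' = "\<psi> (\<phi> ` U)"])
      show "\<forall>s\<in>carrier (sect E U). \<psi> (\<phi> ` U) (\<psi>' U s) = s" using s1 U im[OF U] by auto
      show "\<forall>t\<in>carrier (sect F (\<phi> ` U)). \<psi>' U (\<psi> (\<phi> ` U) t) = t" using s2 op[OF U] im'[OF U] by auto
    qed (use ring_hom_closed[OF r(1)] ring_hom_closed[OF r(2)] in auto)
    moreover have "\<psi>' U \<zero>\<^bsub>sect E U\<^esub> = \<zero>\<^bsub>sect F (\<phi> ` U)\<^esub>"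
      by (rule ring_hom_zero[OF r(1) EU.ring_axioms FU.ring_axioms])
    ultimately show ?thesis using h by (simp add: alg_iso_def)
  qed
  moreover have "\<psi>' W (res E U W s) = res F (\<phi> ` U) (\<phi> ` W) (\<psi>' U s)"
    if "openin (points E) U" "openin (points E) W" "W \<subseteq> U" "s \<in> carrier (sect E U)" for U W s
    using m(2) that im[OF that(1)] im[OF that(2)] unfolding lrs_morphism_def by auto
  ultimately have "sheaf_iso E F \<phi> \<psi>'" by (simp add: sheaf_iso_def)
  then show ?thesis by blast
qed

section \<open>The ring of global regular functions\<close>

text \<open>Members of a coset differ by polynomials vanishing on \<open>V\<close>, which makes the
  definite description meaningful at points of \<open>V\<close>.\<close>

lemma coset_eval_coordinate_ring:
  assumes "Q \<in> V"
  shows "coset_eval (vanishing_ideal n V +>\<^bsub>mpoly_ring n\<^esub> g) Q = poly_eval g Q"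
proof -
  let ?C = "vanishing_ideal n V +>\<^bsub>mpoly_ring n\<^esub> g"
  have C: "?C = {h + g |h. h \<in> vanishing_ideal n V}"
    unfolding a_r_coset_def' by (auto simp: mpoly_ring_def)
  have "0 \<in> vanishing_ideal n V" by (simp add: vanishing_ideal_def mpoly_ring_def poly_eval_simps)
  then have "g \<in> ?C" unfolding C by force
  moreover have "poly_eval f Q = poly_eval g Q" if f: "f \<in> ?C" for f
  proof -
    obtain h where "f = h + g" "h \<in> vanishing_ideal n V" using f unfolding C by blast
    then show ?thesis using assms by (simp add: vanishing_ideal_def poly_eval_add)
  qed
  ultimately show ?thesis unfolding coset_eval_def by (intro the_equality) metis+
qed

lemma carrier_coordinate_ring:
  "carrier (coordinate_ring n V) = (\<lambda>g. vanishing_ideal n V +>\<^bsub>mpoly_ring n\<^esub> g) ` carrier (mpoly_ring n)"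
  unfolding coordinate_ring_def FactRing_def by (auto simp: A_RCOSETS_def')

lemma regular_functions_iff:
  assumes V: "V \<subseteq> affine_space n"
  shows "f \<in> regular_functions n V U \<longleftrightarrow> f \<in> U \<rightarrow>\<^sub>E UNIV \<and>
    (\<forall>P\<in>U. \<exists>N. openin (zariski_topology n V) N \<and> P \<in> N \<and> N \<subseteq> U \<and>
      (\<exists>g\<in>carrier (mpoly_ring n). \<exists>l\<in>carrier (mpoly_ring n).
        \<forall>Q\<in>N. poly_eval l Q \<noteq> 0 \<and> f Q = poly_eval g Q / poly_eval l Q))"
proof -
  have "(\<exists>g\<in>carrier (coordinate_ring n V). \<exists>l\<in>carrier (coordinate_ring n V).
          \<forall>Q\<in>N. coset_eval l Q \<noteq> 0 \<and> f Q = coset_eval g Q / coset_eval l Q) \<longleftrightarrow>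
      (\<exists>g\<in>carrier (mpoly_ring n). \<exists>l\<in>carrier (mpoly_ring n).
        \<forall>Q\<in>N. poly_eval l Q \<noteq> 0 \<and> f Q = poly_eval g Q / poly_eval l Q)"
    if "openin (zariski_topology n V) N" for N
  proof -
    have "N \<subseteq> V" using that by (simp add: openin_zariski[OF V])
    then have "coset_eval (vanishing_ideal n V +>\<^bsub>mpoly_ring n\<^esub> g) Q = poly_eval g Q" if "Q \<in> N" for g Q
      using that by (intro coset_eval_coordinate_ring) blast
    then show ?thesis by (simp add: carrier_coordinate_ring)
  qed
  then show ?thesis unfolding regular_functions_def by (simp cong: conj_cong)
qed

text \<open>\<open>A\<close> is any algebra identified by \<tau> with the ring of regular functions
  on \<open>W\<close>, not that ring itself: the algebra in the final statement has the sections of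
  the abstract equivariety as elements.\<close>

locale global_functions =
  fixes n :: nat and W :: "(nat \<Rightarrow> 'k::field) set" and A :: "('k, 'a) module" and \<tau> :: "'a \<Rightarrow> (nat \<Rightarrow> 'k) \<Rightarrow> 'k"
  assumes V: "affine_algebraic_subvariety n W"
    and A: "k_algebra A"
    and \<tau>: "alg_iso A (sect (subvariety_space n W) W) \<tau>"
begin

sublocale A: algebra base_field A by (rule A)

abbreviation R where "R \<equiv> carrier (mpoly_ring n) :: 'k poly_n set"
abbreviation Z where "Z \<equiv> zariski_topology n W"

lemma W_affine: "W \<subseteq> affine_space n"
  using V by (auto simp: affine_algebraic_subvariety_def zero_set_def)

lemma open_iff: "openin Z U \<longleftrightarrow> U \<subseteq> W \<and> (\<exists>S. S \<subseteq> R \<and> W - U = W \<inter> zero_set n S)"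
  by (rule openin_zariski[OF W_affine])

lemma in_zero_set: "P \<in> W \<Longrightarrow> P \<in> zero_set n S \<longleftrightarrow> (\<forall>f\<in>S. poly_eval f P = 0)"
  using W_affine by (auto simp: zero_set_def)

lemma open_W: "openin Z W"
  unfolding open_iff using mpoly_ring_one
  by (intro conjI exI[of _ "{1}"]) (auto simp: in_zero_set poly_eval_simps)

lemma topspace_Z: "topspace Z = W"
  using open_W openin_subset[OF open_W] open_iff openin_topspace by blast

lemma open_subset: "openin Z U \<Longrightarrow> U \<subseteq> W"
  by (simp add: open_iff)

lemma open_poly: "h \<in> R \<Longrightarrow> openin Z {P \<in> W. poly_eval h P \<noteq> 0}"
  unfolding open_iff by (intro conjI exI[of _ "{h}"]) (auto simp: in_zero_set)

text \<open>Multiplication by such a polynomial turns an identity between functions that holds on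
  \<open>N\<close> into one that holds on all of \<open>W\<close>.\<close>

lemma poly_vanishing_outside_open:
  assumes "openin Z N" "P \<in> N"
  shows "\<exists>s\<in>R. poly_eval s P \<noteq> 0 \<and> (\<forall>Q\<in>W - N. poly_eval s Q = 0)"
proof -
  obtain S where S: "N \<subseteq> W" "S \<subseteq> R" "W - N = W \<inter> zero_set n S" using assms open_iff by auto
  have "P \<notin> zero_set n S" using S assms by blast
  then obtain s where "s \<in> S" "poly_eval s P \<noteq> 0" using in_zero_set assms S by blast
  moreover have "poly_eval s Q = 0" if "Q \<in> W - N" for Q
    using S(3) that \<open>s \<in> S\<close> in_zero_set[of Q S] by blast
  ultimately show ?thesis using S by blast
qed

lemma sect_simps:
  "carrier (sect (subvariety_space n W) U) = regular_functions n W U"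
  "f \<otimes>\<^bsub>sect (subvariety_space n W) U\<^esub> g = (\<lambda>P\<in>U. f P * g P)"
  "f \<oplus>\<^bsub>sect (subvariety_space n W) U\<^esub> g = (\<lambda>P\<in>U. f P + g P)"
  "\<one>\<^bsub>sect (subvariety_space n W) U\<^esub> = (\<lambda>P\<in>U. 1)"
  "\<zero>\<^bsub>sect (subvariety_space n W) U\<^esub> = (\<lambda>P\<in>U. 0)"
  "c \<odot>\<^bsub>sect (subvariety_space n W) U\<^esub> f = (\<lambda>P\<in>U. c * f P)"
  by (simp_all add: subvariety_space_def pointwise_algebra_def base_field_def)

lemma \<tau>_simps:
  assumes "P \<in> W"
  shows "a \<in> carrier A \<Longrightarrow> b \<in> carrier A \<Longrightarrow> \<tau> (a \<otimes>\<^bsub>A\<^esub> b) P = \<tau> a P * \<tau> b P"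
    "a \<in> carrier A \<Longrightarrow> b \<in> carrier A \<Longrightarrow> \<tau> (a \<oplus>\<^bsub>A\<^esub> b) P = \<tau> a P + \<tau> b P"
    "\<tau> \<one>\<^bsub>A\<^esub> P = 1" "\<tau> \<zero>\<^bsub>A\<^esub> P = 0"
    "a \<in> carrier A \<Longrightarrow> \<tau> (c \<odot>\<^bsub>A\<^esub> a) P = c * \<tau> a P"
  using alg_isoD[OF \<tau>] assms by (simp_all add: sect_simps)

lemma \<tau>_minus:
  assumes "P \<in> W" "a \<in> carrier A" "b \<in> carrier A"
  shows "\<tau> (a \<ominus>\<^bsub>A\<^esub> b) P = \<tau> a P - \<tau> b P"
proof -
  have "\<tau> ((a \<ominus>\<^bsub>A\<^esub> b) \<oplus>\<^bsub>A\<^esub> b) P = \<tau> (a \<ominus>\<^bsub>A\<^esub> b) P + \<tau> b P"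
    using assms by (intro \<tau>_simps) auto
  moreover have "(a \<ominus>\<^bsub>A\<^esub> b) \<oplus>\<^bsub>A\<^esub> b = a"
    using assms by (simp add: A.minus_eq A.a_assoc A.l_neg)
  ultimately show ?thesis by simp
qed

lemma smult_closed: "a \<in> carrier A \<Longrightarrow> c \<odot>\<^bsub>A\<^esub> a \<in> carrier A"
  by (rule A.smult_closed) (simp_all add: base_field_def)

lemma \<tau>_regular: "a \<in> carrier A \<Longrightarrow> \<tau> a \<in> regular_functions n W W"
  using alg_isoD(8)[OF \<tau>] by (simp add: sect_simps)

lemma \<tau>_eqI:
  assumes "a \<in> carrier A" "b \<in> carrier A" "\<And>P. P \<in> W \<Longrightarrow> \<tau> a P = \<tau> b P"
  shows "a = b"
proof -
  have "\<tau> a = \<tau> b"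
    using \<tau>_regular[OF assms(1)] \<tau>_regular[OF assms(2)] assms(3)
    by (auto simp: regular_functions_def intro: PiE_ext)
  then show ?thesis using alg_isoD(6)[OF \<tau>] assms by (auto dest: inj_onD)
qed

lemma \<tau>_surj:
  assumes "f \<in> regular_functions n W W"
  shows "\<exists>a\<in>carrier A. \<forall>P\<in>W. \<tau> a P = f P"
proof -
  have "f \<in> \<tau> ` carrier A" using alg_isoD(7)[OF \<tau>] assms by (simp add: sect_simps)
  then show ?thesis by blast
qed

lemma \<tau>_local:
  assumes "a \<in> carrier A" "P \<in> W"
  shows "\<exists>N. openin Z N \<and> P \<in> N \<and> (\<exists>g\<in>R. \<exists>l\<in>R.
    \<forall>Q\<in>N. poly_eval l Q \<noteq> 0 \<and> \<tau> a Q = poly_eval g Q / poly_eval l Q)"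
  using \<tau>_regular[OF assms(1)] assms(2) unfolding regular_functions_iff[OF W_affine] by blast

lemma ex_of_poly: "f \<in> R \<Longrightarrow> \<exists>a\<in>carrier A. \<forall>P\<in>W. \<tau> a P = poly_eval f P"
proof -
  assume f: "f \<in> R"
  have "(\<lambda>P\<in>W. poly_eval f P) \<in> regular_functions n W W"
    unfolding regular_functions_iff[OF W_affine]
  proof (intro conjI ballI)
    fix P assume "P \<in> W"
    moreover have "\<forall>Q\<in>W. poly_eval (1 :: 'k poly_n) Q \<noteq> 0 \<and>
        (\<lambda>P\<in>W. poly_eval f P) Q = poly_eval f Q / poly_eval 1 Q"
      by (simp add: poly_eval_simps)
    ultimately show "\<exists>N. openin Z N \<and> P \<in> N \<and> N \<subseteq> W \<and> (\<exists>g\<in>R. \<exists>l\<in>R. \<forall>Q\<in>N. poly_eval l Q \<noteq> 0 \<and>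
        (\<lambda>P\<in>W. poly_eval f P) Q = poly_eval g Q / poly_eval l Q)"
      using open_W f mpoly_ring_one by blast
  qed auto
  then show ?thesis using \<tau>_surj by fastforce
qed

text \<open>Restriction of polynomials to \<open>W\<close>. The choice is unique on
  \<open>R\<close>, because elements of \<open>A\<close> are determined by their values
  (\<open>\<tau>_eqI\<close>).\<close>

definition of_poly :: "'k poly_n \<Rightarrow> 'a" where
  "of_poly f = (SOME a. a \<in> carrier A \<and> (\<forall>P\<in>W. \<tau> a P = poly_eval f P))"

lemma of_poly: "f \<in> R \<Longrightarrow> of_poly f \<in> carrier A" "f \<in> R \<Longrightarrow> P \<in> W \<Longrightarrow> \<tau> (of_poly f) P = poly_eval f P"
  using someI_ex[of "\<lambda>a. a \<in> carrier A \<and> (\<forall>P\<in>W. \<tau> a P = poly_eval f P)"] ex_of_poly[of f]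
  unfolding of_poly_def by blast+

text \<open>On a neighbourhood \<open>N\<close> of \<open>P\<close> the element \<open>a\<close> is
  a quotient g/l. With a polynomial s that vanishes outside \<open>N\<close> and not at
  \<open>P\<close>, the equation s g = (s l) a holds on all of \<open>W\<close>.\<close>

lemma clear_denominator:
  assumes a: "a \<in> carrier A" "P \<in> W" "\<tau> a P \<noteq> 0"
  shows "\<exists>h\<in>R. \<exists>b\<in>carrier A. poly_eval h P \<noteq> 0 \<and> (\<forall>Q\<in>W. poly_eval h Q = \<tau> b Q * \<tau> a Q)"
proof -
  obtain N g l where N: "openin Z N" "P \<in> N" "g \<in> R" "l \<in> R"
    "\<And>Q. Q \<in> N \<Longrightarrow> poly_eval l Q \<noteq> 0 \<and> \<tau> a Q = poly_eval g Q / poly_eval l Q"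
    using \<tau>_local[OF a(1,2)] by blast
  obtain s where s: "s \<in> R" "poly_eval s P \<noteq> 0" "\<And>Q. Q \<in> W - N \<Longrightarrow> poly_eval s Q = 0"
    using poly_vanishing_outside_open[OF N(1,2)] by blast
  have sg: "s * g \<in> R" "s * l \<in> R" using s N by (auto intro: mpoly_ring_mult_closed)
  show ?thesis
  proof (intro bexI[of _ "s * g"] bexI[of _ "of_poly (s * l)"] conjI ballI)
    have "poly_eval g P \<noteq> 0" using a(3) N(5)[OF N(2)] by auto
    then show "poly_eval (s * g) P \<noteq> 0" using s by (simp add: poly_eval_mult)
    fix Q assume Q: "Q \<in> W"
    show "poly_eval (s * g) Q = \<tau> (of_poly (s * l)) Q * \<tau> a Q"
      using s(3)[of Q] N(5)[of Q] Q by (cases "Q \<in> N") (simp_all add: of_poly(2)[OF sg(2) Q] poly_eval_mult)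
  qed (use sg of_poly in auto)
qed

text \<open>Around each of its points the set contains the nonvanishing set of a polynomial multiple
  of \<open>a\<close>, obtained by clearing denominators.\<close>

lemma open_nonzero: "a \<in> carrier A \<Longrightarrow> openin Z {P \<in> W. \<tau> a P \<noteq> 0}"
proof (subst openin_subopen, intro ballI)
  fix P assume a: "a \<in> carrier A" "P \<in> {P \<in> W. \<tau> a P \<noteq> 0}"
  then obtain h b where h: "h \<in> R" "b \<in> carrier A" "poly_eval h P \<noteq> 0" "\<forall>Q\<in>W. poly_eval h Q = \<tau> b Q * \<tau> a Q"
    using clear_denominator[of a P] by auto
  show "\<exists>T. openin Z T \<and> P \<in> T \<and> T \<subseteq> {P \<in> W. \<tau> a P \<noteq> 0}"
    by (intro exI[of _ "{P \<in> W. poly_eval h P \<noteq> 0}"] conjI open_poly h(1)) (use h a in auto)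
qed

text \<open>Where \<open>a\<close> is g/l, the numerator g has no zeros either, so l/g represents
  the inverse; regularity is a local condition.\<close>

lemma nonvanishing_unit:
  assumes a: "a \<in> carrier A" "\<And>P. P \<in> W \<Longrightarrow> \<tau> a P \<noteq> 0"
  shows "\<exists>b\<in>carrier A. b \<otimes>\<^bsub>A\<^esub> a = \<one>\<^bsub>A\<^esub>"
proof -
  have "(\<lambda>P\<in>W. 1 / \<tau> a P) \<in> regular_functions n W W"
    unfolding regular_functions_iff[OF W_affine]
  proof (intro conjI ballI)
    fix P assume P: "P \<in> W"
    obtain N g l where N: "openin Z N" "P \<in> N" "g \<in> R" "l \<in> R"
      "\<And>Q. Q \<in> N \<Longrightarrow> poly_eval l Q \<noteq> 0 \<and> \<tau> a Q = poly_eval g Q / poly_eval l Q"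
      using \<tau>_local[OF a(1) P] by blast
    have "poly_eval g Q \<noteq> 0 \<and> (\<lambda>P\<in>W. 1 / \<tau> a P) Q = poly_eval l Q / poly_eval g Q" if "Q \<in> N" for Q
      using N(5)[OF that] a(2)[of Q] that open_subset[OF N(1)] by auto
    then show "\<exists>N. openin Z N \<and> P \<in> N \<and> N \<subseteq> W \<and> (\<exists>g\<in>R. \<exists>l\<in>R. \<forall>Q\<in>N. poly_eval l Q \<noteq> 0 \<and>
        (\<lambda>P\<in>W. 1 / \<tau> a P) Q = poly_eval g Q / poly_eval l Q)"
      using N(1-4) open_subset[OF N(1)] by blast
  qed auto
  then obtain b where b: "b \<in> carrier A" "\<forall>P\<in>W. \<tau> b P = (\<lambda>P\<in>W. 1 / \<tau> a P) P"
    using \<tau>_surj by blast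
  have "b \<otimes>\<^bsub>A\<^esub> a = \<one>\<^bsub>A\<^esub>"
    by (rule \<tau>_eqI) (use a b in \<open>auto simp: \<tau>_simps\<close>)
  then show ?thesis using b(1) by blast
qed

section \<open>Maximal ideals of points\<close>

definition point_ideal :: "(nat \<Rightarrow> 'k) \<Rightarrow> 'a set" where
  "point_ideal P = {a \<in> carrier A. \<tau> a P = 0}"

lemma ideal_point_ideal:
  assumes P: "P \<in> W"
  shows "ideal (point_ideal P) A"
proof (rule idealI[OF A.ring_axioms])
  have inv: "\<tau> (\<ominus>\<^bsub>A\<^esub> a) P = - \<tau> a P" if "a \<in> carrier A" for a
    using \<tau>_minus[OF P A.zero_closed that] that by (simp add: A.minus_eq \<tau>_simps[OF P])
  show "subgroup (point_ideal P) (add_monoid A)"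
    by (rule A.add.subgroupI)
      (auto simp: point_ideal_def \<tau>_simps[OF P] inv a_inv_def[symmetric] intro: exI[of _ "\<zero>\<^bsub>A\<^esub>"])
qed (auto simp: point_ideal_def \<tau>_simps[OF P])

text \<open>The residue field is k: an element outside the ideal can be scaled to take the value one
  at \<open>P\<close>, and its difference from one then lies in the ideal.\<close>

lemma maximalideal_point_ideal:
  assumes P: "P \<in> W"
  shows "maximalideal (point_ideal P) A"
proof (rule maximalidealI[OF ideal_point_ideal[OF P]])
  have "\<one>\<^bsub>A\<^esub> \<notin> point_ideal P" by (simp add: point_ideal_def \<tau>_simps[OF P])
  then show "carrier A \<noteq> point_ideal P" using A.one_closed by blast
  fix J assume J: "ideal J A" "point_ideal P \<subseteq> J" "J \<subseteq> carrier A"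
  interpret J: ideal J A by fact
  show "J = point_ideal P \<or> J = carrier A"
  proof (rule disjCI)
    assume "J \<noteq> carrier A"
    show "J = point_ideal P"
    proof (rule ccontr)
      assume "J \<noteq> point_ideal P"
      then obtain a where a: "a \<in> J" "a \<notin> point_ideal P" using J by blast
      then have aA: "a \<in> carrier A" and "\<tau> a P \<noteq> 0" using J by (auto simp: point_ideal_def)
      define b where "b = (1 / \<tau> a P) \<odot>\<^bsub>A\<^esub> \<one>\<^bsub>A\<^esub>"
      have b: "b \<in> carrier A" by (simp add: b_def smult_closed)
      have "\<one>\<^bsub>A\<^esub> \<ominus>\<^bsub>A\<^esub> b \<otimes>\<^bsub>A\<^esub> a \<in> point_ideal P"
        using aA b \<open>\<tau> a P \<noteq> 0\<close> by (simp add: point_ideal_def \<tau>_minus[OF P] \<tau>_simps[OF P]) (simp add: b_def \<tau>_simps[OF P])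
      then have "(\<one>\<^bsub>A\<^esub> \<ominus>\<^bsub>A\<^esub> b \<otimes>\<^bsub>A\<^esub> a) \<oplus>\<^bsub>A\<^esub> b \<otimes>\<^bsub>A\<^esub> a \<in> J"
        using J(2) a b J.I_l_closed by (intro J.a_closed) auto
      moreover have "(\<one>\<^bsub>A\<^esub> \<ominus>\<^bsub>A\<^esub> b \<otimes>\<^bsub>A\<^esub> a) \<oplus>\<^bsub>A\<^esub> b \<otimes>\<^bsub>A\<^esub> a = \<one>\<^bsub>A\<^esub>"
        using aA b by (simp add: A.minus_eq A.a_assoc A.l_neg)
      ultimately show False using J.one_imp_carrier \<open>J \<noteq> carrier A\<close> by simp
    qed
  qed
qed

lemma primeideal_point_ideal: "P \<in> W \<Longrightarrow> primeideal (point_ideal P) A"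
  by (rule A.maximalideal_prime[OF maximalideal_point_ideal])

text \<open>The polynomials whose restriction to \<open>W\<close> lies in an ideal \<open>J\<close> of \<open>A\<close> form an ideal. If \<open>J\<close> has no
  common zero on \<open>W\<close>, neither has this ideal, by clearing denominators; so it contains a nowhere
  vanishing polynomial, which is a unit of \<open>A\<close>.\<close>

lemma proper_ideal_has_point:
  assumes J: "ideal J A" "J \<noteq> carrier A"
  shows "\<exists>P\<in>W. J \<subseteq> point_ideal P"
proof (rule ccontr)
  interpret J: ideal J A by fact
  have JA: "J \<subseteq> carrier A" by (rule J.a_subset)
  assume "\<not> ?thesis"
  then have nz: "\<exists>a\<in>J. \<tau> a P \<noteq> 0" if "P \<in> W" for P
    using that JA by (auto simp: point_ideal_def)
  define K where "K = {f \<in> R. of_poly f \<in> J}"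
  have K: "poly_ideal n K"
    unfolding poly_ideal_def
  proof (intro conjI ballI)
    have 0: "0 \<in> R" by (simp add: mpoly_ring_def)
    have "of_poly 0 = \<zero>\<^bsub>A\<^esub>" by (rule \<tau>_eqI) (auto simp: of_poly 0 \<tau>_simps poly_eval_simps)
    then show "0 \<in> K" using 0 by (simp add: K_def)
    fix f assume f: "f \<in> K"
    show "f + g \<in> K" if g: "g \<in> K" for g
    proof -
      have R: "f \<in> R" "g \<in> R" "f + g \<in> R" using f g mpoly_ring_add_closed by (auto simp: K_def)
      have "of_poly (f + g) = of_poly f \<oplus>\<^bsub>A\<^esub> of_poly g"
        by (rule \<tau>_eqI) (use R in \<open>auto simp: of_poly \<tau>_simps poly_eval_add\<close>)
      then show ?thesis using f g R by (simp add: K_def)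
    qed
    show "g * f \<in> K" if g: "g \<in> R" for g
    proof -
      have R: "f \<in> R" "g \<in> R" "g * f \<in> R" using f g mpoly_ring_mult_closed by (auto simp: K_def)
      have "of_poly (g * f) = of_poly g \<otimes>\<^bsub>A\<^esub> of_poly f"
        by (rule \<tau>_eqI) (use R in \<open>auto simp: of_poly \<tau>_simps poly_eval_mult\<close>)
      then show ?thesis using f g R J.I_l_closed by (simp add: K_def of_poly)
    qed
  qed (simp add: K_def)
  \<comment> \<open>At points of \<open>W\<close> a suitable polynomial multiple of an element of
    \<open>J\<close> is nonzero. Outside \<open>W\<close> some polynomial of the defining ideal is
    nonzero, and it belongs to \<open>K\<close> because it restricts to zero.\<close>
  have "\<exists>f\<in>K. poly_eval f P \<noteq> 0" if P: "P \<in> affine_space n" for P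
  proof (cases "P \<in> W")
    case True
    obtain a where a: "a \<in> J" "\<tau> a P \<noteq> 0" using nz[OF True] by blast
    obtain h b where h: "h \<in> R" "b \<in> carrier A" "poly_eval h P \<noteq> 0" "\<forall>Q\<in>W. poly_eval h Q = \<tau> b Q * \<tau> a Q"
      using clear_denominator[OF _ True a(2)] a(1) JA by blast
    have "of_poly h = b \<otimes>\<^bsub>A\<^esub> a"
      by (rule \<tau>_eqI) (use h a JA in \<open>auto simp: of_poly \<tau>_simps\<close>)
    then have "of_poly h \<in> J" using J.I_l_closed a(1) h(2) by simp
    then show ?thesis using h by (auto simp: K_def)
  next
    case False
    obtain I where I: "ideal I (mpoly_ring n)" "W = zero_set n I"
      using V by (auto simp: affine_algebraic_subvariety_def)
    have IR: "I \<subseteq> R" using I(1) by (simp add: additive_subgroup.a_subset ideal.axioms(1))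
    have "P \<notin> zero_set n I" using False I(2) by simp
    then obtain f where f: "f \<in> I" "poly_eval f P \<noteq> 0" using P by (auto simp: zero_set_def)
    have fR: "f \<in> R" using f IR by blast
    have "poly_eval f Q = 0" if "Q \<in> W" for Q using that f(1) unfolding I(2) by (simp add: zero_set_def)
    then have "of_poly f = \<zero>\<^bsub>A\<^esub>" by (intro \<tau>_eqI) (auto simp: of_poly fR \<tau>_simps)
    then show ?thesis using f fR by (auto simp: K_def)
  qed
  then obtain f where f: "f \<in> K" "\<And>P. poly_eval f P \<noteq> 0" using nowhere_vanishing_element[OF K] by blast
  have "f \<in> R" using f by (simp add: K_def)
  then obtain b where "b \<in> carrier A" "b \<otimes>\<^bsub>A\<^esub> of_poly f = \<one>\<^bsub>A\<^esub>"
    using nonvanishing_unit[of "of_poly f"] f(2) by (auto simp: of_poly)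
  moreover have "of_poly f \<in> J" using f by (simp add: K_def)
  ultimately have "\<one>\<^bsub>A\<^esub> \<in> J" using J.I_l_closed by metis
  then show False using J.one_imp_carrier J(2) by simp
qed

section \<open>The closed points of the spectrum\<close>

lemma open_spec: "openin (spec_topology A) U \<longleftrightarrow> U \<subseteq> {p. primeideal p A} \<and>
     (\<exists>S. S \<subseteq> carrier A \<and> {p. primeideal p A} - U = {p. primeideal p A \<and> S \<subseteq> p})"
  by (rule openin_spec[OF A])

lemma topspace_spec: "topspace (spec_topology A) = {p. primeideal p A}"
proof -
  have "S \<subseteq> p \<Longrightarrow> S = {\<one>\<^bsub>A\<^esub>} \<Longrightarrow> \<not> primeideal p A" for S p
    using A.ring_axioms by (auto simp: primeideal_def primeideal_axioms_def dest: ideal.one_imp_carrier)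
  then have "openin (spec_topology A) {p. primeideal p A}"
    unfolding open_spec by (intro conjI exI[of _ "{\<one>\<^bsub>A\<^esub>}"]) auto
  then show ?thesis unfolding topspace_def using open_spec by blast
qed

lemma points_Spec: "points (Spec A) = spec_topology A"
  using subtopology_topspace[of "spec_topology A"] by (simp add: Spec_def spec_restriction_def topspace_spec)

text \<open>If {p} is the set of primes containing \<open>S\<close>, a point ideal that contains
  \<open>p\<close> contains \<open>S\<close> as well and so equals \<open>p\<close>. Conversely a
  point ideal is maximal, and no other prime contains it.\<close>

lemma closed_points_Spec: "closed_points (Spec A) = point_ideal ` W"
proof (intro equalityI subsetI)
  fix p assume "p \<in> closed_points (Spec A)"
  then have p: "primeideal p A" "closedin (spec_topology A) {p}"
    by (auto simp: closed_points_def points_Spec topspace_spec)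
  then have "openin (spec_topology A) ({p. primeideal p A} - {p})"
    by (simp add: closedin_def topspace_spec)
  then obtain S where eq: "{p. primeideal p A} - ({p. primeideal p A} - {p}) = {p. primeideal p A \<and> S \<subseteq> p}"
    unfolding open_spec by (elim conjE exE) rule
  have "{p. primeideal p A} - ({p. primeideal p A} - {p}) = {p}" using p(1) by auto
  then have eq: "{p. primeideal p A \<and> S \<subseteq> p} = {p}" using eq by simp
  have S: "primeideal q A \<Longrightarrow> S \<subseteq> q \<Longrightarrow> q = p" "S \<subseteq> p" for q
    using equalityD1[OF eq] equalityD2[OF eq] by auto
  have "ideal p A" "p \<noteq> carrier A" using p(1) by (auto simp: primeideal_def primeideal_axioms_def)
  then obtain P where P: "P \<in> W" "p \<subseteq> point_ideal P" using proper_ideal_has_point by blast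
  then have "point_ideal P = p" using S primeideal_point_ideal by blast
  then show "p \<in> point_ideal ` W" using P(1) by blast
next
  fix p assume "p \<in> point_ideal ` W"
  then obtain P where P: "P \<in> W" "p = point_ideal P" by blast
  have "q = p" if "primeideal q A" "p \<subseteq> q" for q
  proof -
    interpret q: primeideal q A by (rule that(1))
    interpret p: maximalideal p A unfolding P(2) by (rule maximalideal_point_ideal[OF P(1)])
    show ?thesis using p.I_maximal[OF q.is_ideal that(2) q.a_subset] q.I_notcarr by simp
  qed
  moreover have "primeideal p A" using P primeideal_point_ideal by simp
  ultimately have "{p. primeideal p A} - ({p. primeideal p A} - {p}) = {q. primeideal q A \<and> p \<subseteq> q}" by blast
  moreover have "p \<subseteq> carrier A" using P by (auto simp: point_ideal_def)
  ultimately have "openin (spec_topology A) ({p. primeideal p A} - {p})" unfolding open_spec by blast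
  then show "p \<in> closed_points (Spec A)"
    using \<open>primeideal p A\<close> by (simp add: closed_points_def points_Spec topspace_spec closedin_def)
qed

lemma closed_points_dense: "points (Spec A) closure_of closed_points (Spec A) = topspace (points (Spec A))"
proof -
  have "point_ideal ` W \<inter> U \<noteq> {}" if U: "openin (spec_topology A) U" "U \<noteq> {}" for U
  proof -
    obtain p where p: "p \<in> U" using U by blast
    obtain S where S: "U \<subseteq> {p. primeideal p A}" "S \<subseteq> carrier A"
      "{p. primeideal p A} - U = {p. primeideal p A \<and> S \<subseteq> p}" using U open_spec by auto
    have "primeideal p A" using p S(1) by blast
    then interpret p: primeideal p A .
    obtain s where s: "s \<in> S" "s \<notin> p" using p S by blast
    have "\<exists>P\<in>W. \<tau> s P \<noteq> 0"
    proof (rule ccontr)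
      assume "\<not> ?thesis"
      then have "s = \<zero>\<^bsub>A\<^esub>" using s S(2) by (intro \<tau>_eqI) (auto simp: \<tau>_simps)
      then show False using s(2) by simp
    qed
    then obtain P where P: "P \<in> W" "\<tau> s P \<noteq> 0" by blast
    have "\<not> S \<subseteq> point_ideal P" using s P by (auto simp: point_ideal_def)
    then have "point_ideal P \<in> U" using S(3) primeideal_point_ideal[OF P(1)] by blast
    then show ?thesis using P(1) by blast
  qed
  then show ?thesis
    unfolding points_Spec closed_points_Spec dense_intersects_open by auto
qed

text \<open>Points that differ in the coordinate \<open>i\<close> are separated by the polynomial
  \<open>var i\<close> minus the constant \<open>P i\<close>.\<close>

lemma inj_point_ideal: "inj_on point_ideal W"
proof (rule inj_onI, rule ccontr)
  fix P Q assume *: "P \<in> W" "Q \<in> W" "point_ideal P = point_ideal Q" "P \<noteq> Q"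
  then have PQ: "P \<in> {..<n} \<rightarrow>\<^sub>E UNIV" "Q \<in> {..<n} \<rightarrow>\<^sub>E UNIV"
    using W_affine by (auto simp: affine_space_def)
  have "\<exists>i<n. P i \<noteq> Q i"
  proof (rule ccontr)
    assume "\<not> ?thesis"
    then have "P = Q" by (intro PiE_ext[OF PQ]) auto
    then show False using *(4) by simp
  qed
  then obtain i where i: "i < n" "P i \<noteq> Q i" by blast
  define f where "f = var i - Poly_Mapping.single 0 (P i)"
  have f: "f \<in> R"
    using mpoly_ring_add_closed[OF var_in_mpoly_ring[OF i(1)] mpoly_ring_uminus[OF mpoly_ring_const[of "P i" n]]]
    by (simp add: f_def)
  have "poly_eval f P = 0" "poly_eval f Q \<noteq> 0"
    using i by (auto simp: f_def poly_eval_simps poly_eval_var)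
  then have "of_poly f \<in> point_ideal P" "of_poly f \<notin> point_ideal Q"
    using *(1,2) f by (simp_all add: point_ideal_def of_poly)
  then show False using *(3) by simp
qed

abbreviation Z0 where "Z0 \<equiv> subtopology (spec_topology A) (point_ideal ` W)"

text \<open>Zeros of a set of polynomials correspond to point ideals containing their restrictions.
  In the other direction a closed set is given by elements of \<open>A\<close>, which need not come
  from polynomials; their nonvanishing sets are open by \<open>open_nonzero\<close>.\<close>

lemma point_ideal_homeo: "homeomorphic_map Z Z0 point_ideal"
  unfolding homeomorphic_map_def quotient_map_def topspace_Z
proof (intro conjI allI impI inj_point_ideal)
  show top: "point_ideal ` W = topspace Z0"
    using primeideal_point_ideal by (auto simp: topspace_spec)
  fix U assume U: "U \<subseteq> topspace Z0"
  show "openin Z {P \<in> W. point_ideal P \<in> U} \<longleftrightarrow> openin Z0 U"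
  proof
    assume "openin Z {P \<in> W. point_ideal P \<in> U}"
    then obtain S where S: "S \<subseteq> R" "W - {P \<in> W. point_ideal P \<in> U} = W \<inter> zero_set n S"
      unfolding open_iff by blast
    define T where "T = {p. primeideal p A \<and> \<not> of_poly ` S \<subseteq> p}"
    have "{p. primeideal p A} - T = {p. primeideal p A \<and> of_poly ` S \<subseteq> p}" by (auto simp: T_def)
    moreover have "of_poly ` S \<subseteq> carrier A" using S(1) of_poly by blast
    moreover have "T \<subseteq> {p. primeideal p A}" by (auto simp: T_def)
    ultimately have "openin (spec_topology A) T" unfolding open_spec by blast
    moreover have "point_ideal P \<in> U \<longleftrightarrow> point_ideal P \<in> T" if P: "P \<in> W" for P
    proof -
      have "point_ideal P \<in> U \<longleftrightarrow> P \<notin> zero_set n S" using S(2) P by blast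
      also have "\<dots> \<longleftrightarrow> (\<exists>f\<in>S. poly_eval f P \<noteq> 0)" using in_zero_set[OF P] by blast
      also have "\<dots> \<longleftrightarrow> \<not> of_poly ` S \<subseteq> point_ideal P"
        using S(1) P by (auto simp: point_ideal_def of_poly subset_iff)
      finally show ?thesis using primeideal_point_ideal[OF P] by (simp add: T_def)
    qed
    then have "U = T \<inter> point_ideal ` W" using U unfolding top[symmetric] by blast
    ultimately show "openin Z0 U" unfolding openin_subtopology by blast
  next
    assume "openin Z0 U"
    then obtain T where T: "openin (spec_topology A) T" "U = T \<inter> point_ideal ` W"
      unfolding openin_subtopology by blast
    obtain S where S: "S \<subseteq> carrier A" "{p. primeideal p A} - T = {p. primeideal p A \<and> S \<subseteq> p}"
      using T(1) unfolding open_spec by blast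
    have "point_ideal P \<in> U \<longleftrightarrow> (\<exists>a\<in>S. \<tau> a P \<noteq> 0)" if P: "P \<in> W" for P
    proof -
      have "point_ideal P \<in> U \<longleftrightarrow> point_ideal P \<in> T" using T(2) P by blast
      also have "\<dots> \<longleftrightarrow> \<not> S \<subseteq> point_ideal P" using S(2) primeideal_point_ideal[OF P] by blast
      also have "\<dots> \<longleftrightarrow> (\<exists>a\<in>S. \<tau> a P \<noteq> 0)" using S(1) by (auto simp: point_ideal_def)
      finally show ?thesis .
    qed
    then have "{P \<in> W. point_ideal P \<in> U} = (\<Union>a\<in>S. {P \<in> W. \<tau> a P \<noteq> 0})" by blast
    moreover have "openin Z (\<Union>a\<in>S. {P \<in> W. \<tau> a P \<noteq> 0})"
      using S(1) open_nonzero by (intro openin_Union) blast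
    ultimately show "openin Z {P \<in> W. point_ideal P \<in> U}" by simp
  qed
qed


section \<open>The structure sheaf on the closed points\<close>

text \<open>Equality of germs at \<open>P\<close>, for arbitrary total functions, so that fractions,
  sections and pointwise combinations of them can be compared without keeping track of
  domains.\<close>

definition agree :: "(nat \<Rightarrow> 'k) \<Rightarrow> ((nat \<Rightarrow> 'k) \<Rightarrow> 'k) \<Rightarrow> ((nat \<Rightarrow> 'k) \<Rightarrow> 'k) \<Rightarrow> bool" where
  "agree P f g \<longleftrightarrow> (\<exists>N. openin Z N \<and> P \<in> N \<and> (\<forall>Q\<in>N. f Q = g Q))"

lemma agreeI: "openin Z N \<Longrightarrow> P \<in> N \<Longrightarrow> (\<And>Q. Q \<in> N \<Longrightarrow> f Q = g Q) \<Longrightarrow> agree P f g"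
  by (auto simp: agree_def)

lemma agree_at: "agree P f g \<Longrightarrow> f P = g P"
  by (auto simp: agree_def)

lemma agree_sym: "agree P f g \<Longrightarrow> agree P g f"
  unfolding agree_def by (metis (no_types))

lemma agree_trans: "agree P f g \<Longrightarrow> agree P g h \<Longrightarrow> agree P f h"
  unfolding agree_def by (metis IntD1 IntD2 IntI openin_Int)

lemma agree_op:
  assumes "agree P f f'" "agree P g g'"
  shows "agree P (\<lambda>Q. F (f Q) (g Q)) (\<lambda>Q. F (f' Q) (g' Q))"
proof -
  obtain N N' where "openin Z N" "P \<in> N" "\<forall>Q\<in>N. f Q = f' Q" "openin Z N'" "P \<in> N'" "\<forall>Q\<in>N'. g Q = g' Q"
    using assms unfolding agree_def by blast
  then show ?thesis by (intro agreeI[of "N \<inter> N'"]) auto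
qed

text \<open>\<open>germ_at P f\<close> is the set of all representations of the germ of \<open>f\<close> at \<open>P\<close> as a fraction of global
  functions; these sets are the elements of the localization of \<open>A\<close> at \<open>P\<close>.\<close>

definition germ_at :: "(nat \<Rightarrow> 'k) \<Rightarrow> ((nat \<Rightarrow> 'k) \<Rightarrow> 'k) \<Rightarrow> ('a \<times> 'a) set" where
  "germ_at P f = {(a, s). a \<in> carrier A \<and> s \<in> carrier A \<and> \<tau> s P \<noteq> 0 \<and> agree P f (\<lambda>Q. \<tau> a Q / \<tau> s Q)}"

lemma germ_at_cong: "agree P f g \<Longrightarrow> germ_at P f = germ_at P g"
proof -
  assume fg: "agree P f g"
  have "agree P f h \<longleftrightarrow> agree P g h" for h
    using agree_trans[OF fg] agree_trans[OF agree_sym[OF fg]] by iprover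
  then show ?thesis by (simp add: germ_at_def)
qed

text \<open>If u (t a - s b) = 0, then a/s and b/t agree where u, s and t do not vanish, which is a
  neighbourhood of \<open>P\<close>. Conversely, a polynomial that is nonzero at \<open>P\<close>
  and zero outside a neighbourhood of agreement serves as u.\<close>

lemma loc_frac_eq_germ_at:
  assumes P: "P \<in> W" and a: "a \<in> carrier A" and s: "s \<in> carrier A" "\<tau> s P \<noteq> 0"
  shows "loc_frac A (point_ideal P) a s = germ_at P (\<lambda>Q. \<tau> a Q / \<tau> s Q)"
proof -
  have "(\<exists>u\<in>carrier A - point_ideal P. u \<otimes>\<^bsub>A\<^esub> (t \<otimes>\<^bsub>A\<^esub> a \<ominus>\<^bsub>A\<^esub> s \<otimes>\<^bsub>A\<^esub> b) = \<zero>\<^bsub>A\<^esub>) \<longleftrightarrow>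
      agree P (\<lambda>Q. \<tau> a Q / \<tau> s Q) (\<lambda>Q. \<tau> b Q / \<tau> t Q)" (is "?L \<longleftrightarrow> ?R")
    if b: "b \<in> carrier A" "t \<in> carrier A" "\<tau> t P \<noteq> 0" for b t
  proof
    have ev: "\<tau> (u \<otimes>\<^bsub>A\<^esub> (t \<otimes>\<^bsub>A\<^esub> a \<ominus>\<^bsub>A\<^esub> s \<otimes>\<^bsub>A\<^esub> b)) Q = \<tau> u Q * (\<tau> t Q * \<tau> a Q - \<tau> s Q * \<tau> b Q)"
      if "u \<in> carrier A" "Q \<in> W" for u Q
      using that a s b by (simp add: \<tau>_simps \<tau>_minus)
    show ?R if ?L
    proof -
      obtain u where u: "u \<in> carrier A" "\<tau> u P \<noteq> 0" "u \<otimes>\<^bsub>A\<^esub> (t \<otimes>\<^bsub>A\<^esub> a \<ominus>\<^bsub>A\<^esub> s \<otimes>\<^bsub>A\<^esub> b) = \<zero>\<^bsub>A\<^esub>"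
        using \<open>?L\<close> by (auto simp: point_ideal_def)
      show ?R
      proof (rule agreeI)
        show "openin Z ({Q \<in> W. \<tau> u Q \<noteq> 0} \<inter> ({Q \<in> W. \<tau> s Q \<noteq> 0} \<inter> {Q \<in> W. \<tau> t Q \<noteq> 0}))"
          by (intro openin_Int open_nonzero u s b)
        show "P \<in> {Q \<in> W. \<tau> u Q \<noteq> 0} \<inter> ({Q \<in> W. \<tau> s Q \<noteq> 0} \<inter> {Q \<in> W. \<tau> t Q \<noteq> 0})"
          using P u s b by simp
        fix Q assume "Q \<in> {Q \<in> W. \<tau> u Q \<noteq> 0} \<inter> ({Q \<in> W. \<tau> s Q \<noteq> 0} \<inter> {Q \<in> W. \<tau> t Q \<noteq> 0})"
        then show "\<tau> a Q / \<tau> s Q = \<tau> b Q / \<tau> t Q"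
          using ev[OF u(1), of Q] u(3) by (simp add: \<tau>_simps frac_eq_eq mult.commute)
      qed
    qed
    show ?L if ?R
    proof -
      obtain N where N: "openin Z N" "P \<in> N" "\<forall>Q\<in>N. \<tau> a Q / \<tau> s Q = \<tau> b Q / \<tau> t Q"
        using \<open>?R\<close> unfolding agree_def by blast
      let ?N = "N \<inter> ({Q \<in> W. \<tau> s Q \<noteq> 0} \<inter> {Q \<in> W. \<tau> t Q \<noteq> 0})"
      have oN: "openin Z ?N" by (intro openin_Int open_nonzero N s b)
      have PN: "P \<in> ?N" using N P s b by simp
      obtain h where h: "h \<in> R" "poly_eval h P \<noteq> 0" "\<forall>Q\<in>W - ?N. poly_eval h Q = 0"
        using poly_vanishing_outside_open[OF oN PN] by (elim bexE conjE) rule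
      have "of_poly h \<otimes>\<^bsub>A\<^esub> (t \<otimes>\<^bsub>A\<^esub> a \<ominus>\<^bsub>A\<^esub> s \<otimes>\<^bsub>A\<^esub> b) = \<zero>\<^bsub>A\<^esub>"
      proof (rule \<tau>_eqI)
        fix Q assume Q: "Q \<in> W"
        have "poly_eval h Q * (\<tau> t Q * \<tau> a Q - \<tau> s Q * \<tau> b Q) = 0"
        proof (cases "Q \<in> ?N")
          case True
          then have "\<tau> a Q / \<tau> s Q = \<tau> b Q / \<tau> t Q" "\<tau> s Q \<noteq> 0" "\<tau> t Q \<noteq> 0" using N(3) by auto
          then show ?thesis by (simp add: frac_eq_eq mult.commute)
        qed (use h(3) Q in auto)
        then show "\<tau> (of_poly h \<otimes>\<^bsub>A\<^esub> (t \<otimes>\<^bsub>A\<^esub> a \<ominus>\<^bsub>A\<^esub> s \<otimes>\<^bsub>A\<^esub> b)) Q = \<tau> \<zero>\<^bsub>A\<^esub> Q"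
          using Q by (simp add: ev of_poly h(1) \<tau>_simps)
      qed (use h(1) a s b of_poly in auto)
      moreover have "of_poly h \<in> carrier A - point_ideal P" using h P by (simp add: of_poly point_ideal_def)
      ultimately show ?L by blast
    qed
  qed
  then show ?thesis
    unfolding loc_frac_def germ_at_def by (intro Collect_cong) (auto simp: point_ideal_def)
qed

text \<open>A germ that is no fraction of global functions has no representations, so
  \<open>germ_at\<close> is then empty and tells nothing about the function. This condition makes
  \<open>germ_at\<close> faithful.\<close>

definition fractional :: "(nat \<Rightarrow> 'k) \<Rightarrow> ((nat \<Rightarrow> 'k) \<Rightarrow> 'k) \<Rightarrow> bool" where
  "fractional P f \<longleftrightarrow> germ_at P f \<noteq> {}"

lemma fractionalE:
  assumes "fractional P f"
  obtains a s where "a \<in> carrier A" "s \<in> carrier A" "\<tau> s P \<noteq> 0" "agree P f (\<lambda>Q. \<tau> a Q / \<tau> s Q)"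
    "(a, s) \<in> germ_at P f"
  using assms by (auto simp: fractional_def germ_at_def)

lemma germ_at_eq_iff: "fractional P f \<Longrightarrow> germ_at P f = germ_at P g \<longleftrightarrow> agree P f g"
proof
  assume f: "fractional P f" "germ_at P f = germ_at P g"
  obtain a s where "(a, s) \<in> germ_at P f" "agree P f (\<lambda>Q. \<tau> a Q / \<tau> s Q)" using f(1) by (rule fractionalE)
  then have "(a, s) \<in> germ_at P g" using f(2) by simp
  then have "agree P g (\<lambda>Q. \<tau> a Q / \<tau> s Q)" by (simp add: germ_at_def)
  then show "agree P f g" using \<open>agree P f (\<lambda>Q. \<tau> a Q / \<tau> s Q)\<close> agree_trans agree_sym by blast
qed (rule germ_at_cong)

lemma carrier_localization:
  assumes P: "P \<in> W"
  shows "carrier (localization A (point_ideal P)) = {germ_at P f |f. fractional P f}"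
proof (intro equalityI subsetI)
  fix x assume "x \<in> carrier (localization A (point_ideal P))"
  then obtain a s where as: "x = loc_frac A (point_ideal P) a s" "a \<in> carrier A" "s \<in> carrier A" "\<tau> s P \<noteq> 0"
    by (auto simp: localization_def point_ideal_def)
  then have "x = germ_at P (\<lambda>Q. \<tau> a Q / \<tau> s Q)" using loc_frac_eq_germ_at[OF P as(2-4)] by simp
  moreover have "agree P (\<lambda>Q. \<tau> a Q / \<tau> s Q) (\<lambda>Q. \<tau> a Q / \<tau> s Q)" by (rule agreeI[OF open_W P]) simp
  then have "(a, s) \<in> germ_at P (\<lambda>Q. \<tau> a Q / \<tau> s Q)" using as by (simp add: germ_at_def)
  ultimately show "x \<in> {germ_at P f |f. fractional P f}" unfolding fractional_def by blast
next
  fix x assume "x \<in> {germ_at P f |f. fractional P f}"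
  then obtain f where f: "x = germ_at P f" "fractional P f" by blast
  obtain a s where as: "a \<in> carrier A" "s \<in> carrier A" "\<tau> s P \<noteq> 0" "agree P f (\<lambda>Q. \<tau> a Q / \<tau> s Q)"
    using f(2) by (rule fractionalE)
  have "x = loc_frac A (point_ideal P) a s"
    using loc_frac_eq_germ_at[OF P as(1-3)] germ_at_cong[OF as(4)] f(1) by simp
  then show "x \<in> carrier (localization A (point_ideal P))"
    using as by (auto simp: localization_def point_ideal_def)
qed

text \<open>Every summand of the unions that define the operations of the localization is the same germ.\<close>

lemma localization_binop:
  assumes P: "P \<in> W" and f: "fractional P f" and g: "fractional P g"
    and num: "\<And>a s b t. \<lbrakk>a \<in> carrier A; s \<in> carrier A; b \<in> carrier A; t \<in> carrier A\<rbrakk> \<Longrightarrow> num a s b t \<in> carrier A"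
    and den: "\<And>a s b t Q. \<lbrakk>a \<in> carrier A; s \<in> carrier A; b \<in> carrier A; t \<in> carrier A; Q \<in> W; \<tau> s Q \<noteq> 0; \<tau> t Q \<noteq> 0\<rbrakk>
      \<Longrightarrow> \<tau> (num a s b t) Q / \<tau> (s \<otimes>\<^bsub>A\<^esub> t) Q = F (\<tau> a Q / \<tau> s Q) (\<tau> b Q / \<tau> t Q)"
  shows "(\<Union>(a, s)\<in>germ_at P f. \<Union>(b, t)\<in>germ_at P g. loc_frac A (point_ideal P) (num a s b t) (s \<otimes>\<^bsub>A\<^esub> t)) =
    germ_at P (\<lambda>Q. F (f Q) (g Q))"
proof -
  have eq: "loc_frac A (point_ideal P) (num a s b t) (s \<otimes>\<^bsub>A\<^esub> t) = germ_at P (\<lambda>Q. F (f Q) (g Q))"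
    if "(a, s) \<in> germ_at P f" "(b, t) \<in> germ_at P g" for a s b t
  proof -
    have as: "a \<in> carrier A" "s \<in> carrier A" "\<tau> s P \<noteq> 0" "agree P f (\<lambda>Q. \<tau> a Q / \<tau> s Q)"
      and bt: "b \<in> carrier A" "t \<in> carrier A" "\<tau> t P \<noteq> 0" "agree P g (\<lambda>Q. \<tau> b Q / \<tau> t Q)"
      using that by (auto simp: germ_at_def)
    have "agree P (\<lambda>Q. \<tau> (num a s b t) Q / \<tau> (s \<otimes>\<^bsub>A\<^esub> t) Q) (\<lambda>Q. F (\<tau> a Q / \<tau> s Q) (\<tau> b Q / \<tau> t Q))"
      by (rule agreeI[of "{Q \<in> W. \<tau> s Q \<noteq> 0} \<inter> {Q \<in> W. \<tau> t Q \<noteq> 0}"])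
        (use as bt P den in \<open>auto intro: open_nonzero\<close>)
    moreover have "agree P (\<lambda>Q. F (\<tau> a Q / \<tau> s Q) (\<tau> b Q / \<tau> t Q)) (\<lambda>Q. F (f Q) (g Q))"
      by (rule agree_op[OF agree_sym[OF as(4)] agree_sym[OF bt(4)], where F = F])
    ultimately have ag: "agree P (\<lambda>Q. \<tau> (num a s b t) Q / \<tau> (s \<otimes>\<^bsub>A\<^esub> t) Q) (\<lambda>Q. F (f Q) (g Q))"
      by (rule agree_trans)
    have "loc_frac A (point_ideal P) (num a s b t) (s \<otimes>\<^bsub>A\<^esub> t) = germ_at P (\<lambda>Q. \<tau> (num a s b t) Q / \<tau> (s \<otimes>\<^bsub>A\<^esub> t) Q)"
      by (rule loc_frac_eq_germ_at[OF P]) (use as bt num P in \<open>auto simp: \<tau>_simps\<close>)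
    then show ?thesis using germ_at_cong[OF ag] by simp
  qed
  have ne: "germ_at P f \<noteq> {}" "germ_at P g \<noteq> {}" using f g by (simp_all add: fractional_def)
  have "(\<Union>(a, s)\<in>germ_at P f. \<Union>(b, t)\<in>germ_at P g. loc_frac A (point_ideal P) (num a s b t) (s \<otimes>\<^bsub>A\<^esub> t)) =
      (\<Union>z\<in>germ_at P f. \<Union>w\<in>germ_at P g. germ_at P (\<lambda>Q. F (f Q) (g Q)))"
    by (intro SUP_cong refl) (auto simp: eq)
  then show ?thesis by (simp add: ne)
qed

lemma localization_ops:
  assumes P: "P \<in> W"
  shows "fractional P f \<Longrightarrow> fractional P g \<Longrightarrow>
      germ_at P f \<otimes>\<^bsub>localization A (point_ideal P)\<^esub> germ_at P g = germ_at P (\<lambda>Q. f Q * g Q)"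
    "fractional P f \<Longrightarrow> fractional P g \<Longrightarrow>
      germ_at P f \<oplus>\<^bsub>localization A (point_ideal P)\<^esub> germ_at P g = germ_at P (\<lambda>Q. f Q + g Q)"
    "fractional P f \<Longrightarrow> c \<odot>\<^bsub>localization A (point_ideal P)\<^esub> germ_at P f = germ_at P (\<lambda>Q. c * f Q)"
    "\<one>\<^bsub>localization A (point_ideal P)\<^esub> = germ_at P (\<lambda>Q. 1)"
    "\<zero>\<^bsub>localization A (point_ideal P)\<^esub> = germ_at P (\<lambda>Q. 0)"
proof -
  show "germ_at P f \<otimes>\<^bsub>localization A (point_ideal P)\<^esub> germ_at P g = germ_at P (\<lambda>Q. f Q * g Q)"
    if "fractional P f" "fractional P g"
    using localization_binop[OF P that, of "\<lambda>a s b t. a \<otimes>\<^bsub>A\<^esub> b" "(*)"]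
    by (simp add: localization_def \<tau>_simps)
  show "germ_at P f \<oplus>\<^bsub>localization A (point_ideal P)\<^esub> germ_at P g = germ_at P (\<lambda>Q. f Q + g Q)"
    if "fractional P f" "fractional P g"
    using localization_binop[OF P that, of "\<lambda>a s b t. t \<otimes>\<^bsub>A\<^esub> a \<oplus>\<^bsub>A\<^esub> s \<otimes>\<^bsub>A\<^esub> b" "(+)"]
    by (simp add: localization_def \<tau>_simps add_frac_eq mult.commute)
  show "c \<odot>\<^bsub>localization A (point_ideal P)\<^esub> germ_at P f = germ_at P (\<lambda>Q. c * f Q)" if f: "fractional P f"
  proof -
    have eq: "loc_frac A (point_ideal P) (c \<odot>\<^bsub>A\<^esub> a) s = germ_at P (\<lambda>Q. c * f Q)"
      if "(a, s) \<in> germ_at P f" for a s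
    proof -
      have as: "a \<in> carrier A" "s \<in> carrier A" "\<tau> s P \<noteq> 0" "agree P f (\<lambda>Q. \<tau> a Q / \<tau> s Q)"
        using that by (auto simp: germ_at_def)
      have "agree P (\<lambda>Q. \<tau> (c \<odot>\<^bsub>A\<^esub> a) Q / \<tau> s Q) (\<lambda>Q. c * (\<tau> a Q / \<tau> s Q))"
        by (rule agreeI[OF open_W P]) (use as in \<open>simp add: \<tau>_simps\<close>)
      moreover have "agree P (\<lambda>Q. c * (\<tau> a Q / \<tau> s Q)) (\<lambda>Q. c * f Q)"
        using agree_op[OF agree_sym[OF as(4)] agree_sym[OF as(4)], of "\<lambda>x y. c * x"] .
      ultimately have "agree P (\<lambda>Q. \<tau> (c \<odot>\<^bsub>A\<^esub> a) Q / \<tau> s Q) (\<lambda>Q. c * f Q)" by (rule agree_trans)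
      then show ?thesis
        using loc_frac_eq_germ_at[OF P smult_closed[OF as(1)] as(2,3)] germ_at_cong by simp
    qed
    obtain z where z: "z \<in> germ_at P f" using f by (auto simp: fractional_def)
    have "(\<Union>(a, s)\<in>germ_at P f. loc_frac A (point_ideal P) (c \<odot>\<^bsub>A\<^esub> a) s) =
        (\<Union>z\<in>germ_at P f. germ_at P (\<lambda>Q. c * f Q))"
      by (intro SUP_cong refl) (auto simp: eq)
    then show ?thesis using z by (auto simp: localization_def)
  qed
  have "loc_frac A (point_ideal P) \<one>\<^bsub>A\<^esub> \<one>\<^bsub>A\<^esub> = germ_at P (\<lambda>Q. 1)"
    "loc_frac A (point_ideal P) \<zero>\<^bsub>A\<^esub> \<one>\<^bsub>A\<^esub> = germ_at P (\<lambda>Q. 0)"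
    using loc_frac_eq_germ_at[OF P A.one_closed A.one_closed]
      loc_frac_eq_germ_at[OF P A.zero_closed A.one_closed]
      germ_at_cong[OF agreeI[OF open_W P, of "\<lambda>Q. \<tau> \<one>\<^bsub>A\<^esub> Q / \<tau> \<one>\<^bsub>A\<^esub> Q" "\<lambda>Q. 1"]]
      germ_at_cong[OF agreeI[OF open_W P, of "\<lambda>Q. \<tau> \<zero>\<^bsub>A\<^esub> Q / \<tau> \<one>\<^bsub>A\<^esub> Q" "\<lambda>Q. 0"]]
    by (simp_all add: \<tau>_simps P)
  then show "\<one>\<^bsub>localization A (point_ideal P)\<^esub> = germ_at P (\<lambda>Q. 1)"
    "\<zero>\<^bsub>localization A (point_ideal P)\<^esub> = germ_at P (\<lambda>Q. 0)"
    by (simp_all add: localization_def)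
qed

section \<open>Regular functions as sections over the closed points\<close>

lemma regular_local_fraction:
  assumes "f \<in> regular_functions n W U" "P \<in> U"
  shows "\<exists>N a b. openin Z N \<and> P \<in> N \<and> N \<subseteq> U \<and> a \<in> carrier A \<and> b \<in> carrier A \<and>
    (\<forall>Q\<in>N. \<tau> b Q \<noteq> 0 \<and> f Q = \<tau> a Q / \<tau> b Q)"
proof -
  obtain N g l where N: "openin Z N" "P \<in> N" "N \<subseteq> U" "g \<in> R" "l \<in> R"
    "\<forall>Q\<in>N. poly_eval l Q \<noteq> 0 \<and> f Q = poly_eval g Q / poly_eval l Q"
    using assms unfolding regular_functions_iff[OF W_affine] by blast
  then show ?thesis
    using open_subset[OF N(1)] of_poly
    by (intro exI[of _ N] exI[of _ "of_poly g"] exI[of _ "of_poly l"]) (auto simp: subset_iff)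
qed

text \<open>Numerator and denominator are themselves quotients of polynomials near \<open>P\<close>,
  and (g/l)/(h/m) = (g m)/(l h); h has no zeros there because the denominator has none.\<close>

lemma local_fraction_regular:
  assumes f: "f \<in> U \<rightarrow>\<^sub>E UNIV"
    and loc: "\<And>P. P \<in> U \<Longrightarrow> \<exists>N a b. openin Z N \<and> P \<in> N \<and> N \<subseteq> U \<and> a \<in> carrier A \<and> b \<in> carrier A \<and>
      (\<forall>Q\<in>N. \<tau> b Q \<noteq> 0 \<and> f Q = \<tau> a Q / \<tau> b Q)"
  shows "f \<in> regular_functions n W U"
  unfolding regular_functions_iff[OF W_affine]
proof (intro conjI f ballI)
  fix P assume "P \<in> U"
  from loc[OF this] obtain N a b where N: "openin Z N" "P \<in> N" "N \<subseteq> U" "a \<in> carrier A" "b \<in> carrier A"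
    "\<And>Q. Q \<in> N \<Longrightarrow> \<tau> b Q \<noteq> 0 \<and> f Q = \<tau> a Q / \<tau> b Q" by blast
  have P: "P \<in> W" using N(2) open_subset[OF N(1)] by blast
  obtain N1 g l where N1: "openin Z N1" "P \<in> N1" "g \<in> R" "l \<in> R"
    "\<And>Q. Q \<in> N1 \<Longrightarrow> poly_eval l Q \<noteq> 0 \<and> \<tau> a Q = poly_eval g Q / poly_eval l Q"
    using \<tau>_local[OF N(4) P] by blast
  obtain N2 h m where N2: "openin Z N2" "P \<in> N2" "h \<in> R" "m \<in> R"
    "\<And>Q. Q \<in> N2 \<Longrightarrow> poly_eval m Q \<noteq> 0 \<and> \<tau> b Q = poly_eval h Q / poly_eval m Q"
    using \<tau>_local[OF N(5) P] by blast
  show "\<exists>N. openin Z N \<and> P \<in> N \<and> N \<subseteq> U \<and> (\<exists>g\<in>R. \<exists>l\<in>R. \<forall>Q\<in>N. poly_eval l Q \<noteq> 0 \<and>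
      f Q = poly_eval g Q / poly_eval l Q)"
  proof (intro exI[of _ "N \<inter> (N1 \<inter> N2)"] conjI, goal_cases)
    case 4
    show ?case
    proof (rule bexI[of _ "g * m"], rule bexI[of _ "l * h"], intro ballI conjI)
      fix Q assume "Q \<in> N \<inter> (N1 \<inter> N2)"
      then have q: "\<tau> b Q \<noteq> 0" "f Q = \<tau> a Q / \<tau> b Q" "poly_eval l Q \<noteq> 0" "\<tau> a Q = poly_eval g Q / poly_eval l Q"
        "poly_eval m Q \<noteq> 0" "\<tau> b Q = poly_eval h Q / poly_eval m Q"
        using N(6)[of Q] N1(5)[of Q] N2(5)[of Q] by blast+
      have "poly_eval h Q \<noteq> 0" using q(1,6) by auto
      then show "poly_eval (l * h) Q \<noteq> 0" using q(3) by (simp add: poly_eval_mult)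
      show "f Q = poly_eval (g * m) Q / poly_eval (l * h) Q"
        by (simp add: q(2,4,6) poly_eval_mult)
    qed (intro mpoly_ring_mult_closed N1 N2)+
  qed (use N N1 N2 in auto)
qed

lemma regular_fractional:
  assumes "f \<in> regular_functions n W U" "P \<in> U"
  shows "fractional P f"
proof -
  obtain N a b where N: "openin Z N" "P \<in> N" "a \<in> carrier A" "b \<in> carrier A"
    "\<And>Q. Q \<in> N \<Longrightarrow> \<tau> b Q \<noteq> 0 \<and> f Q = \<tau> a Q / \<tau> b Q"
    using regular_local_fraction[OF assms] by blast
  then have "(a, b) \<in> germ_at P f" by (auto simp: germ_at_def intro: agreeI)
  then show ?thesis by (auto simp: fractional_def)
qed

definition to_point :: "'a set \<Rightarrow> nat \<Rightarrow> 'k" where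
  "to_point = inv_into W point_ideal"

lemma to_point: "P \<in> W \<Longrightarrow> to_point (point_ideal P) = P"
  unfolding to_point_def by (rule inv_into_f_f[OF inj_point_ideal])

text \<open>The isomorphism of sheaves: the value at the ideal of \<open>P\<close> is the germ of
  \<open>f\<close> at \<open>P\<close>, read as an element of the localization.\<close>

definition germs :: "(nat \<Rightarrow> 'k) set \<Rightarrow> ((nat \<Rightarrow> 'k) \<Rightarrow> 'k) \<Rightarrow> 'a set \<Rightarrow> ('a \<times> 'a) set" where
  "germs U f = (\<lambda>p\<in>point_ideal ` U. germ_at (to_point p) f)"

lemma germs_apply: "U \<subseteq> W \<Longrightarrow> P \<in> U \<Longrightarrow> germs U f (point_ideal P) = germ_at P f"
  using to_point by (auto simp: germs_def)

lemma germs_eqI: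
  assumes U: "U \<subseteq> W" and s: "s \<in> extensional (point_ideal ` U)"
    and eq: "\<And>P. P \<in> U \<Longrightarrow> germ_at P f = s (point_ideal P)"
  shows "germs U f = s"
proof (rule extensionalityI[OF _ s])
  show "germs U f \<in> extensional (point_ideal ` U)" by (simp add: germs_def)
  fix p assume "p \<in> point_ideal ` U"
  then show "germs U f p = s p" using eq germs_apply[OF U] by auto
qed

lemma open_image_Z0: "openin Z N \<Longrightarrow> openin Z0 (point_ideal ` N)"
  using homeomorphic_map_openness_eq[OF point_ideal_homeo, of N] by blast

lemma germs_in_spec_sections:
  assumes U: "openin Z U" and f: "f \<in> regular_functions n W U"
  shows "germs U f \<in> spec_sections A (point_ideal ` W) (point_ideal ` U)"
  unfolding spec_sections_def
proof (intro CollectI conjI ballI PiE_I)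
  note UW = open_subset[OF U]
  fix p assume "p \<in> point_ideal ` U"
  then obtain P where P: "P \<in> U" "p = point_ideal P" by blast
  have PW: "P \<in> W" using P UW by blast
  show "germs U f p \<in> carrier (localization A p)"
    using regular_fractional[OF f P(1)] by (auto simp: P(2) germs_apply[OF UW P(1)] carrier_localization[OF PW])
  obtain N a b where N: "openin Z N" "P \<in> N" "N \<subseteq> U" "a \<in> carrier A" "b \<in> carrier A"
    "\<And>Q. Q \<in> N \<Longrightarrow> \<tau> b Q \<noteq> 0 \<and> f Q = \<tau> a Q / \<tau> b Q"
    using regular_local_fraction[OF f P(1)] by blast
  have "b \<notin> q \<and> germs U f q = loc_frac A q a b" if q: "q \<in> point_ideal ` N" for q
  proof -
    obtain Q where Q: "Q \<in> N" "q = point_ideal Q" using q by blast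
    have QW: "Q \<in> W" "Q \<in> U" using Q N(3) UW by blast+
    have b: "\<tau> b Q \<noteq> 0" using N(6) Q by blast
    have "agree Q f (\<lambda>Q. \<tau> a Q / \<tau> b Q)" by (rule agreeI[OF N(1) Q(1)]) (use N(6) in blast)
    then have "germs U f q = loc_frac A q a b"
      using germ_at_cong loc_frac_eq_germ_at[OF QW(1) N(4,5) b] germs_apply[OF UW QW(2)] by (simp add: Q(2))
    then show ?thesis using b by (simp add: Q(2) point_ideal_def)
  qed
  then show "\<exists>U'. openin Z0 U' \<and> p \<in> U' \<and> U' \<subseteq> point_ideal ` U \<and>
      (\<exists>a\<in>carrier A. \<exists>b\<in>carrier A. \<forall>q\<in>U'. b \<notin> q \<and> germs U f q = loc_frac A q a b)"
    using open_image_Z0[OF N(1)] N(2-5) P(2) by (intro exI[of _ "point_ideal ` N"]) blast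
qed (simp add: germs_def)

text \<open>An element of the localization at a point has a value at that point, given by any
  fraction representing it; these values make up \<open>f\<close>. On an open set where
  \<open>s\<close> is given by a/b, \<open>f\<close> equals a/b as well, so it is regular and its
  germs are those prescribed by \<open>s\<close>.\<close>

lemma spec_sections_germs:
  assumes U: "openin Z U" and s: "s \<in> spec_sections A (point_ideal ` W) (point_ideal ` U)"
  shows "\<exists>f\<in>regular_functions n W U. germs U f = s"
proof -
  note UW = open_subset[OF U]
  have loc: "\<exists>N a b. openin Z N \<and> P \<in> N \<and> N \<subseteq> U \<and> a \<in> carrier A \<and> b \<in> carrier A \<and>
      (\<forall>Q\<in>N. \<tau> b Q \<noteq> 0 \<and> s (point_ideal Q) = germ_at Q (\<lambda>Q. \<tau> a Q / \<tau> b Q))" if P: "P \<in> U" for P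
  proof -
    have "\<forall>p\<in>point_ideal ` U. \<exists>U'. openin Z0 U' \<and> p \<in> U' \<and> U' \<subseteq> point_ideal ` U \<and>
        (\<exists>a\<in>carrier A. \<exists>b\<in>carrier A. \<forall>q\<in>U'. b \<notin> q \<and> s q = loc_frac A q a b)"
      using s unfolding spec_sections_def mem_Collect_eq by (rule conjunct2)
    from this[THEN bspec, OF imageI[OF P]] obtain U' a b where U': "openin Z0 U'" "point_ideal P \<in> U'" "U' \<subseteq> point_ideal ` U"
      and ab: "a \<in> carrier A" "b \<in> carrier A" "\<forall>q\<in>U'. b \<notin> q \<and> s q = loc_frac A q a b"
      by (elim exE bexE conjE) (rule that)
    define N where "N = {Q \<in> W. point_ideal Q \<in> U'}"
    have oN: "openin Z N"
      using openin_continuous_map_preimage[OF homeomorphic_imp_continuous_map[OF point_ideal_homeo] U'(1)]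
      by (simp add: N_def topspace_Z)
    have PN: "P \<in> N" using P UW U' by (auto simp: N_def)
    have NU: "N \<subseteq> U"
      using U'(3) inj_on_image_mem_iff[OF inj_point_ideal _ UW] by (auto simp: N_def)
    have "\<tau> b Q \<noteq> 0 \<and> s (point_ideal Q) = germ_at Q (\<lambda>Q. \<tau> a Q / \<tau> b Q)" if "Q \<in> N" for Q
    proof -
      have Q: "Q \<in> W" "b \<notin> point_ideal Q" "s (point_ideal Q) = loc_frac A (point_ideal Q) a b"
        using that ab(3) by (auto simp: N_def)
      then have "\<tau> b Q \<noteq> 0" using ab(2) by (simp add: point_ideal_def)
      then show ?thesis using loc_frac_eq_germ_at[OF Q(1) ab(1,2)] Q(3) by simp
    qed
    then show ?thesis
      using oN PN NU ab(1,2) by (intro exI[of _ N] exI[of _ a] exI[of _ b]) simp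
  qed
  \<comment> \<open>All fractions that represent a germ at \<open>Q\<close> have the same value
    there, so the arbitrary choice does no harm.\<close>
  define v where "v x Q = (case (SOME z. z \<in> x) of (a, b) \<Rightarrow> \<tau> a Q / \<tau> b Q)" for x :: "('a \<times> 'a) set" and Q
  define f where "f = (\<lambda>Q\<in>U. v (s (point_ideal Q)) Q)"
  have v: "v (germ_at Q g) Q = g Q" if "fractional Q g" for Q g
  proof -
    have "(SOME z. z \<in> germ_at Q g) \<in> germ_at Q g"
      using that by (simp add: fractional_def some_in_eq)
    moreover obtain a b where ab: "(SOME z. z \<in> germ_at Q g) = (a, b)" by (rule prod.exhaust)
    ultimately have "(a, b) \<in> germ_at Q g" by simp
    then have "agree Q g (\<lambda>Q. \<tau> a Q / \<tau> b Q)" by (simp add: germ_at_def)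
    from agree_at[OF this] show ?thesis by (simp add: v_def ab)
  qed
  have fl: "\<exists>N a b. openin Z N \<and> P \<in> N \<and> N \<subseteq> U \<and> a \<in> carrier A \<and> b \<in> carrier A \<and>
      (\<forall>Q\<in>N. \<tau> b Q \<noteq> 0 \<and> s (point_ideal Q) = germ_at Q (\<lambda>Q. \<tau> a Q / \<tau> b Q) \<and> f Q = \<tau> a Q / \<tau> b Q)"
    if P: "P \<in> U" for P
  proof -
    obtain N a b where N: "openin Z N" "P \<in> N" "N \<subseteq> U" "a \<in> carrier A" "b \<in> carrier A"
      "\<And>Q. Q \<in> N \<Longrightarrow> \<tau> b Q \<noteq> 0 \<and> s (point_ideal Q) = germ_at Q (\<lambda>Q. \<tau> a Q / \<tau> b Q)"
      using loc[OF P] by blast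
    have "f Q = \<tau> a Q / \<tau> b Q" if Q: "Q \<in> N" for Q
    proof -
      have "agree Q (\<lambda>Q. \<tau> a Q / \<tau> b Q) (\<lambda>Q. \<tau> a Q / \<tau> b Q)" by (rule agreeI[OF N(1) Q]) simp
      then have "fractional Q (\<lambda>Q. \<tau> a Q / \<tau> b Q)"
        using N(4,5) N(6)[OF Q] by (auto simp: fractional_def germ_at_def)
      then show ?thesis using v N(3) N(6)[OF Q] Q by (auto simp: f_def)
    qed
    then show ?thesis using N by (intro exI[of _ N] exI[of _ a] exI[of _ b]) simp
  qed
  have "f \<in> regular_functions n W U"
  proof (rule local_fraction_regular)
    show "f \<in> U \<rightarrow>\<^sub>E UNIV" by (simp add: f_def)
    fix P assume "P \<in> U"
    from fl[OF this] show "\<exists>N a b. openin Z N \<and> P \<in> N \<and> N \<subseteq> U \<and> a \<in> carrier A \<and> b \<in> carrier A \<and>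
      (\<forall>Q\<in>N. \<tau> b Q \<noteq> 0 \<and> f Q = \<tau> a Q / \<tau> b Q)" by blast
  qed
  moreover have "germs U f = s"
  proof (rule germs_eqI[OF UW])
    show "s \<in> extensional (point_ideal ` U)" using s by (auto simp: spec_sections_def PiE_def)
    fix P assume "P \<in> U"
    from fl[OF this] obtain N a b where N: "openin Z N" "P \<in> N"
      "\<And>Q. Q \<in> N \<Longrightarrow> s (point_ideal Q) = germ_at Q (\<lambda>Q. \<tau> a Q / \<tau> b Q) \<and> f Q = \<tau> a Q / \<tau> b Q" by blast
    have "agree P f (\<lambda>Q. \<tau> a Q / \<tau> b Q)" by (rule agreeI[OF N(1,2)]) (use N(3) in blast)
    then show "germ_at P f = s (point_ideal P)" using germ_at_cong N(3)[OF N(2)] by simp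
  qed
  ultimately show ?thesis by blast
qed

lemma spec_restriction_simps:
  "points (spec_restriction A (point_ideal ` W)) = Z0"
  "res (spec_restriction A (point_ideal ` W)) U N s = restrict s N"
  "carrier (sect (spec_restriction A (point_ideal ` W)) U) = spec_sections A (point_ideal ` W) U"
  "s \<otimes>\<^bsub>sect (spec_restriction A (point_ideal ` W)) U\<^esub> t = (\<lambda>p\<in>U. s p \<otimes>\<^bsub>localization A p\<^esub> t p)"
  "s \<oplus>\<^bsub>sect (spec_restriction A (point_ideal ` W)) U\<^esub> t = (\<lambda>p\<in>U. s p \<oplus>\<^bsub>localization A p\<^esub> t p)"
  "\<one>\<^bsub>sect (spec_restriction A (point_ideal ` W)) U\<^esub> = (\<lambda>p\<in>U. \<one>\<^bsub>localization A p\<^esub>)"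
  "\<zero>\<^bsub>sect (spec_restriction A (point_ideal ` W)) U\<^esub> = (\<lambda>p\<in>U. \<zero>\<^bsub>localization A p\<^esub>)"
  "c \<odot>\<^bsub>sect (spec_restriction A (point_ideal ` W)) U\<^esub> s = (\<lambda>p\<in>U. c \<odot>\<^bsub>localization A p\<^esub> s p)"
  by (simp_all add: spec_restriction_def pointwise_algebra_def)

text \<open>A germ determines the value at its point, which gives injectivity, and the operations of
  the localization are pointwise operations on germs by \<open>localization_ops\<close>.\<close>

lemma germs_alg_iso:
  assumes U: "openin Z U"
  shows "alg_iso (sect (subvariety_space n W) U) (sect (spec_restriction A (point_ideal ` W)) (point_ideal ` U)) (germs U)"
proof -
  note UW = open_subset[OF U]
  have fr: "fractional P f" if "f \<in> regular_functions n W U" "P \<in> U" for f P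
    by (rule regular_fractional[OF that])
  \<comment> \<open>The pointwise operations on sections truncate their results to \<open>U\<close>;
    this leaves the germs at points of \<open>U\<close> unchanged.\<close>
  have cong: "germ_at P (\<lambda>Q\<in>U. f Q) = germ_at P f" if "P \<in> U" for P f
    by (rule germ_at_cong, rule agreeI[OF U that]) simp
  have hom: "germs U \<in> alg_hom (sect (subvariety_space n W) U)
      (sect (spec_restriction A (point_ideal ` W)) (point_ideal ` U))"
    unfolding alg_hom_def
  proof (intro CollectI conjI allI ballI ring_hom_memI)
    fix f assume f: "f \<in> carrier (sect (subvariety_space n W) U)"
    then show "germs U f \<in> carrier (sect (spec_restriction A (point_ideal ` W)) (point_ideal ` U))"
      by (simp add: sect_simps spec_restriction_simps germs_in_spec_sections[OF U])
    show "germs U (c \<odot>\<^bsub>sect (subvariety_space n W) U\<^esub> f) =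
        c \<odot>\<^bsub>sect (spec_restriction A (point_ideal ` W)) (point_ideal ` U)\<^esub> germs U f" for c
      unfolding sect_simps spec_restriction_simps
      by (rule germs_eqI[OF UW]) (use f UW in \<open>auto simp: sect_simps germs_apply[OF UW] localization_ops fr cong subset_iff\<close>)
    fix g assume g: "g \<in> carrier (sect (subvariety_space n W) U)"
    show "germs U (f \<otimes>\<^bsub>sect (subvariety_space n W) U\<^esub> g) =
        germs U f \<otimes>\<^bsub>sect (spec_restriction A (point_ideal ` W)) (point_ideal ` U)\<^esub> germs U g"
      unfolding sect_simps spec_restriction_simps
      by (rule germs_eqI[OF UW]) (use f g UW in \<open>auto simp: sect_simps germs_apply[OF UW] localization_ops fr cong subset_iff\<close>)
    show "germs U (f \<oplus>\<^bsub>sect (subvariety_space n W) U\<^esub> g) =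
        germs U f \<oplus>\<^bsub>sect (spec_restriction A (point_ideal ` W)) (point_ideal ` U)\<^esub> germs U g"
      unfolding sect_simps spec_restriction_simps
      by (rule germs_eqI[OF UW]) (use f g UW in \<open>auto simp: sect_simps germs_apply[OF UW] localization_ops fr cong subset_iff\<close>)
  next
    show "germs U \<one>\<^bsub>sect (subvariety_space n W) U\<^esub> =
        \<one>\<^bsub>sect (spec_restriction A (point_ideal ` W)) (point_ideal ` U)\<^esub>"
      unfolding sect_simps spec_restriction_simps
      by (rule germs_eqI[OF UW]) (use UW in \<open>auto simp: localization_ops cong subset_iff\<close>)
  qed
  moreover have "bij_betw (germs U) (regular_functions n W U) (spec_sections A (point_ideal ` W) (point_ideal ` U))"
    unfolding bij_betw_def
  proof (intro conjI equalityI subsetI)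
    show "inj_on (germs U) (regular_functions n W U)"
    proof (rule inj_onI)
      fix f g assume fg: "f \<in> regular_functions n W U" "g \<in> regular_functions n W U" "germs U f = germs U g"
      have "f P = g P" if P: "P \<in> U" for P
      proof -
        have "germ_at P f = germ_at P g" using germs_apply[OF UW P] fg(3) by metis
        then show ?thesis using germ_at_eq_iff[OF fr[OF fg(1) P]] agree_at by blast
      qed
      then show "f = g" using fg(1,2) by (auto simp: regular_functions_def intro: PiE_ext)
    qed
  next
    fix s assume "s \<in> germs U ` regular_functions n W U"
    then show "s \<in> spec_sections A (point_ideal ` W) (point_ideal ` U)" using germs_in_spec_sections[OF U] by blast
  next
    fix s assume "s \<in> spec_sections A (point_ideal ` W) (point_ideal ` U)"
    then show "s \<in> germs U ` regular_functions n W U" using spec_sections_germs[OF U] by blast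
  qed
  moreover have "germs U \<zero>\<^bsub>sect (subvariety_space n W) U\<^esub> =
        \<zero>\<^bsub>sect (spec_restriction A (point_ideal ` W)) (point_ideal ` U)\<^esub>"
      unfolding sect_simps spec_restriction_simps
      by (rule germs_eqI[OF UW]) (use UW in \<open>auto simp: localization_ops cong subset_iff\<close>)
  ultimately show ?thesis by (simp add: alg_iso_def sect_simps spec_restriction_simps)
qed

lemma germs_sheaf_iso:
  "sheaf_iso (subvariety_space n W) (spec_restriction A (point_ideal ` W)) point_ideal germs"
proof -
  have pts: "points (subvariety_space n W) = Z" "res (subvariety_space n W) U N f = restrict f N" for U N f
    by (simp_all add: subvariety_space_def)
  have "germs N (restrict f N) = restrict (germs U f) (point_ideal ` N)"
    if N: "openin Z N" "N \<subseteq> U" "openin Z U" for N U f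
  proof (rule germs_eqI[OF open_subset[OF N(1)]])
    fix P assume P: "P \<in> N"
    have "germ_at P (restrict f N) = germ_at P f" by (rule germ_at_cong, rule agreeI[OF N(1) P]) simp
    then show "germ_at P (restrict f N) = restrict (germs U f) (point_ideal ` N) (point_ideal P)"
      using P N(2) germs_apply[OF open_subset[OF N(3)], of P f] by auto
  qed simp
  then show ?thesis
    unfolding sheaf_iso_def pts spec_restriction_simps
    using point_ideal_homeo germs_alg_iso by blast
qed

end

section \<open>Passage to an arbitrary equivariety\<close>

theorem proposition5p21:
  fixes V :: "('k::field, 'p, 's) ringed_space"
  assumes "affine_algebraic_equivariety V"
  shows "\<exists>A :: ('k, 's) module. k_algebra A \<and>
    (let Z = Spec A; Z0 = closed_points Z in
       points Z closure_of Z0 = topspace (points Z) \<and>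
       lrs_isomorphic V (spec_restriction A Z0))"
proof -
  obtain n W where lV: "locally_ringed_space V" and W: "affine_algebraic_subvariety n W"
    and iso: "lrs_isomorphic V (subvariety_space n W)"
    using assms by (auto simp: affine_algebraic_equivariety_def)
  have pre: "presheaf_of_algebras V"
    using lV by (simp add: locally_ringed_space_def sheaf_of_algebras_def)
  obtain \<phi> \<chi> where si: "sheaf_iso V (subvariety_space n W) \<phi> \<chi>"
    using lrs_isomorphic_imp_sheaf_iso[OF iso] by blast
  interpret VW: sheaf_isomorphism V "subvariety_space n W" \<phi> \<chi> by unfold_locales (rule pre si)+
  \<comment> \<open>The global sections of \<open>V\<close> itself rather than of its model, so that
    the elements have the required type; \<chi> on the whole space identifies them with regular
    functions on \<open>W\<close>.\<close>
  define A where "A = sect V (topspace (points V))"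
  have A: "k_algebra A" unfolding A_def by (rule VW.E_algebra) simp
  have "W \<subseteq> affine_space n" using W by (auto simp: affine_algebraic_subvariety_def zero_set_def)
  then have "openin (zariski_topology n W) U \<Longrightarrow> U \<subseteq> W" "openin (zariski_topology n W) W" for U
    using mpoly_ring_one[of n]
    by (auto simp: openin_zariski zero_set_def poly_eval_simps intro!: exI[of _ "{1}"])
  then have "topspace (zariski_topology n W) = W" by (meson openin_subset openin_topspace subset_antisym)
  then have top: "\<phi> ` topspace (points V) = W" using VW.phi_surj by (simp add: subvariety_space_def)
  have "alg_iso A (sect (subvariety_space n W) W) (\<chi> (topspace (points V)))"
    using VW.chi_iso[of "topspace (points V)"] by (simp add: A_def top)
  then interpret G: global_functions n W A "\<chi> (topspace (points V))"
    by (rule global_functions.intro[OF W A])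
  \<comment> \<open>The two isomorphisms are composed as \<open>sheaf_iso\<close>; since
    \<open>V\<close> is locally ringed, so is the space of closed points, and the composite yields
    morphisms in both directions.\<close>
  have "lrs_isomorphic V (spec_restriction A (closed_points (Spec A)))"
    unfolding G.closed_points_Spec
    by (rule sheaf_iso_imp_lrs_isomorphic[OF lV sheaf_iso_trans[OF pre si G.germs_sheaf_iso]])
  then show ?thesis using A G.closed_points_dense by (auto simp: Let_def)
qed

end
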